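(* Let $\Gamma\subset\mathbb C$ be a chord-arc curve and $0<s<1$. Then the Calderón–Plemelj property holds for $H^s(\Gamma)$, i.e. the Cauchy integral operator $$Tf(z)=\frac1{2\pi i}\,\mathrm{P.V.}\int_\Gamma\frac{f(\zeta)}{\zeta-z}\,d\zeta,\qquad z\in\Gamma,$$ is bounded on $H^s(\Gamma)$: there is a constant $C>0$ such that $\|Tf\|_{H^s(\Gamma)}\le C\|f\|_{H^s(\Gamma)}$ for all $f\in H^s(\Gamma)$.
   Context: A chord-arc curve is a bounded Jordan curve $\Gamma$ that is the image of the unit circle under a bi-Lipschitz homeomorphism of the plane; equivalently, $\Gamma$ is rectifiable and there is $K\ge1$ such that for all $z_1,z_2\in\Gamma$ the shorter of the two subarcs of $\Gamma$ with endpoints $z_1,z_2$ has length at most $K|z_1-z_2|$. $d\sigma$ is arc-length measure. For $0<s<1$, $H^s(\Gamma)$ is the space of functions $f\in L^2(\Gamma,d\sigma)$ with $$\|f\|_{H^s(\Gamma)}^2=\iint_{\Gamma\times\Gamma}\frac{|f(z)-f(\zeta)|^2}{|z-\zeta|^{1+2s}}\,d\sigma(z)\,d\sigma(\zeta)<\infty ,$$ which is a norm modulo constants. The principal value is $\lim_{\varepsilon\to0}\int_{\zeta\in\Gamma,\,|\zeta-z|>\varepsilon}$, which exists for $\sigma$-almost every $z\in\Gamma$. *)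

theory Defs
  imports "HOL-Analysis.Analysis"
begin

definition chord_arc_curve :: "complex set \<Rightarrow> bool" where
  "chord_arc_curve \<Gamma> \<longleftrightarrow>
     (\<exists>(F :: complex \<Rightarrow> complex) G L. homeomorphism UNIV UNIV F G \<and>
        lipschitz_on L UNIV F \<and> lipschitz_on L UNIV G \<and> \<Gamma> = F ` sphere 0 1)"

text \<open>The supremum of the lengths of inscribed polygons; the list holds the partition points.\<close>

definition curve_length :: "(real \<Rightarrow> complex) \<Rightarrow> real \<Rightarrow> real \<Rightarrow> ennreal" where
  "curve_length \<gamma> a b =
     (SUP ts \<in> {ts. sorted ts \<and> set ts \<subseteq> {a..b}}.
        \<Sum>i<length ts - 1. ennreal (dist (\<gamma> (ts ! i)) (\<gamma> (ts ! Suc i))))"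

text \<open>Parametrization of a Jordan curve of length \<open>len\<close> by arc length, in either orientation.\<close>

definition arc_length_parametrization ::
    "(real \<Rightarrow> complex) \<Rightarrow> real \<Rightarrow> complex set \<Rightarrow> bool" where
  "arc_length_parametrization \<gamma> len \<Gamma> \<longleftrightarrow>
     0 < len \<and> continuous_on {0..len} \<gamma> \<and> inj_on \<gamma> {0..<len} \<and> \<gamma> len = \<gamma> 0 \<and>
     \<gamma> ` {0..len} = \<Gamma> \<and> (\<forall>t\<in>{0..len}. curve_length \<gamma> 0 t = ennreal t)"

text \<open>Arc-length measure, as a Borel measure on the plane that is concentrated on the curve.\<close>

definition arc_length_measure :: "(real \<Rightarrow> complex) \<Rightarrow> real \<Rightarrow> complex measure" where
  "arc_length_measure \<gamma> len = distr (restrict_space lborel {0..len}) borel \<gamma>"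

text \<open>
  In the energy the diagonal contributes \<open>0 / 0 = 0\<close>; it is a null set.  Elements of the spaces
  \<open>L\<^sup>2\<close> and \<open>H\<^sup>s\<close> are represented by Borel functions on the plane, whose values off the
  curve are irrelevant.
\<close>

definition Hs_energy :: "complex measure \<Rightarrow> real \<Rightarrow> (complex \<Rightarrow> complex) \<Rightarrow> ennreal" where
  "Hs_energy \<sigma> s f =
     (\<integral>\<^sup>+ z. (\<integral>\<^sup>+ \<zeta>. ennreal ((cmod (f z - f \<zeta>))\<^sup>2 / cmod (z - \<zeta>) powr (1 + 2 * s)) \<partial>\<sigma>) \<partial>\<sigma>)"

definition Hs_space :: "complex measure \<Rightarrow> real \<Rightarrow> (complex \<Rightarrow> complex) set" where
  "Hs_space \<sigma> s =
     {f \<in> borel_measurable \<sigma>. integrable \<sigma> (\<lambda>z. (cmod (f z))\<^sup>2) \<and> Hs_energy \<sigma> s f < \<infinity>}"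

definition Hs_norm :: "complex measure \<Rightarrow> real \<Rightarrow> (complex \<Rightarrow> complex) \<Rightarrow> real" where
  "Hs_norm \<sigma> s f = sqrt (enn2real (Hs_energy \<sigma> s f))"

text \<open>
  The integral of \<open>f \<zeta> / (\<zeta> - z) d\<zeta>\<close> over the points of the curve at distance more than \<open>\<epsilon>\<close>
  from \<open>z\<close>, where \<open>d\<zeta> = \<gamma>' t dt\<close>; the derivative of an arc-length parametrization exists
  almost everywhere.
\<close>

definition truncated_cauchy_integral ::
    "(real \<Rightarrow> complex) \<Rightarrow> real \<Rightarrow> (complex \<Rightarrow> complex) \<Rightarrow> complex \<Rightarrow> real \<Rightarrow> complex" where
  "truncated_cauchy_integral \<gamma> len f z \<epsilon> =
     (LINT t:{t \<in> {0..len}. cmod (\<gamma> t - z) > \<epsilon>}|lebesgue.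
        f (\<gamma> t) / (\<gamma> t - z) * vector_derivative \<gamma> (at t within {0..len}))"

definition has_cauchy_pv ::
    "(real \<Rightarrow> complex) \<Rightarrow> real \<Rightarrow> (complex \<Rightarrow> complex) \<Rightarrow> complex \<Rightarrow> bool" where
  "has_cauchy_pv \<gamma> len f z \<longleftrightarrow>
     (\<exists>w. (truncated_cauchy_integral \<gamma> len f z \<longlongrightarrow> w) (at_right 0))"

definition cauchy_operator ::
    "(real \<Rightarrow> complex) \<Rightarrow> real \<Rightarrow> (complex \<Rightarrow> complex) \<Rightarrow> complex \<Rightarrow> complex" where
  "cauchy_operator \<gamma> len f z =
     1 / (2 * of_real pi * \<i>) * Lim (at_right 0) (truncated_cauchy_integral \<gamma> len f z)"

end

theory Submission
  imports Defs
begin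

text \<open>
  Write \<open>T f = f \<cdot> T 1 + (1 / 2\<pi>\<i>) g\<close> with
  \<open>g(z) = \<integral> (f(\<zeta>) - f(z)) / (\<zeta> - z) d\<zeta>\<close>.  For \<open>f\<close> in \<open>H\<^sup>s\<close> with \<open>s > 0\<close> the
  integral defining \<open>g\<close> converges absolutely at almost every point, so that a singular integral
  is left only in \<open>T 1\<close>.  Two facts carry the proof.

  First, the truncated integrals of the constant function are bounded, and \<open>T 1\<close> is a constant.
  For an arc-length parametrization \<open>\<gamma>\<close> of length \<open>l\<close> the chord \<open>\<gamma> y - \<gamma> x\<close> has a continuous
  logarithm on the convex set of pairs \<open>0 \<le> x < y \<le> l\<close> without the corner \<open>(0, l)\<close>
  (\<open>chord_log\<close>).  The integral of \<open>\<gamma>'(u) / (\<gamma> u - \<gamma> t)\<close> over the points \<open>u\<close> at arc distance more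
  than \<open>r\<close> from \<open>t\<close> is an increment of this logarithm.  Its two end values belong to the chords
  from \<open>t - r\<close> to \<open>t\<close> and from \<open>t\<close> to \<open>t + r\<close>; sliding the chord along the curve joins them,
  and since the chord has length at least \<open>c r\<close> and moves by at most \<open>2 r\<close>, the logarithm changes
  by \<open>O(1/c)\<close> only (\<open>far_integral_bound\<close>).  The remaining constant \<open>cauchy_jump\<close> compares the
  logarithm with itself after the end points of the chord have been exchanged; it does not depend
  on \<open>t\<close>, because it is continuous in \<open>t\<close> and determined up to multiples of \<open>2\<pi>\<i>\<close>.  Where \<open>\<gamma>\<close> is
  differentiable the two short chords become parallel as \<open>r\<close> tends to 0, so the principal value
  is exactly \<open>cauchy_jump\<close> (\<open>chord_far_integral_tendsto\<close>).

  Second, splitting the integral of \<open>g(t) - g(v)\<close> at twice the arc distance \<open>d\<close> of \<open>t\<close> and \<open>v\<close>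
  bounds it by averages of \<open>\<bar>f(u) - f(t)\<bar>\<close> and \<open>\<bar>f(u) - f(v)\<bar>\<close> against the kernel
  \<open>min (1/x) (d/x\<^sup>2)\<close>, \<open>x\<close> being the arc distance of \<open>u\<close> (\<open>reg_cauchy_diff_bound\<close>); the term
  \<open>f(t) - f(v)\<close> appears with a truncated integral of the constant function as its factor, which is
  where the first fact enters.  The kernel is homogeneous of degree \<open>-1\<close> in \<open>(x, d)\<close>, and the
  Cauchy-Schwarz inequality with the weight \<open>x\<^sup>s\<close> bounds the averages by the \<open>H\<^sup>s\<close> energy; the
  two integrals that occur converge precisely for \<open>0 < s < 1\<close> (\<open>hardy_inequality\<close>).

  All constants depend on \<open>s\<close> and on the lower bound \<open>c\<close> of the ratio of chord to arc distance,
  which is the same for all arc-length parametrizations of the curve (\<open>chord_arc_lower_bound\<close>).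
  Two pieces of real analysis are proved on the way: a Lipschitz curve is differentiable almost
  everywhere, and the principal value is a Borel function of the point.
\<close>

section \<open>Lipschitz curves\<close>

text \<open>
  On the line closed balls are intervals, so the Vitali covering theorem applies to intervals that
  have the given point as an end point; these are the intervals on which difference quotients live.
\<close>

lemma vitali_slope_intervals:
  fixes g :: "real \<Rightarrow> real"
  assumes op: "\<And>V. V \<in> \<U> \<Longrightarrow> open V" and S: "S \<subseteq> \<Union>\<U>"
    and slope: "\<And>x d. x \<in> S \<Longrightarrow> 0 < d \<Longrightarrow> \<exists>y. y \<noteq> x \<and> \<bar>y - x\<bar> < d \<and> P ((g y - g x) / (y - x))"
  obtains C where "countable C" "disjoint_family_on (\<lambda>(a,b). {a..b}) C"
    "\<And>a b. (a,b) \<in> C \<Longrightarrow> a < b \<and> P ((g b - g a) / (b - a)) \<and> (\<exists>V\<in>\<U>. {a..b} \<subseteq> V)"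
    "negligible (S - (\<Union>(a,b)\<in>C. {a..b}))"
proof -
  define ctr :: "real \<times> real \<Rightarrow> real" where "ctr = (\<lambda>(a,b). (a + b) / 2)"
  define rad :: "real \<times> real \<Rightarrow> real" where "rad = (\<lambda>(a,b). (b - a) / 2)"
  have cb: "cball (ctr i) (rad i) = (case i of (a,b) \<Rightarrow> {a..b})" for i
    by (cases i) (auto simp: ctr_def rad_def cball_def dist_real_def abs_if field_simps)
  define K where "K = {(a,b). a < b \<and> P ((g b - g a) / (b - a)) \<and> (\<exists>V\<in>\<U>. {a..b} \<subseteq> V)}"
  have pos: "0 < rad i" if "i \<in> K" for i using that by (cases i) (simp add: K_def rad_def)
  have cov: "\<exists>i. i \<in> K \<and> x \<in> cball (ctr i) (rad i) \<and> rad i < d" if x: "x \<in> S" "0 < d" for x d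
  proof -
    obtain V where V: "V \<in> \<U>" "x \<in> V" using S x(1) by blast
    obtain d' where d': "0 < d'" "ball x d' \<subseteq> V" using op[OF V(1)] V(2) openE by blast
    obtain y where y: "y \<noteq> x" "\<bar>y - x\<bar> < min d d'" "P ((g y - g x) / (y - x))"
      using slope[OF x(1), of "min d d'"] d'(1) x(2) by auto
    define a b where "a = min x y" and "b = max x y"
    have ab: "a < b" "x \<in> {a..b}" "b - a < d" "{a..b} \<subseteq> ball x d'"
      using y(1,2) unfolding min_less_iff_conj by (auto simp: a_def b_def min_def max_def dist_real_def)
    have "(g b - g a) / (b - a) = (g y - g x) / (y - x)"
      using y(1) by (auto simp: a_def b_def min_def max_def divide_simps algebra_simps)
    then have "(a, b) \<in> K" using ab y(3) d'(2) V(1) by (auto simp: K_def)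
    moreover have "rad (a, b) < d" using ab by (auto simp: rad_def)
    ultimately show ?thesis using ab(2) cb by (intro exI[of _ "(a,b)"]) auto
  qed
  obtain C where C: "countable C" "C \<subseteq> K"
      "pairwise (\<lambda>i j. disjnt (cball (ctr i) (rad i)) (cball (ctr j) (rad j))) C"
      "negligible (S - (\<Union>i\<in>C. cball (ctr i) (rad i)))"
    by (rule Vitali_covering_theorem_cballs[where K=K and r=rad and a=ctr and S=S])
      (use pos cov in blast)+
  show ?thesis
  proof (rule that[of C])
    show "disjoint_family_on (\<lambda>(a,b). {a..b}) C"
      using C(3) unfolding cb by (auto simp: pairwise_def disjoint_family_on_def disjnt_def)
    show "negligible (S - (\<Union>(a,b)\<in>C. {a..b}))" using C(4) unfolding cb .
  qed (use C(1,2) in \<open>auto simp: K_def\<close>)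
qed

text \<open>
  The images of disjoint intervals under a strictly increasing \<open>g\<close> are contained in disjoint
  intervals \<open>{g a..g b}\<close>, whose lengths therefore add up.  A Vitali family with slopes below \<open>p\<close>
  near \<open>T\<close>, and inside it a Vitali family with slopes above \<open>q\<close>, then give two competing bounds
  for the same total length of images.
\<close>

lemma strict_mono_slopes_cover:
  fixes g :: "real \<Rightarrow> real"
  assumes g: "strict_mono g" and pq: "0 < p" "p < q" and e: "0 < e"
    and lo: "\<And>x d. x \<in> S \<Longrightarrow> 0 < d \<Longrightarrow> \<exists>y. y \<noteq> x \<and> \<bar>y - x\<bar> < d \<and> (g y - g x) / (y - x) < p"
    and hi: "\<And>x d. x \<in> S \<Longrightarrow> 0 < d \<Longrightarrow> \<exists>y. y \<noteq> x \<and> \<bar>y - x\<bar> < d \<and> (g y - g x) / (y - x) > q"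
    and T: "T \<in> lmeasurable" "S \<subseteq> T"
  shows "\<exists>T'\<in>lmeasurable. S \<subseteq> T' \<and> measure lebesgue T' \<le> p / q * (measure lebesgue T + e)"
proof -
  obtain U where U: "open U" "T \<subseteq> U" "U - T \<in> lmeasurable" "emeasure lebesgue (U - T) < ennreal e"
    using sets_lebesgue_outer_open[of T e] T(1) e by (metis fmeasurableD)
  have Ule: "emeasure lborel U \<le> ennreal (measure lebesgue T + e)"
  proof -
    have "emeasure lborel U = emeasure lebesgue U" using U(1) by simp
    also have "\<dots> \<le> emeasure lebesgue T + emeasure lebesgue (U - T)"
      using U(2) T(1) U(1) by (subst plus_emeasure) (auto simp: Un_absorb1)
    also have "\<dots> \<le> ennreal (measure lebesgue T) + ennreal e"
      using U(4) T(1) by (intro add_mono) (auto simp: emeasure_eq_measure2)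
    finally show ?thesis using e by (simp add: ennreal_plus[symmetric] del: ennreal_plus)
  qed
  obtain C1 where C1: "countable C1" "disjoint_family_on (\<lambda>(a,b). {a..b}) C1"
      "\<And>a b. (a,b) \<in> C1 \<Longrightarrow> a < b \<and> (g b - g a) / (b - a) < p \<and> (\<exists>V\<in>{U}. {a..b} \<subseteq> V)"
      "negligible (S - (\<Union>(a,b)\<in>C1. {a..b}))"
    by (rule vitali_slope_intervals[of "{U}" S "\<lambda>z. z < p" g]) (use U T lo in auto)
  \<comment> \<open>Only the countably many end points are lost on passing to open intervals.\<close>
  define W where "W = (\<lambda>(a,b). {a<..<b}) ` C1"
  have "S - \<Union>W \<subseteq> (S - (\<Union>(a,b)\<in>C1. {a..b})) \<union> (fst ` C1 \<union> snd ` C1)"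
    by (force simp: W_def)
  moreover have "negligible (fst ` C1 \<union> snd ` C1)"
    unfolding negligible_iff_null_sets
    by (intro null_sets_completionI countable_imp_null_set_lborel countable_Un countable_image C1(1))
  ultimately have SW: "negligible (S - \<Union>W)"
    using negligible_subset[OF negligible_Un[OF C1(4)]] by blast
  obtain C2 where C2: "countable C2" "disjoint_family_on (\<lambda>(a,b). {a..b}) C2"
      "\<And>a b. (a,b) \<in> C2 \<Longrightarrow> a < b \<and> (g b - g a) / (b - a) > q \<and> (\<exists>V\<in>W. {a..b} \<subseteq> V)"
      "negligible (S \<inter> \<Union>W - (\<Union>(a,b)\<in>C2. {a..b}))"
    by (rule vitali_slope_intervals[of W "S \<inter> \<Union>W" "\<lambda>z. z > q" g]) (use hi in \<open>auto simp: W_def\<close>)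
  define I :: "real \<times> real \<Rightarrow> real set" where "I = (\<lambda>(a,b). {a..b})"
  define J :: "real \<times> real \<Rightarrow> real set" where "J = (\<lambda>(a,b). {g a..g b})"
  have meas: "I i \<in> sets lborel" "J i \<in> sets lborel" for i by (cases i; auto simp: I_def J_def)+
  have disjJ: "disjoint_family_on J C"
    if "disjoint_family_on I C" "\<And>a b. (a,b) \<in> C \<Longrightarrow> a < b" for C
    unfolding disjoint_family_on_def
  proof (intro ballI impI)
    fix i j assume ij: "i \<in> C" "j \<in> C" "i \<noteq> j"
    obtain a b a' b' where [simp]: "i = (a,b)" "j = (a',b')" by (cases i; cases j) auto
    have "I i \<inter> I j = {}" using that(1) ij unfolding disjoint_family_on_def by blast
    moreover have "a < b" "a' < b'" using that(2) ij by auto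
    ultimately have "b < a' \<or> b' < a" by (auto simp: I_def)
    then have "g b < g a' \<or> g b' < g a" using g by (auto simp: strict_mono_less)
    then show "J i \<inter> J j = {}" by (auto simp: J_def)
  qed
  note C1 = C1[folded I_def] and C2 = C2[folded I_def]
  have dJ: "disjoint_family_on J C1" "disjoint_family_on J C2" using disjJ C1(2,3) C2(2,3) by blast+
  have emI: "emeasure lborel (\<Union>i\<in>C. I i) = (\<integral>\<^sup>+ i. emeasure lborel (I i) \<partial>count_space C)"
    if "countable C" "disjoint_family_on I C" for C
    by (rule emeasure_UN_countable) (use that meas in auto)
  have emJ: "emeasure lborel (\<Union>i\<in>C. J i) = (\<integral>\<^sup>+ i. emeasure lborel (J i) \<partial>count_space C)"
    if "countable C" "disjoint_family_on J C" for C
    by (rule emeasure_UN_countable) (use that meas in auto)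
  have gle: "a < b \<Longrightarrow> g a \<le> g b" for a b using g by (simp add: strict_mono_less_eq)
  \<comment> \<open>The images of \<open>C2\<close> are longer than \<open>q\<close> times, those of \<open>C1\<close> shorter than \<open>p\<close> times their intervals.\<close>
  have "ennreal q * emeasure lborel (\<Union>i\<in>C2. I i) = (\<integral>\<^sup>+ i. ennreal q * emeasure lborel (I i) \<partial>count_space C2)"
    by (subst emI[OF C2(1,2)]) (simp add: nn_integral_cmult)
  also have "\<dots> \<le> (\<integral>\<^sup>+ i. emeasure lborel (J i) \<partial>count_space C2)"
  proof (rule nn_integral_mono)
    fix i assume "i \<in> space (count_space C2)"
    then obtain a b where [simp]: "i = (a,b)" and i: "(a,b) \<in> C2" by (cases i) auto
    have "a < b" "g b - g a > q * (b - a)" using C2(3)[OF i] by (auto simp: field_simps)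
    then show "ennreal q * emeasure lborel (I i) \<le> emeasure lborel (J i)"
      using pq gle by (simp add: I_def J_def ennreal_mult'[symmetric])
  qed
  also have "\<dots> = emeasure lborel (\<Union>i\<in>C2. J i)" by (rule emJ[OF C2(1) dJ(2), symmetric])
  also have "\<dots> \<le> emeasure lborel (\<Union>i\<in>C1. J i)"
  proof (rule emeasure_mono)
    show "(\<Union>i\<in>C2. J i) \<subseteq> (\<Union>i\<in>C1. J i)"
    proof (rule UN_least)
      fix i assume "i \<in> C2"
      then obtain a b where [simp]: "i = (a,b)" and i: "(a,b) \<in> C2" by (cases i) auto
      obtain a' b' where ab: "a < b" "(a',b') \<in> C1" "{a..b} \<subseteq> {a'<..<b'}"
        using C2(3)[OF i] by (auto simp: W_def)
      then have "a \<in> {a'<..<b'}" "b \<in> {a'<..<b'}" by (auto simp del: greaterThanLessThan_iff)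
      then have "g a' \<le> g a" "g b \<le> g b'" using g by (auto simp: strict_mono_less_eq)
      then have "J i \<subseteq> J (a',b')" by (auto simp: J_def)
      then show "J i \<subseteq> (\<Union>i\<in>C1. J i)" using ab(2) by blast
    qed
    show "(\<Union>i\<in>C1. J i) \<in> sets lborel" using C1(1) meas by (intro sets.countable_UN'') auto
  qed
  also have "\<dots> = (\<integral>\<^sup>+ i. emeasure lborel (J i) \<partial>count_space C1)" by (rule emJ[OF C1(1) dJ(1)])
  also have "\<dots> \<le> (\<integral>\<^sup>+ i. ennreal p * emeasure lborel (I i) \<partial>count_space C1)"
  proof (rule nn_integral_mono)
    fix i assume "i \<in> space (count_space C1)"
    then obtain a b where [simp]: "i = (a,b)" and i: "(a,b) \<in> C1" by (cases i) auto
    have "a < b" "g b - g a < p * (b - a)" using C1(3)[OF i] by (auto simp: field_simps)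
    then show "emeasure lborel (J i) \<le> ennreal p * emeasure lborel (I i)"
      using pq gle by (simp add: I_def J_def ennreal_mult'[symmetric])
  qed
  also have "\<dots> = ennreal p * emeasure lborel (\<Union>i\<in>C1. I i)"
    by (subst emI[OF C1(1,2)]) (simp add: nn_integral_cmult)
  also have "\<dots> \<le> ennreal p * emeasure lborel U"
    using C1(3) U(1) by (intro mult_left_mono emeasure_mono) (force simp: I_def)+
  also have "\<dots> \<le> ennreal p * ennreal (measure lebesgue T + e)"
    by (intro mult_left_mono Ule) auto
  finally have main: "ennreal q * emeasure lborel (\<Union>i\<in>C2. I i) \<le> ennreal p * ennreal (measure lebesgue T + e)" .
  define V where "V = (\<Union>i\<in>C2. I i)"
  have Vs: "V \<in> sets lborel" unfolding V_def using C2(1) meas by (intro sets.countable_UN'') auto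
  have "emeasure lborel V \<le> ennreal (p / q * (measure lebesgue T + e))"
  proof -
    have "ennreal (1/q) * (ennreal q * emeasure lborel V) \<le> ennreal (1/q) * (ennreal p * ennreal (measure lebesgue T + e))"
      using main by (intro mult_left_mono) (auto simp: V_def)
    moreover have "ennreal (1/q) * (ennreal q * emeasure lborel V) = emeasure lborel V"
      using pq by (simp add: mult.assoc[symmetric] ennreal_mult'[symmetric])
    ultimately show ?thesis using pq e by (simp add: ennreal_mult'[symmetric] ennreal_mult''[symmetric] del: ennreal_plus)
  qed
  then have V: "V \<in> lmeasurable" "measure lebesgue V \<le> p / q * (measure lebesgue T + e)"
    using Vs pq e by (auto simp: fmeasurable_def measure_def enn2real_leI intro: le_less_trans ennreal_less_top)
  have "S - V \<subseteq> (S - \<Union>W) \<union> (S \<inter> \<Union>W - (\<Union>i\<in>C2. I i))"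
    unfolding V_def by auto
  then have SV: "negligible (S - V)"
    by (rule negligible_subset[rotated]) (intro negligible_Un SW C2(4))
  have "V \<union> (S - V) \<in> lmeasurable" "measure lebesgue (V \<union> (S - V)) = measure lebesgue V"
    using V(1) SV measure_Un_null_set[of V lebesgue "S - V"]
    by (auto simp: negligible_imp_measurable negligible_iff_null_sets simp del: Un_Diff_cancel intro: fmeasurable.Un)
  then show ?thesis using V(2) by (intro bexI[of _ "V \<union> (S - V)"]) auto
qed

text \<open>
  The infimum of the measures of all supersets cannot be positive, since
  \<open>strict_mono_slopes_cover\<close> shrinks every superset by a fixed factor below 1.  Arguing with
  supersets avoids the measurability of \<open>S\<close>.
\<close>

lemma strict_mono_oscillating_slopes_negligible:
  fixes g :: "real \<Rightarrow> real"
  assumes g: "strict_mono g" and pq: "0 < p" "p < q" and S: "bounded S"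
    and lo: "\<And>x d. x \<in> S \<Longrightarrow> 0 < d \<Longrightarrow> \<exists>y. y \<noteq> x \<and> \<bar>y - x\<bar> < d \<and> (g y - g x) / (y - x) < p"
    and hi: "\<And>x d. x \<in> S \<Longrightarrow> 0 < d \<Longrightarrow> \<exists>y. y \<noteq> x \<and> \<bar>y - x\<bar> < d \<and> (g y - g x) / (y - x) > q"
  shows "negligible S"
  unfolding negligible_outer
proof (intro allI impI)
  fix e :: real assume e: "0 < e"
  define m where "m = Inf {measure lebesgue T | T. T \<in> lmeasurable \<and> S \<subseteq> T}"
  let ?X = "{measure lebesgue T | T. T \<in> lmeasurable \<and> S \<subseteq> T}"
  obtain B where "S \<subseteq> cball 0 B" using S by (auto simp: bounded_iff subset_iff)
  then have ne: "?X \<noteq> {}" using lmeasurable_cball by blast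
  have bd: "bdd_below ?X" by (intro bdd_belowI[of _ 0]) auto
  have m0: "0 \<le> m" unfolding m_def by (rule cInf_greatest[OF ne]) auto
  have "m \<le> p / q * (m + 2 * \<eta>)" if \<eta>: "0 < \<eta>" for \<eta>
  proof -
    have "Inf ?X < m + \<eta>" using \<eta> by (simp add: m_def)
    then obtain T where T: "T \<in> lmeasurable" "S \<subseteq> T" "measure lebesgue T < m + \<eta>"
      using cInf_lessD[OF ne] by blast
    obtain T' where T': "T' \<in> lmeasurable" "S \<subseteq> T'" "measure lebesgue T' \<le> p / q * (measure lebesgue T + \<eta>)"
      using strict_mono_slopes_cover[OF g pq \<eta> lo hi T(1,2)] by blast
    have "m \<le> measure lebesgue T'" unfolding m_def using T' by (intro cInf_lower[OF _ bd]) auto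
    also have "\<dots> \<le> p / q * (measure lebesgue T + \<eta>)" by (rule T')
    also have "\<dots> \<le> p / q * (m + 2 * \<eta>)" using T(3) pq by (intro mult_left_mono) auto
    finally show ?thesis .
  qed
  then have "m \<le> p / q * m + \<eta>" if "0 < \<eta>" for \<eta>
    using that[THEN half_gt_zero] pq that
    by (smt (verit, ccfv_SIG) distrib_left divide_less_eq_1_pos field_sum_of_halves mult_less_cancel_right2)
  then have "m \<le> p / q * m" by (rule field_le_epsilon)
  then have "m * (q - p) \<le> 0" using pq by (simp add: field_simps)
  then have "m = 0" using pq m0 by (simp add: mult_le_0_iff)
  then have "Inf ?X < e" using e by (simp add: m_def)
  then show "\<exists>T. S \<subseteq> T \<and> T \<in> lmeasurable \<and> measure lebesgue T < e"
    using cInf_lessD[OF ne] by blast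
qed

text \<open>
  Rational levels suffice to exclude a gap between the lower and the upper limit; this keeps the
  exceptional set in the application a countable union.
\<close>

lemma convergent_quotient_if_no_gap:
  fixes Q :: "real \<Rightarrow> real"
  assumes F: "F \<noteq> bot" and lb: "\<forall>\<^sub>F y in F. a \<le> Q y" and ub: "\<forall>\<^sub>F y in F. Q y \<le> b"
    and gap: "\<And>p q. p \<in> \<rat> \<Longrightarrow> q \<in> \<rat> \<Longrightarrow> a - 1 < p \<Longrightarrow> p < q \<Longrightarrow> (\<forall>\<^sub>F y in F. p \<le> Q y) \<or> (\<forall>\<^sub>F y in F. Q y \<le> q)"
  shows "\<exists>D. (Q \<longlongrightarrow> D) F"
proof -
  define A where "A = {p. \<forall>\<^sub>F y in F. p \<le> Q y}"
  have A1: "a \<in> A" using lb by (simp add: A_def)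
  have A2: "p \<le> b" if "p \<in> A" for p
  proof -
    have "\<forall>\<^sub>F y in F. p \<le> b" using that ub unfolding A_def mem_Collect_eq by eventually_elim auto
    then show ?thesis using F by simp
  qed
  have bd: "bdd_above A" using A2 by (rule bdd_aboveI)
  define D where "D = Sup A"
  have aD: "a \<le> D" unfolding D_def by (rule cSup_upper[OF A1 bd])
  have "(Q \<longlongrightarrow> D) F"
  proof (rule order_tendstoI)
    fix x assume "x < D"
    then obtain p where "p \<in> A" "x < p" unfolding D_def using less_cSupD[of A x] A1 by blast
    then show "\<forall>\<^sub>F y in F. x < Q y" unfolding A_def by (auto elim: eventually_mono)
  next
    fix x assume "D < x"
    then obtain q where q: "q \<in> \<rat>" "D < q" "q < x" using Rats_dense_in_real by blast
    then obtain p where p: "p \<in> \<rat>" "D < p" "p < q" using Rats_dense_in_real by blast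
    have "p \<notin> A" using p(2) cSup_upper[OF _ bd] unfolding D_def by force
    then have "\<forall>\<^sub>F y in F. Q y \<le> q" using gap[of p q] p q aD by (auto simp: A_def)
    then show "\<forall>\<^sub>F y in F. Q y < x" using q(3) by (auto elim: eventually_mono)
  qed
  then show ?thesis by blast
qed

lemma lipschitz_real_differentiable_AE:
  fixes f :: "real \<Rightarrow> real"
  assumes f: "\<And>x y. \<bar>f x - f y\<bar> \<le> \<bar>x - y\<bar>"
  shows "AE x in lebesgue. \<exists>D. (f has_real_derivative D) (at x)"
proof -
  \<comment> \<open>Adding a steep line makes every slope lie between 1 and 3.\<close>
  define g where "g x = f x + 2 * x" for x
  define Q where "Q x y = (g y - g x) / (y - x)" for x y
  have Q: "1 \<le> Q x y" "Q x y \<le> 3" if "x \<noteq> y" for x y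
    using that f[of y x] unfolding Q_def g_def
    by (auto simp: divide_simps abs_if algebra_simps split: if_splits)
  have g: "strict_mono g"
  proof (rule strict_monoI)
    fix x y :: real assume "x < y"
    then show "g x < g y" using f[of y x] by (auto simp: g_def abs_if split: if_splits)
  qed
  define S where "S p q n = {x. \<bar>x\<bar> \<le> real n \<and> (\<forall>d>0. \<exists>y. y \<noteq> x \<and> \<bar>y - x\<bar> < d \<and> Q x y < p)
     \<and> (\<forall>d>0. \<exists>y. y \<noteq> x \<and> \<bar>y - x\<bar> < d \<and> Q x y > q)}" for p q n
  have neg: "negligible (S p q n)" if "0 < p" "p < q" for p q n
  proof (rule strict_mono_oscillating_slopes_negligible[OF g that])
    show "bounded (S p q n)" by (auto simp: bounded_iff S_def)
  qed (auto simp: S_def Q_def)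
  define R where "R = {(p,q). p \<in> \<rat> \<and> q \<in> \<rat> \<and> 0 < p \<and> (p::real) < q}"
  have "countable R" by (rule countable_subset[of _ "\<rat> \<times> \<rat>"]) (auto simp: R_def countable_rat)
  then have "negligible (\<Union>((\<lambda>((p,q),n). S p q n) ` (R \<times> UNIV)))"
    by (intro negligible_countable_Union countable_image countable_SIGMA) (auto intro!: neg simp: R_def)
  then have "AE x in lebesgue. x \<notin> \<Union>((\<lambda>((p,q),n). S p q n) ` (R \<times> UNIV))"
    unfolding negligible_iff_null_sets by (rule AE_not_in)
  then show ?thesis
  proof (rule AE_mp, intro AE_I2 impI)
    fix x assume x: "x \<notin> \<Union>((\<lambda>((p,q),n). S p q n) ` (R \<times> UNIV))"
    obtain n where n: "\<bar>x\<bar> \<le> real n" using real_arch_simple by blast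
    have "\<exists>D. (Q x \<longlongrightarrow> D) (at x)"
    proof (rule convergent_quotient_if_no_gap)
      show "\<forall>\<^sub>F y in at x. 1 \<le> Q x y" "\<forall>\<^sub>F y in at x. Q x y \<le> 3"
        using Q by (auto simp: eventually_at intro!: exI[of _ 1])
      fix p q :: real assume pq: "p \<in> \<rat>" "q \<in> \<rat>" "1 - 1 < p" "p < q"
      then have "(p,q) \<in> R" by (auto simp: R_def)
      then have "x \<notin> S p q n" using x by force
      then show "(\<forall>\<^sub>F y in at x. p \<le> Q x y) \<or> (\<forall>\<^sub>F y in at x. Q x y \<le> q)"
      proof -
        have "\<not> (\<forall>d>0. \<exists>y. y \<noteq> x \<and> \<bar>y - x\<bar> < d \<and> Q x y < p) \<or> \<not> (\<forall>d>0. \<exists>y. y \<noteq> x \<and> \<bar>y - x\<bar> < d \<and> Q x y > q)"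
          using n \<open>x \<notin> S p q n\<close> by (simp add: S_def)
        then show ?thesis
        proof (elim disjE)
          assume "\<not> (\<forall>d>0. \<exists>y. y \<noteq> x \<and> \<bar>y - x\<bar> < d \<and> Q x y < p)"
          then obtain d where "d > 0" "\<And>y. y \<noteq> x \<Longrightarrow> \<bar>y - x\<bar> < d \<Longrightarrow> p \<le> Q x y" by (meson not_less)
          then show ?thesis by (intro disjI1) (auto simp: eventually_at dist_real_def)
        next
          assume "\<not> (\<forall>d>0. \<exists>y. y \<noteq> x \<and> \<bar>y - x\<bar> < d \<and> Q x y > q)"
          then obtain d where "d > 0" "\<And>y. y \<noteq> x \<Longrightarrow> \<bar>y - x\<bar> < d \<Longrightarrow> Q x y \<le> q" by (meson not_less)
          then show ?thesis by (intro disjI2) (auto simp: eventually_at dist_real_def)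
        qed
      qed
    qed auto
    then obtain D where "(Q x \<longlongrightarrow> D) (at x)" by blast
    then have "(g has_real_derivative D) (at x)"
      by (simp add: has_field_derivative_iff Q_def[abs_def])
    then have "((\<lambda>x. g x - 2 * x) has_real_derivative (D - 2)) (at x)"
      by (auto intro!: derivative_eq_intros)
    then show "\<exists>D. (f has_real_derivative D) (at x)" by (auto simp: g_def)
  qed
qed

lemma lipschitz_complex_differentiable_AE:
  fixes \<gamma> :: "real \<Rightarrow> complex"
  assumes "\<And>x y. cmod (\<gamma> x - \<gamma> y) \<le> \<bar>x - y\<bar>"
  shows "AE x in lebesgue. \<exists>D. (\<gamma> has_vector_derivative D) (at x)"
proof -
  have "\<bar>Re (\<gamma> x) - Re (\<gamma> y)\<bar> \<le> \<bar>x - y\<bar>" "\<bar>Im (\<gamma> x) - Im (\<gamma> y)\<bar> \<le> \<bar>x - y\<bar>" for x y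
    using assms[of x y] abs_Re_le_cmod[of "\<gamma> x - \<gamma> y"] abs_Im_le_cmod[of "\<gamma> x - \<gamma> y"] by auto
  from this[THEN lipschitz_real_differentiable_AE]
  show ?thesis
  proof eventually_elim
    case (elim x)
    then obtain a b where "((\<lambda>x. Re (\<gamma> x)) has_real_derivative a) (at x)" "((\<lambda>x. Im (\<gamma> x)) has_real_derivative b) (at x)"
      by blast
    then have "(\<gamma> has_vector_derivative Complex a b) (at x)"
      by (simp add: has_vector_derivative_complex_iff)
    then show ?case by blast
  qed
qed

lemma has_vector_derivative_quotient_tendsto:
  fixes f :: "real \<Rightarrow> 'a::real_normed_vector"
  assumes "(f has_vector_derivative D) (at x)"
  shows "((\<lambda>y. (f y - f x) /\<^sub>R (y - x)) \<longlongrightarrow> D) (at x)"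
proof (rule LIM_zero_cancel, rule tendsto_norm_zero_cancel, rule Lim_transform_eventually)
  show "((\<lambda>y. norm ((f y - f x) - (y - x) *\<^sub>R D) / norm (y - x)) \<longlongrightarrow> 0) (at x)"
    using assms unfolding has_vector_derivative_def has_derivative_iff_norm by blast
  have "norm ((f y - f x) - (y - x) *\<^sub>R D) / norm (y - x) = norm ((f y - f x) /\<^sub>R (y - x) - D)"
    if "y \<noteq> x" for y
  proof -
    have "(f y - f x) /\<^sub>R (y - x) - D = ((f y - f x) - (y - x) *\<^sub>R D) /\<^sub>R (y - x)"
      using that by (simp add: scaleR_diff_right)
    then show ?thesis by (simp add: divide_inverse abs_inverse mult.commute)
  qed
  then show "\<forall>\<^sub>F y in at x. norm ((f y - f x) - (y - x) *\<^sub>R D) / norm (y - x) = norm ((f y - f x) /\<^sub>R (y - x) - D)"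
    by (auto simp: eventually_at intro!: exI[of _ 1])
qed

text \<open>
  The functions \<open>(\<phi>(x + h) - \<phi> x) / h\<close> are bounded by the Lipschitz constant and converge to the
  derivative almost everywhere.  Their integrals are difference quotients of an antiderivative of
  \<open>\<phi>\<close> at \<open>b\<close> and \<open>a\<close>, so dominated convergence gives the theorem.
\<close>

lemma lipschitz_FTC:
  fixes \<phi> d :: "real \<Rightarrow> complex"
  assumes ab: "a \<le> b"
    and lip: "\<And>x y. x \<in> {a..b} \<Longrightarrow> y \<in> {a..b} \<Longrightarrow> cmod (\<phi> x - \<phi> y) \<le> L * \<bar>x - y\<bar>"
    and d: "set_borel_measurable lborel {a..b} d"
    and der: "AE t in lborel. t \<in> {a<..<b} \<longrightarrow> (\<phi> has_vector_derivative d t) (at t)"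
  shows "set_integrable lborel {a..b} d" "(LINT t:{a..b}|lborel. d t) = \<phi> b - \<phi> a"
proof -
  define \<psi> where "\<psi> x = \<phi> (max a (min b x))" for x
  define L' where "L' = max L 0"
  have L': "0 \<le> L'" "L \<le> L'" by (auto simp: L'_def)
  have lip': "cmod (\<psi> x - \<psi> y) \<le> L' * \<bar>x - y\<bar>" for x y
  proof -
    have "cmod (\<psi> x - \<psi> y) \<le> L * \<bar>max a (min b x) - max a (min b y)\<bar>"
      unfolding \<psi>_def using ab by (intro lip) auto
    also have "\<dots> \<le> L' * \<bar>x - y\<bar>" using L' by (intro mult_mono) auto
    finally show ?thesis .
  qed
  have cont: "continuous_on UNIV \<psi>"
    by (rule lipschitz_on_continuous_on[of L']) (auto intro!: lipschitz_onI lip' L' simp: dist_norm)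
  \<comment> \<open>The margin leaves room for the increments \<open>h k \<le> 1\<close> and makes \<open>a\<close> and \<open>b\<close> interior points.\<close>
  obtain P where P: "\<And>x. x \<in> {a-1..b+2} \<Longrightarrow> (P has_vector_derivative \<psi> x) (at x within {a-1..b+2})"
    using antiderivative_continuous[OF continuous_on_subset[OF cont subset_UNIV, of "{a-1..b+2}"]] by metis
  have P': "(P has_vector_derivative \<psi> x) (at x)" if "a - 1 < x" "x < b + 2" for x
    using P[of x] that by (simp add: at_within_Icc_at)
  define h where "h k = 1 / real (Suc k)" for k
  have h: "0 < h k" "h k \<le> 1" for k by (auto simp: h_def field_simps)
  have h0: "h \<longlonglongrightarrow> 0" unfolding h_def by (rule LIMSEQ_Suc[OF lim_1_over_n])
  have xh: "filterlim (\<lambda>k. x + h k) (at x) sequentially" for x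
  proof -
    have "(\<lambda>k. x + h k) \<longlonglongrightarrow> x" using tendsto_add[OF tendsto_const h0, of x] by simp
    moreover have "x + h k \<noteq> x" for k using h(1)[of k] by simp
    ultimately show ?thesis by (simp add: filterlim_at)
  qed
  define S where "S k x = indicator {a..b} x *\<^sub>R ((1 / h k) *\<^sub>R (\<psi> (x + h k) - \<psi> x))" for k x
  have [measurable]: "\<psi> \<in> borel_measurable borel" using cont by (rule borel_measurable_continuous_onI)
  have Smeas: "S k \<in> borel_measurable lborel" for k unfolding S_def by measurable
  have Sbound: "norm (S k x) \<le> indicator {a..b} x * L'" for k x
  proof -
    have "norm ((1 / h k) *\<^sub>R (\<psi> (x + h k) - \<psi> x)) = cmod (\<psi> (x + h k) - \<psi> x) / h k"
      using h[of k] by (simp del: scaleR_diff_right)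
    also have "\<dots> \<le> L'" using lip'[of "x + h k" x] h[of k] by (simp add: field_simps)
    finally show ?thesis by (auto simp: S_def indicator_def simp del: scaleR_diff_right)
  qed
  have Slim: "AE x in lborel. (\<lambda>k. S k x) \<longlonglongrightarrow> indicator {a..b} x *\<^sub>R d x"
    using der AE_lborel_singleton[of a] AE_lborel_singleton[of b]
  proof eventually_elim
    case (elim x)
    show ?case
    proof (cases "x \<in> {a<..<b}")
      case True
      have "(\<psi> has_vector_derivative d x) (at x)"
      proof (rule has_vector_derivative_transform_within_open)
        show "(\<phi> has_vector_derivative d x) (at x)" using elim True by auto
        show "open {a<..<b}" "x \<in> {a<..<b}" using True by auto
      qed (auto simp: \<psi>_def max_def min_def)
      then have "((\<lambda>y. (\<psi> y - \<psi> x) /\<^sub>R (y - x)) \<longlongrightarrow> d x) (at x)"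
        by (rule has_vector_derivative_quotient_tendsto)
      moreover have "filterlim (\<lambda>k. x + h k) (at x) sequentially"
        by (rule xh)
      ultimately have "(\<lambda>k. (\<psi> (x + h k) - \<psi> x) /\<^sub>R (x + h k - x)) \<longlonglongrightarrow> d x"
        by (rule filterlim_compose)
      then show ?thesis using True by (simp add: S_def divide_inverse)
    next
      case False
      then have "x \<notin> {a..b}" using elim by auto
      then show ?thesis by (simp add: S_def)
    qed
  qed
  have dm: "(\<lambda>x. indicator {a..b} x *\<^sub>R d x) \<in> borel_measurable lborel"
    using d by (simp add: set_borel_measurable_def)
  have bi: "integrable lborel (\<lambda>x. indicator {a..b} x * L')"
    by (intro integrable_mult_left integrable_real_indicator) (use ab in auto)
  note dct = dm Smeas bi Slim AE_I2[OF Sbound]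
  show int: "set_integrable lborel {a..b} d" unfolding set_integrable_def
    by (rule integrable_dominated_convergence[OF dct])
  have lim1: "(\<lambda>k. integral\<^sup>L lborel (S k)) \<longlonglongrightarrow> (LINT t:{a..b}|lborel. d t)"
    unfolding set_lebesgue_integral_def by (rule integral_dominated_convergence[OF dct])
  have Sint: "integral\<^sup>L lborel (S k) = (P (b + h k) - P b) /\<^sub>R h k - (P (a + h k) - P a) /\<^sub>R h k" for k
  proof -
    have "integral\<^sup>L lborel (S k) = (1 / h k) *\<^sub>R (P (b + h k) - P b) - (1 / h k) *\<^sub>R (P (a + h k) - P a)"
      unfolding S_def
    proof (rule integral_FTC_Icc)
      fix x assume x: "a \<le> x" "x \<le> b"
      have shift: "((\<lambda>x. x + h k) has_vector_derivative 1) (at x)"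
        unfolding has_real_derivative_iff_has_vector_derivative[symmetric]
        by (auto intro!: derivative_eq_intros)
      have "(P has_vector_derivative \<psi> (x + h k)) (at (x + h k))"
        using x h[of k] by (intro P') auto
      then have "((\<lambda>x. P (x + h k)) has_vector_derivative \<psi> (x + h k)) (at x)"
        using vector_diff_chain_at[OF shift, of P "\<psi> (x + h k)"] by (simp add: o_def)
      then show "((\<lambda>x. (1 / h k) *\<^sub>R (P (x + h k) - P x)) has_vector_derivative (1 / h k) *\<^sub>R (\<psi> (x + h k) - \<psi> x)) (at x within {a..b})"
        using x P'[of x] 
        by (intro has_vector_derivative_at_within[of _ _ _ "{a..b}"]) (auto intro!: derivative_eq_intros)
    next
      show "continuous_on {a..b} (\<lambda>x. (1 / h k) *\<^sub>R (\<psi> (x + h k) - \<psi> x))"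
        by (intro continuous_intros continuous_on_compose2[OF cont]) auto
    qed (use ab in auto)
    then show ?thesis by (simp add: divide_inverse)
  qed
  have quot: "(\<lambda>k. (P (x + h k) - P x) /\<^sub>R h k) \<longlonglongrightarrow> \<psi> x" if "a \<le> x" "x \<le> b" for x
  proof -
    have "((\<lambda>y. (P y - P x) /\<^sub>R (y - x)) \<longlongrightarrow> \<psi> x) (at x)"
      using P'[of x] that by (intro has_vector_derivative_quotient_tendsto) auto
    moreover have "filterlim (\<lambda>k. x + h k) (at x) sequentially"
        by (rule xh)
    ultimately have "(\<lambda>k. (P (x + h k) - P x) /\<^sub>R (x + h k - x)) \<longlonglongrightarrow> \<psi> x"
      by (rule filterlim_compose)
    then show ?thesis by simp
  qed
  have "(\<lambda>k. integral\<^sup>L lborel (S k)) \<longlonglongrightarrow> \<psi> b - \<psi> a"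
    unfolding Sint using ab by (intro tendsto_diff quot) auto
  then show "(LINT t:{a..b}|lborel. d t) = \<phi> b - \<phi> a"
    using LIMSEQ_unique[OF lim1] ab by (simp add: \<psi>_def)
qed

section \<open>Increments of continuous logarithms\<close>

text \<open>
  Two logarithms of the same number differ by a multiple of \<open>2\<pi>\<i>\<close>, so a continuous logarithm of a
  constant cannot move.
\<close>

lemma exp_one_range_discrete:
  fixes f :: "'a::topological_space \<Rightarrow> complex"
  assumes S: "connected S" and f: "continuous_on S f" and e: "\<And>x. x \<in> S \<Longrightarrow> exp (f x) = c"
    and xy: "x \<in> S" "y \<in> S"
  shows "f x = f y"
proof -
  have "f constant_on S"
  proof (rule continuous_discrete_range_constant[OF S f])
    fix x assume x: "x \<in> S"
    have "1 \<le> norm (f y - f x)" if y: "y \<in> S" "f y \<noteq> f x" for y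
    proof -
      obtain n :: int where n: "f y = f x + (of_int (2 * n) * pi) * \<i>"
        using e[OF x] e[OF y(1)] exp_eq by metis
      then have "n \<noteq> 0" using y(2) by auto
      then have "1 \<le> \<bar>real_of_int n\<bar>" by linarith
      moreover have "norm (f y - f x) = 2 * \<bar>real_of_int n\<bar> * pi" using n by (simp add: norm_mult)
      moreover have "1 * 1 \<le> (2 * pi) * \<bar>real_of_int n\<bar>" using \<open>1 \<le> \<bar>real_of_int n\<bar>\<close> pi_ge_two
        by (intro mult_mono) auto
      ultimately show ?thesis by (simp add: mult_ac)
    qed
    then show "\<exists>e>0. \<forall>y. y \<in> S \<and> f y \<noteq> f x \<longrightarrow> e \<le> norm (f y - f x)" by (intro exI[of _ 1]) auto
  qed
  then show ?thesis using xy by (auto simp: constant_on_def)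
qed

text \<open>
  As long as \<open>w\<close> stays in the disc around \<open>w x\<close> that touches 0, the quotient \<open>w / w x\<close> stays in the
  right half plane and the principal branch computes the increment.
\<close>

lemma continuous_log_increment:
  fixes \<psi> :: "'a::topological_space \<Rightarrow> complex"
  assumes S: "connected S" and \<psi>: "continuous_on S \<psi>" and e: "\<And>u. u \<in> S \<Longrightarrow> exp (\<psi> u) = w u"
    and close: "\<And>u. u \<in> S \<Longrightarrow> cmod (w u - w x) < cmod (w x)" and xy: "x \<in> S" "y \<in> S"
  shows "\<psi> y - \<psi> x = Ln (w y / w x)"
proof -
  have w0: "w x \<noteq> 0" using e[OF xy(1)] by (metis exp_not_eq_zero)
  have re: "w u / w x \<notin> \<real>\<^sub>\<le>\<^sub>0" "w u / w x \<noteq> 0" if "u \<in> S" for u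
  proof -
    have "cmod (w u / w x - 1) = cmod (w u - w x) / cmod (w x)"
      using w0 by (simp add: norm_divide[symmetric] diff_divide_distrib)
    also have "\<dots> < 1" using close[OF that] w0 by simp
    finally have "cmod (w u / w x - 1) < 1" .
    moreover have "\<bar>Re (w u / w x - 1)\<bar> \<le> cmod (w u / w x - 1)" by (rule abs_Re_le_cmod)
    ultimately have "Re (w u / w x) > 0" by simp
    then show "w u / w x \<notin> \<real>\<^sub>\<le>\<^sub>0" by (auto simp: complex_nonpos_Reals_iff)
    then show "w u / w x \<noteq> 0" by auto
  qed
  have w: "continuous_on S w"
    by (rule continuous_on_eq[of S "\<lambda>u. exp (\<psi> u)"]) (auto intro!: continuous_intros \<psi> e)
  have "(\<lambda>u. \<psi> u - \<psi> x - Ln (w u / w x)) y = (\<lambda>u. \<psi> u - \<psi> x - Ln (w u / w x)) x"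
  proof (rule exp_one_range_discrete[OF S, where c=1])
    show "continuous_on S (\<lambda>u. \<psi> u - \<psi> x - Ln (w u / w x))"
      using re w0 by (intro continuous_intros \<psi> w) auto
    show "exp (\<psi> u - \<psi> x - Ln (w u / w x)) = 1" if "u \<in> S" for u
      using re[OF that] w0 e[OF that] e[OF xy(1)] by (simp add: exp_diff)
  qed (use xy in auto)
  then show ?thesis using w0 by simp
qed

text \<open>
  Locally the increment is \<open>Ln (1 + z)\<close> with \<open>z\<close> of size \<open>M \<bar>y - x\<bar> / m\<close>; summing over short steps
  makes the estimate global without any bound on the winding of \<open>w\<close>.
\<close>

lemma continuous_log_lipschitz:
  fixes \<psi> w :: "real \<Rightarrow> complex"
  assumes \<psi>: "continuous_on {a..b} \<psi>" and e: "\<And>u. u \<in> {a..b} \<Longrightarrow> exp (\<psi> u) = w u"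
    and lip: "\<And>x y. x \<in> {a..b} \<Longrightarrow> y \<in> {a..b} \<Longrightarrow> cmod (w x - w y) \<le> M * \<bar>x - y\<bar>"
    and m: "0 < m" "\<And>u. u \<in> {a..b} \<Longrightarrow> m \<le> cmod (w u)" and M: "0 \<le> M"
    and xy: "x \<in> {a..b}" "y \<in> {a..b}"
  shows "cmod (\<psi> y - \<psi> x) \<le> 2 * M / m * \<bar>y - x\<bar>"
proof -
  define h where "h = m / (2 * (M + 1))"
  have h: "0 < h" using m M by (simp add: h_def)
  have local: "cmod (\<psi> y - \<psi> x) \<le> 2 * M / m * (y - x)" if "x \<in> {a..b}" "y \<in> {a..b}" "x \<le> y" "y - x \<le> h" for x y
  proof -
    have close: "cmod (w u - w x) \<le> M * (u - x)" "cmod (w u - w x) < m / 2" if "u \<in> {x..y}" for u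
    proof -
      show *: "cmod (w u - w x) \<le> M * (u - x)"
        using lip[of u x] that \<open>x \<in> {a..b}\<close> \<open>y \<in> {a..b}\<close> by auto
      have "M * (u - x) \<le> M * h" using M that \<open>y - x \<le> h\<close> by (intro mult_left_mono) auto
      also have "\<dots> < (M + 1) * h" using h by (simp add: algebra_simps)
      also have "\<dots> = m / 2" using M by (simp add: h_def field_simps)
      finally show "cmod (w u - w x) < m / 2" using * by simp
    qed
    have mx: "m \<le> cmod (w x)" using m that by auto
    then have wx: "w x \<noteq> 0" using m by auto
    have "\<psi> y - \<psi> x = Ln (w y / w x)"
    proof (rule continuous_log_increment[where S = "{x..y}"])
      show "continuous_on {x..y} \<psi>" using that by (intro continuous_on_subset[OF \<psi>]) auto
      show "cmod (w u - w x) < cmod (w x)" if "u \<in> {x..y}" for u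
        using close(2)[OF that] mx m by auto
    qed (use that e in auto)
    also have "w y / w x = 1 + (w y - w x) / w x" using wx by (simp add: field_simps)
    also have "cmod (Ln (1 + (w y - w x) / w x)) \<le> 2 * cmod ((w y - w x) / w x)"
    proof (rule norm_Ln_le)
      have "cmod (w y - w x) < cmod (w x) / 2" using close(2)[of y] mx that by auto
      then show "cmod ((w y - w x) / w x) < 1/2" using wx by (simp add: norm_divide field_simps)
    qed
    also have "\<dots> \<le> 2 * (M * (y - x) / m)"
      unfolding norm_divide using close(1)[of y] that mx m M by (intro mult_left_mono frac_le) auto
    finally show ?thesis by simp
  qed
  have steps: "cmod (\<psi> y - \<psi> x) \<le> 2 * M / m * (y - x)"
    if "x \<in> {a..b}" "y \<in> {a..b}" "x \<le> y" "y - x \<le> real n * h" for x y n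
    using that
  proof (induction n arbitrary: y)
    case 0
    then show ?case by simp
  next
    case (Suc n)
    define z where "z = max x (y - h)"
    have z: "z \<in> {a..b}" "x \<le> z" "z \<le> y" "y - z \<le> h" "z - x \<le> real n * h"
      using Suc.prems h by (auto simp: z_def algebra_simps max_def)
    have "cmod (\<psi> y - \<psi> x) \<le> cmod (\<psi> y - \<psi> z) + cmod (\<psi> z - \<psi> x)"
      using norm_triangle_ineq[of "\<psi> y - \<psi> z" "\<psi> z - \<psi> x"] by simp
    also have "\<dots> \<le> 2 * M / m * (y - z) + 2 * M / m * (z - x)"
      using Suc z by (intro add_mono local Suc.IH) auto
    also have "\<dots> = 2 * M / m * (y - x)" by (simp only: distrib_left[symmetric]) simp
    finally show ?case .
  qed
  have *: "cmod (\<psi> y - \<psi> x) \<le> 2 * M / m * (y - x)" if "x \<in> {a..b}" "y \<in> {a..b}" "x \<le> y" for x y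
  proof -
    obtain n where "y - x < real n * h" using reals_Archimedean3[OF h] by blast
    then show ?thesis using steps[OF that, of n] by simp
  qed
  show ?thesis
  proof (cases "x \<le> y")
    case True then show ?thesis using *[OF xy] by simp
  next
    case False then show ?thesis using *[OF xy(2,1)] by (simp add: norm_minus_commute)
  qed
qed

lemma continuous_log_has_vector_derivative:
  fixes \<psi> w :: "real \<Rightarrow> complex"
  assumes \<psi>: "continuous_on {a<..<b} \<psi>" and e: "\<And>u. u \<in> {a<..<b} \<Longrightarrow> exp (\<psi> u) = w u"
    and x: "x \<in> {a<..<b}" and w: "(w has_vector_derivative w') (at x)"
  shows "(\<psi> has_vector_derivative w' / w x) (at x)"
proof -
  have w0: "w x \<noteq> 0" using e[OF x] by (metis exp_not_eq_zero)
  have "isCont w x" using w by (rule has_vector_derivative_continuous)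
  then obtain d1 where d1: "d1 > 0" "\<And>y. dist y x < d1 \<Longrightarrow> dist (w y) (w x) < cmod (w x)"
    using w0 unfolding continuous_at_eps_delta by (metis zero_less_norm_iff)
  define d where "d = min d1 (min (x - a) (b - x))"
  have d: "0 < d" using d1 x by (auto simp: d_def)
  have sub: "ball x d \<subseteq> {a<..<b}" by (auto simp: d_def dist_real_def)
  have eq: "\<psi> y = \<psi> x + Ln (w y / w x)" if "y \<in> ball x d" for y
  proof -
    have "\<psi> y - \<psi> x = Ln (w y / w x)"
    proof (rule continuous_log_increment[where S = "ball x d"])
      show "cmod (w u - w x) < cmod (w x)" if "u \<in> ball x d" for u
        using d1(2)[of u] that by (simp add: d_def dist_commute dist_norm)
    qed (use sub e d that in \<open>auto intro: continuous_on_subset[OF \<psi>]\<close>)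
    then show ?thesis by (simp add: algebra_simps)
  qed
  have "((\<lambda>y. w y / w x) has_vector_derivative w' / w x) (at x)"
    using w by (rule has_vector_derivative_divide)
  moreover have "(Ln has_field_derivative inverse (w x / w x)) (at (w x / w x))"
    using w0 by (intro has_field_derivative_Ln) auto
  ultimately have "((Ln \<circ> (\<lambda>y. w y / w x)) has_vector_derivative w' / w x * inverse (w x / w x)) (at x)"
    by (intro field_vector_diff_chain_at) auto
  from has_vector_derivative_add[OF has_vector_derivative_const this, of "\<psi> x"]
  have "((\<lambda>y. \<psi> x + Ln (w y / w x)) has_vector_derivative w' / w x) (at x)"
    using w0 by (simp add: o_def)
  then show ?thesis
    by (rule has_vector_derivative_transform_within_open[where S = "ball x d"]) (use d in \<open>auto intro: eq[symmetric]\<close>)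
qed

section \<open>Chord-arc geometry\<close>

text \<open>
  The distance along a closed curve of length \<open>l\<close> between the points with parameters \<open>x\<close> and \<open>y\<close>
  in \<open>{0..l}\<close>.
\<close>

definition arc_dist :: "real \<Rightarrow> real \<Rightarrow> real \<Rightarrow> real" where
  "arc_dist l x y = min \<bar>x - y\<bar> (l - \<bar>x - y\<bar>)"

text \<open>
  Along a partition the increments of \<open>B\<close> telescope.
\<close>

lemma curve_length_le_increment:
  assumes ab: "a \<le> b"
    and B: "\<And>x y. a \<le> x \<Longrightarrow> x \<le> y \<Longrightarrow> y \<le> b \<Longrightarrow> dist (\<gamma> x) (\<gamma> y) \<le> B y - B x"
  shows "curve_length \<gamma> a b \<le> ennreal (B b - B a)"
  unfolding curve_length_def
proof (rule SUP_least)
  fix ts :: "real list" assume "ts \<in> {ts. sorted ts \<and> set ts \<subseteq> {a..b}}"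
  then have ts: "sorted ts" "set ts \<subseteq> {a..b}" by auto
  have Bm: "B x \<le> B y" if "a \<le> x" "x \<le> y" "y \<le> b" for x y
    using B[OF that] zero_le_dist[of "\<gamma> x" "\<gamma> y"] by linarith
  show "(\<Sum>i<length ts - 1. ennreal (dist (\<gamma> (ts ! i)) (\<gamma> (ts ! Suc i)))) \<le> ennreal (B b - B a)"
  proof (cases ts)
    case Nil
    then show ?thesis by simp
  next
    case (Cons t ts')
    let ?n = "length ts - 1"
    have nth: "ts ! i \<in> {a..b}" if "i < length ts" for i using ts(2) that nth_mem by blast
    have "(\<Sum>i<?n. ennreal (dist (\<gamma> (ts ! i)) (\<gamma> (ts ! Suc i)))) = ennreal (\<Sum>i<?n. dist (\<gamma> (ts ! i)) (\<gamma> (ts ! Suc i)))"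
      by (rule sum_ennreal) auto
    also have "\<dots> \<le> ennreal (\<Sum>i<?n. B (ts ! Suc i) - B (ts ! i))"
      using nth ts(1) by (intro ennreal_leI sum_mono B) (auto simp: sorted_iff_nth_mono)
    also have "(\<Sum>i<?n. B (ts ! Suc i) - B (ts ! i)) = B (ts ! ?n) - B (ts ! 0)"
      by (rule sum_lessThan_telescope)
    also have "ennreal \<dots> \<le> ennreal (B b - B a)"
      using nth[of 0] nth[of ?n] Cons ab by (intro ennreal_leI diff_mono Bm) auto
    finally show ?thesis .
  qed
qed

text \<open>
  A partition of \<open>{a..b}\<close> may be continued by the two points \<open>b\<close> and \<open>c\<close>.
\<close>

lemma curve_length_add_dist_le:
  assumes "a \<le> b" "b \<le> c"
  shows "curve_length \<gamma> a b + ennreal (dist (\<gamma> b) (\<gamma> c)) \<le> curve_length \<gamma> a c"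
proof -
  let ?P = "\<lambda>b. {ts. sorted ts \<and> set ts \<subseteq> {a..b}}"
  let ?f = "\<lambda>ts i. ennreal (dist (\<gamma> (ts ! i)) (\<gamma> (ts ! Suc i)))"
  let ?S = "\<lambda>ts. \<Sum>i<length ts - 1. ?f ts i"
  have "curve_length \<gamma> a b + ennreal (dist (\<gamma> b) (\<gamma> c)) = (SUP ts\<in>?P b. ?S ts + ennreal (dist (\<gamma> b) (\<gamma> c)))"
    unfolding curve_length_def by (intro ennreal_SUP_add_left[symmetric]) (auto intro: exI[of _ "[]"])
  also have "\<dots> \<le> curve_length \<gamma> a c"
  proof (rule SUP_least)
    fix ts assume "ts \<in> ?P b"
    then have ts: "sorted ts" "set ts \<subseteq> {a..b}" by auto
    let ?n = "length ts" and ?us = "ts @ [b, c]"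
    have us: "?us \<in> ?P c" using ts assms by (auto simp: sorted_append)
    have "?S ts + ennreal (dist (\<gamma> b) (\<gamma> c)) = (\<Sum>i<?n - 1. ?f ?us i) + ?f ?us ?n"
      by (intro arg_cong2[of _ _ _ _ "(+)"] sum.cong) (auto simp: nth_append)
    also have "\<dots> = sum (?f ?us) (insert ?n {..<?n - 1})" by (subst sum.insert) (auto simp: add.commute)
    also have "\<dots> \<le> sum (?f ?us) {..<length ?us - 1}" by (rule sum_mono2) auto
    also have "\<dots> \<le> curve_length \<gamma> a c"
      unfolding curve_length_def by (rule SUP_upper2[OF us]) auto
    finally show "?S ts + ennreal (dist (\<gamma> b) (\<gamma> c)) \<le> curve_length \<gamma> a c" .
  qed
  finally show ?thesis .
qed

lemma arc_length_parametrization_nonexpansive: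
  assumes \<gamma>: "arc_length_parametrization \<gamma> l \<Gamma>" and xy: "x \<in> {0..l}" "y \<in> {0..l}"
  shows "cmod (\<gamma> x - \<gamma> y) \<le> \<bar>x - y\<bar>"
proof -
  have len: "curve_length \<gamma> 0 t = ennreal t" if "t \<in> {0..l}" for t
    using \<gamma> that by (auto simp: arc_length_parametrization_def)
  have *: "dist (\<gamma> a) (\<gamma> b) \<le> b - a" if "a \<in> {0..l}" "b \<in> {0..l}" "a \<le> b" for a b
  proof -
    have "ennreal (a + dist (\<gamma> a) (\<gamma> b)) \<le> ennreal b"
      using curve_length_add_dist_le[of 0 a b \<gamma>] that len by simp
    then show ?thesis using that by (simp del: ennreal_plus)
  qed
  show ?thesis
    using *[of x y] *[of y x] xy by (cases "x \<le> y") (auto simp: dist_norm norm_minus_commute)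
qed

lemma cmod_cis_diff: "cmod (cis a - cis b) = 2 * \<bar>sin ((a - b) / 2)\<bar>"
proof -
  have "cis a - cis b = cis b * (cis (a - b) - 1)"
    by (simp add: algebra_simps cis_mult)
  then have "cmod (cis a - cis b) = cmod (cis (a - b) - 1)" by (simp add: norm_mult)
  also have "\<dots> = 2 * \<bar>sin ((a - b) / 2)\<bar>"
    using dist_exp_i_1[of "a - b"] by (simp add: cis_conv_exp)
  finally show ?thesis .
qed

text \<open>
  The constant 1/4 is far from optimal but needs only \<open>\<pi> < 4\<close>; its size affects the final
  constant alone.
\<close>

lemma sin_ge_quarter:
  assumes "0 \<le> x" "x \<le> pi / 2"
  shows "x / 4 \<le> sin x"
proof (cases "x \<le> pi / 3")
  case True
  have "(\<lambda>x. sin x - x / 2) 0 \<le> (\<lambda>x. sin x - x / 2) x"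
  proof (rule DERIV_nonneg_imp_nondecreasing[OF assms(1)])
    fix y assume y: "0 \<le> y" "y \<le> x"
    have "cos (pi / 3) \<le> cos y" using y True by (intro cos_monotone_0_pi_le) auto
    then show "\<exists>z. ((\<lambda>x. sin x - x / 2) has_real_derivative z) (at y) \<and> 0 \<le> z"
      by (intro exI[of _ "cos y - 1/2"]) (auto simp: cos_60 intro!: derivative_eq_intros)
  qed
  then show ?thesis using assms by simp
next
  case False
  have "1 / 2 \<le> sqrt 3 / 2" by simp
  also have "\<dots> = sin (pi / 3)" by (simp add: sin_60)
  also have "\<dots> \<le> sin x" using False assms by (intro sin_monotone_2pi_le) auto
  finally show ?thesis using assms pi_less_4 by simp
qed

lemma cis_diff_ge:
  assumes "\<bar>a - b\<bar> \<le> 2 * pi"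
  shows "min \<bar>a - b\<bar> (2 * pi - \<bar>a - b\<bar>) / 4 \<le> cmod (cis a - cis b)"
proof -
  define x where "x = \<bar>a - b\<bar> / 2"
  have x: "0 \<le> x" "x \<le> pi" "min \<bar>a - b\<bar> (2 * pi - \<bar>a - b\<bar>) = 2 * min x (pi - x)"
    using assms by (auto simp: x_def min_def)
  have "\<bar>sin ((a - b) / 2)\<bar> = \<bar>sin x\<bar>" 
    using sin_minus[of "(a - b) / 2"] by (cases "a \<le> b") (auto simp: x_def minus_divide_left)
  also have "\<dots> = sin x" using x by (simp add: sin_ge_zero)
  also have "sin x \<ge> min x (pi - x) / 4"
  proof (cases "x \<le> pi / 2")
    case True then show ?thesis using sin_ge_quarter[of x] x by auto
  next
    case False then show ?thesis using sin_ge_quarter[of "pi - x"] x by auto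
  qed
  finally show ?thesis unfolding cmod_cis_diff x(3) by simp
qed

text \<open>
  An angle function of a simple loop in the unit circle is injective on the half-open interval,
  hence monotone there; the sign \<open>\<sigma>\<close> absorbs the orientation.  If its total change were a larger
  multiple of \<open>2\<pi>\<close>, the intermediate value theorem would produce a second passage through the
  initial point.
\<close>

lemma circle_loop_lift:
  fixes e :: "real \<Rightarrow> complex"
  assumes l: "0 < l" and e: "continuous_on {0..l} e" "\<And>t. t \<in> {0..l} \<Longrightarrow> cmod (e t) = 1"
    "inj_on e {0..<l}" "e l = e 0"
  obtains \<theta> \<sigma> where "\<sigma> = 1 \<or> \<sigma> = -1" "\<And>t. t \<in> {0..l} \<Longrightarrow> e t = cis (\<sigma> * \<theta> t)" "mono_on {0..l} \<theta>"
    "\<theta> l - \<theta> 0 = 2 * pi"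
proof -
  have nz: "e t \<noteq> 0" if "t \<in> {0..l}" for t using e(2)[OF that] by auto
  obtain g where g: "continuous_on {0..l} g" "\<And>t. t \<in> {0..l} \<Longrightarrow> e t = exp (g t)"
    using continuous_logarithm_on_contractible[OF e(1) _ nz] convex_imp_contractible[of "{0..l}"] convex_real_interval(5)
    by metis
  define \<psi> where "\<psi> t = Im (g t)" for t
  have e\<psi>: "e t = cis (\<psi> t)" if "t \<in> {0..l}" for t
  proof -
    have "exp (Re (g t)) = 1" using g(2)[OF that] e(2)[OF that] norm_exp_eq_Re[of "g t"] by simp
    then show ?thesis using g(2)[OF that] by (simp add: \<psi>_def exp_eq_polar)
  qed
  have \<psi>c: "continuous_on {0..l} \<psi>" unfolding \<psi>_def by (intro continuous_intros g)
  have "inj_on \<psi> {0..<l}"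
    using e(3) by (auto simp: inj_on_def e\<psi>)
  moreover have "continuous_on {0..<l} \<psi>" by (rule continuous_on_subset[OF \<psi>c]) auto
  ultimately have "strict_mono_on {0..<l} \<psi> \<or> strict_antimono_on {0..<l} \<psi>"
    using injective_eq_monotone_map[of "{0..<l}" \<psi>] by (auto simp: is_interval_co)
  then obtain \<sigma> :: real where \<sigma>: "\<sigma> = 1 \<or> \<sigma> = -1" "strict_mono_on {0..<l} (\<lambda>t. \<sigma> * \<psi> t)"
    by (elim disjE) (force simp: monotone_on_def)+
  define \<theta> where "\<theta> t = \<sigma> * \<psi> t" for t
  have e\<theta>: "e t = cis (\<sigma> * \<theta> t)" if "t \<in> {0..l}" for t
    using \<sigma>(1) e\<psi>[OF that] by (auto simp: \<theta>_def)
  have \<theta>c: "continuous_on {0..l} \<theta>" unfolding \<theta>_def by (intro continuous_intros \<psi>c)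
  have mono: "\<theta> x < \<theta> y" if "0 \<le> x" "x < y" "y < l" for x y
    using \<sigma>(2) that by (auto simp: monotone_on_def \<theta>_def)
  have last: "\<theta> x < \<theta> l" if x: "0 \<le> x" "x < l" for x
  proof (rule ccontr)
    assume "\<not> \<theta> x < \<theta> l"
    define m where "m = (x + l) / 2"
    have m: "x < m" "m < l" using x by (auto simp: m_def)
    have "\<theta> x < \<theta> m" using mono x m by auto
    define v where "v = (\<theta> x + \<theta> m) / 2"
    have v: "\<theta> l \<le> v" "v < \<theta> m" "\<theta> x < v" using \<open>\<theta> x < \<theta> m\<close> \<open>\<not> \<theta> x < \<theta> l\<close> by (auto simp: v_def)
    obtain u where u: "m \<le> u" "u \<le> l" "\<theta> u = v"
      using IVT2'[of \<theta> l v m] v m continuous_on_subset[OF \<theta>c, of "{m..l}"] x by auto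
    then show False using mono[of m u] v m x \<open>\<not> \<theta> x < \<theta> l\<close> by (cases "u = l"; cases "u = m") auto
  qed
  have "cis (\<sigma> * \<theta> l) = cis (\<sigma> * \<theta> 0)" using e\<theta>[of 0] e\<theta>[of l] e(4) l by auto
  then have "cis (\<sigma> * \<theta> l - \<sigma> * \<theta> 0) = 1" by (simp add: cis_divide[symmetric])
  from arg_cong[OF this, of Re] have "cos (\<sigma> * \<theta> l - \<sigma> * \<theta> 0) = 1" by simp
  then have "cos (\<theta> l - \<theta> 0) = 1" using \<sigma>(1) cos_minus[of "\<theta> l - \<theta> 0"] by auto
  then obtain n :: int where n: "\<theta> l - \<theta> 0 = real_of_int n * (2 * pi)"
    unfolding cos_one_2pi_int by auto
  have "0 < real_of_int n * (2 * pi)" using last[of 0] l n by linarith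
  then have n1: "1 \<le> n" by (simp add: zero_less_mult_iff)
  have "n = 1"
  proof (rule ccontr)
    assume "n \<noteq> 1"
    then have "2 * (2 * pi) \<le> real_of_int n * (2 * pi)" using n1 by (intro mult_right_mono) auto
    then have lt: "\<theta> 0 + 2 * pi < \<theta> l" using n pi_gt_zero by linarith
    obtain u where u: "0 \<le> u" "u \<le> l" "\<theta> u = \<theta> 0 + 2 * pi"
      using IVT'[of \<theta> 0 "\<theta> 0 + 2 * pi" l] lt \<theta>c l by auto
    have "u \<noteq> 0" "u \<noteq> l" using u lt by auto
    moreover have "e u = e 0"
    proof -
      have "cis (\<theta> 0 + 2 * pi) = cis (\<theta> 0)" "cis (- (\<theta> 0 + 2 * pi)) = cis (- \<theta> 0)"
        by (simp_all add: complex_eq_iff cos_diff sin_diff)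
      then show ?thesis using e\<theta>[of u] e\<theta>[of 0] u l \<sigma>(1) by auto
    qed
    ultimately show False using e(3) u l by (auto simp: inj_on_def)
  qed
  moreover have "mono_on {0..l} \<theta>"
    by (rule mono_onI) (metis atLeastAtMost_iff last mono le_less order_refl)
  ultimately show ?thesis using that \<sigma>(1) e\<theta> n by simp
qed

text \<open>
  Pulling \<open>\<gamma>\<close> back by the bi-Lipschitz map gives a simple loop in the unit circle, with a monotone
  angle \<open>\<theta>\<close>.  The length of \<open>\<gamma>\<close> on \<open>{a..b}\<close> is at most \<open>L (\<theta> b - \<theta> a)\<close>, and the chord is at least
  a multiple of the chord of the corresponding angle.  The constant \<open>c\<close> is chosen before the
  parametrization, which makes the final estimate uniform.
\<close>

lemma chord_arc_lower_bound:
  assumes "chord_arc_curve \<Gamma>"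
  obtains c where "0 < c"
    "\<And>\<gamma> l x y. arc_length_parametrization \<gamma> l \<Gamma> \<Longrightarrow> x \<in> {0..l} \<Longrightarrow> y \<in> {0..l} \<Longrightarrow>
       c * arc_dist l x y \<le> cmod (\<gamma> x - \<gamma> y)"
proof -
  obtain F G :: "complex \<Rightarrow> complex" and L where FG: "homeomorphism UNIV UNIV F G"
    and F: "lipschitz_on L UNIV F" and G: "lipschitz_on L UNIV G" and \<Gamma>: "\<Gamma> = F ` sphere 0 1"
    using assms unfolding chord_arc_curve_def by blast
  have inv: "G (F z) = z" "F (G z) = z" for z using FG by (auto simp: homeomorphism_def)
  have Fl: "cmod (F z - F w) \<le> L * cmod (z - w)" and Gl: "cmod (G z - G w) \<le> L * cmod (z - w)" for z w
    using lipschitz_onD[OF F] lipschitz_onD[OF G] by (auto simp: dist_norm)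
  have "1 \<le> L * cmod (F 1 - F 0)" using Gl[of "F 1" "F 0"] by (simp add: inv)
  moreover have "0 \<le> L" using F by (rule lipschitz_on_nonneg)
  ultimately have L: "0 < L" by (cases "L = 0") auto
  show ?thesis
  proof (rule that[of "1 / (4 * L\<^sup>2)"])
    show "0 < 1 / (4 * L\<^sup>2)" using L by simp
  next
    fix \<gamma> l x y
    assume par: "arc_length_parametrization \<gamma> l \<Gamma>" and xy: "x \<in> {0..l}" "y \<in> {0..l}"
    note pd = par[unfolded arc_length_parametrization_def]
    have l: "0 < l" and \<gamma>c: "continuous_on {0..l} \<gamma>" and len: "\<And>t. t \<in> {0..l} \<Longrightarrow> curve_length \<gamma> 0 t = ennreal t"
      using pd by auto
    define e where "e t = G (\<gamma> t)" for t
    have Ge: "\<gamma> t = F (e t)" for t by (simp add: e_def inv)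
    obtain \<theta> \<sigma> where \<theta>: "\<sigma> = 1 \<or> \<sigma> = -1" "\<And>t. t \<in> {0..l} \<Longrightarrow> e t = cis (\<sigma> * \<theta> t)"
        "mono_on {0..l} \<theta>" "\<theta> l - \<theta> 0 = 2 * pi"
    proof (rule circle_loop_lift[OF l, of e])
      show "continuous_on {0..l} e" unfolding e_def
        by (rule continuous_on_compose2[OF lipschitz_on_continuous_on[OF G] \<gamma>c]) auto
      show "cmod (e t) = 1" if "t \<in> {0..l}" for t
      proof -
        have "\<gamma> t \<in> F ` sphere 0 1" using pd that \<Gamma> by blast
        then show ?thesis by (auto simp: e_def inv)
      qed
      show "inj_on e {0..<l}" using pd by (auto simp: inj_on_def Ge) 
      show "e l = e 0" using pd by (simp add: e_def)
    qed (use that in blast)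
    have \<sigma>d: "\<bar>\<sigma> * u - \<sigma> * v\<bar> = \<bar>u - v\<bar>" for u v using \<theta>(1) by auto
    have m: "\<theta> a \<le> \<theta> b" if "0 \<le> a" "a \<le> b" "b \<le> l" for a b
      using \<theta>(3) that by (auto simp: monotone_on_def)
    have up: "cmod (\<gamma> a - \<gamma> b) \<le> L * (\<theta> b - \<theta> a)" if ab: "0 \<le> a" "a \<le> b" "b \<le> l" for a b
    proof -
      have "cmod (\<gamma> a - \<gamma> b) \<le> L * cmod (e a - e b)" unfolding Ge by (rule Fl)
      also have "cmod (e a - e b) = 2 * \<bar>sin ((\<sigma> * \<theta> a - \<sigma> * \<theta> b) / 2)\<bar>"
        using \<theta>(2) ab by (simp add: cmod_cis_diff)
      also have "\<dots> \<le> 2 * \<bar>(\<sigma> * \<theta> a - \<sigma> * \<theta> b) / 2\<bar>" by (intro mult_left_mono abs_sin_x_le_abs_x) auto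
      also have "\<dots> = \<theta> b - \<theta> a" using \<sigma>d[of "\<theta> a" "\<theta> b"] m[OF ab] by simp
      finally show ?thesis using L by simp
    qed
    have arc: "b - a \<le> L * (\<theta> b - \<theta> a)" if ab: "0 \<le> a" "a \<le> b" "b \<le> l" for a b
    proof -
      \<comment> \<open>Length is parameter up to \<open>a\<close>; after \<open>a\<close> it is controlled by the angle.\<close>
      define B where "B x = (if x \<le> a then x else a + L * (\<theta> x - \<theta> a))" for x
      have Bb: "dist (\<gamma> u) (\<gamma> v) \<le> B v - B u" if uv: "0 \<le> u" "u \<le> v" "v \<le> b" for u v
      proof -
        have n: "cmod (\<gamma> p - \<gamma> q) \<le> \<bar>p - q\<bar>" if "p \<in> {0..l}" "q \<in> {0..l}" for p q
          by (rule arc_length_parametrization_nonexpansive[OF par that])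
        consider "v \<le> a" | "u \<le> a" "a < v" | "a < u" by linarith
        then show ?thesis
        proof cases
          case 1
          then show ?thesis using n[of u v] uv ab by (auto simp: B_def dist_norm)
        next
          case 2
          have "dist (\<gamma> u) (\<gamma> v) \<le> cmod (\<gamma> u - \<gamma> a) + cmod (\<gamma> a - \<gamma> v)"
            by (metis dist_norm dist_triangle)
          also have "\<dots> \<le> (a - u) + L * (\<theta> v - \<theta> a)"
            using n[of u a] up[of a v] uv ab 2 by (intro add_mono) auto
          finally show ?thesis using 2 by (simp add: B_def)
        next
          case 3
          then show ?thesis using up[of u v] uv ab by (auto simp: B_def dist_norm algebra_simps)
        qed
      qed
      have "ennreal b = curve_length \<gamma> 0 b" using len ab by simp
      also have "\<dots> \<le> ennreal (B b - B 0)" using ab Bb by (intro curve_length_le_increment) auto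
      also have "B b - B 0 = a + L * (\<theta> b - \<theta> a)" using ab by (auto simp: B_def)
      finally have "b \<le> a + L * (\<theta> b - \<theta> a)" using ab L m[OF ab]
        by (subst (asm) ennreal_le_iff) auto
      then show ?thesis by simp
    qed
    have main: "1 / (4 * L\<^sup>2) * arc_dist l a b \<le> cmod (\<gamma> a - \<gamma> b)" if ab: "0 \<le> a" "a \<le> b" "b \<le> l" for a b
    proof -
      define \<Delta> where "\<Delta> = \<theta> b - \<theta> a"
      have \<Delta>: "0 \<le> \<Delta>" "\<Delta> \<le> 2 * pi" using m[of 0 a] m[of a b] m[of b l] ab \<theta>(4) by (auto simp: \<Delta>_def)
      have "b - a \<le> L * \<Delta>" using arc[of a b] ab by (simp add: \<Delta>_def)
      moreover have "l - (b - a) \<le> L * (2 * pi - \<Delta>)"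
      proof -
        have "l - (b - a) \<le> L * (\<theta> a - \<theta> 0) + L * (\<theta> l - \<theta> b)" using arc[of 0 a] arc[of b l] ab by linarith
        also have "\<dots> = L * ((\<theta> l - \<theta> 0) - \<Delta>)" by (simp add: \<Delta>_def algebra_simps)
        finally show ?thesis by (simp add: \<theta>(4))
      qed
      ultimately have "arc_dist l a b \<le> min (L * \<Delta>) (L * (2 * pi - \<Delta>))"
        using ab unfolding arc_dist_def by (intro min.mono) auto
      also have "\<dots> = L * min \<Delta> (2 * pi - \<Delta>)" using L by (simp add: min_mult_distrib_left)
      also have "\<dots> \<le> L * (4 * cmod (e a - e b))"
      proof (intro mult_left_mono)
        have "\<bar>\<sigma> * \<theta> a - \<sigma> * \<theta> b\<bar> = \<Delta>" using \<sigma>d[of "\<theta> a" "\<theta> b"] \<Delta> by (simp add: \<Delta>_def)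
        then show "min \<Delta> (2 * pi - \<Delta>) \<le> 4 * cmod (e a - e b)"
          using cis_diff_ge[of "\<sigma> * \<theta> a" "\<sigma> * \<theta> b"] \<Delta> \<theta>(2)[of a] \<theta>(2)[of b] ab by simp
      qed (use L in auto)
      also have "\<dots> \<le> L * (4 * (L * cmod (\<gamma> a - \<gamma> b)))"
        using L Gl by (intro mult_left_mono) (auto simp: e_def)
      finally show ?thesis using L by (simp add: field_simps power2_eq_square)
    qed
    show "1 / (4 * L\<^sup>2) * arc_dist l x y \<le> cmod (\<gamma> x - \<gamma> y)"
    proof (cases "x \<le> y")
      case True then show ?thesis using main[of x y] xy by auto
    next
      case False
      then show ?thesis using main[of y x] xy by (auto simp: arc_dist_def norm_minus_commute abs_minus_commute)
    qed
  qed
qed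

section \<open>Truncated Cauchy integrals of the constant function\<close>

lemma set_integrable_bounded:
  fixes f :: "real \<Rightarrow> complex"
  assumes A: "A \<in> sets borel" "A \<subseteq> {a..b}" and f: "set_borel_measurable lborel A f"
    and B: "\<And>x. x \<in> A \<Longrightarrow> cmod (f x) \<le> B"
  shows "set_integrable lborel A f"
proof -
  have "emeasure lborel A \<le> emeasure lborel {a..b}" using A by (intro emeasure_mono) auto
  also have "\<dots> < \<infinity>" by (cases "a \<le> b") auto
  finally have fin: "emeasure lborel A < \<infinity>" .
  have "integrable lborel (\<lambda>x. indicator A x *\<^sub>R (indicator A x *\<^sub>R f x))"
    by (rule integrableI_bounded_set_indicator[where B=B])
      (use A f B fin in \<open>auto simp: set_borel_measurable_def\<close>)
  moreover have "(\<lambda>x. indicator A x *\<^sub>R (indicator A x *\<^sub>R f x)) = (\<lambda>x. indicator A x *\<^sub>R f x)"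
    by (auto simp: indicator_def)
  ultimately show ?thesis by (simp only: set_integrable_def)
qed

lemma set_integral_cong_off_finite:
  fixes f :: "real \<Rightarrow> complex"
  assumes N: "finite N" and AB: "A - N = B - N" "A \<in> sets borel" "B \<in> sets borel"
    and f: "set_borel_measurable lborel (A \<union> B) f"
  shows "(LINT x:A|lborel. f x) = (LINT x:B|lborel. f x)"
  unfolding set_lebesgue_integral_def
proof (rule integral_cong_AE)
  have "AE x in lborel. x \<notin> N"
    by (rule AE_not_in) (use N in \<open>auto intro: finite_imp_null_set_lborel\<close>)
  then show "AE x in lborel. indicator A x *\<^sub>R f x = indicator B x *\<^sub>R f x"
    using AB(1) by (elim AE_mp) (auto simp: indicator_def)
  show "(\<lambda>x. indicator A x *\<^sub>R f x) \<in> borel_measurable lborel" "(\<lambda>x. indicator B x *\<^sub>R f x) \<in> borel_measurable lborel"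
    using AB set_borel_measurable_subset[OF f] by (auto simp: set_borel_measurable_def)
qed

text \<open>
  The function \<open>D\<close> is a Borel version of the derivative of \<open>\<gamma>\<close>.  Keeping it as a parameter
  separates the analysis from the values that \<open>vector_derivative\<close> takes at exceptional points.
\<close>

locale chord_arc_loop =
  fixes \<gamma> D :: "real \<Rightarrow> complex" and l c :: real
  assumes l_pos: "0 < l" and c_pos: "0 < c" and closed: "\<gamma> l = \<gamma> 0"
    and nonexpansive: "\<And>x y. x \<in> {0..l} \<Longrightarrow> y \<in> {0..l} \<Longrightarrow> cmod (\<gamma> x - \<gamma> y) \<le> \<bar>x - y\<bar>"
    and chord_arc: "\<And>x y. x \<in> {0..l} \<Longrightarrow> y \<in> {0..l} \<Longrightarrow> c * arc_dist l x y \<le> cmod (\<gamma> x - \<gamma> y)"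
    and D_measurable [measurable]: "D \<in> borel_measurable borel"
    and D_derivative: "AE t in lborel. t \<in> {0<..<l} \<longrightarrow> (\<gamma> has_vector_derivative D t) (at t)"
    and D_le_1: "\<And>t. cmod (D t) \<le> 1"
begin

definition cauchy_kernel :: "real \<Rightarrow> real \<Rightarrow> complex" where
  "cauchy_kernel t u = D u / (\<gamma> u - \<gamma> t)"

lemma continuous_\<gamma>: "continuous_on {0..l} \<gamma>"
  by (rule lipschitz_on_continuous_on[of 1]) (auto intro!: lipschitz_onI nonexpansive simp: dist_norm)

lemma \<gamma>_diff_nonzero:
  assumes "x \<in> {0..l}" "y \<in> {0..l}" "0 < arc_dist l x y"
  shows "\<gamma> x \<noteq> \<gamma> y"
proof -
  have "0 < c * arc_dist l x y" using assms(3) c_pos by simp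
  then show ?thesis using chord_arc[OF assms(1,2)] by auto
qed

lemma set_measurable_kernel:
  assumes "A \<in> sets borel" "A \<subseteq> {0..l}"
  shows "set_borel_measurable lborel A (\<lambda>u. D u / (\<gamma> u - z))"
proof -
  have [measurable]: "(\<lambda>u. indicator {0..l} u *\<^sub>R (\<gamma> u - z)) \<in> borel_measurable borel"
    by (intro borel_measurable_continuous_on_indicator continuous_intros continuous_\<gamma>) auto
  have "(\<lambda>u. D u / (indicator {0..l} u *\<^sub>R (\<gamma> u - z))) \<in> borel_measurable borel" by measurable
  moreover have "(\<lambda>u. indicator {0..l} u *\<^sub>R (D u / (\<gamma> u - z))) = (\<lambda>u. D u / (indicator {0..l} u *\<^sub>R (\<gamma> u - z)))"
    by (auto simp: indicator_def)
  ultimately have "set_borel_measurable lborel {0..l} (\<lambda>u. D u / (\<gamma> u - z))"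
    by (simp add: set_borel_measurable_def)
  then show ?thesis by (rule set_borel_measurable_subset) (use assms in auto)
qed

definition far :: "real \<Rightarrow> real \<Rightarrow> real set" where
  "far t r = {u \<in> {0..l}. r < arc_dist l t u}"

abbreviation far_integral :: "real \<Rightarrow> real \<Rightarrow> complex" where
  "far_integral t r \<equiv> LINT u:far t r|lborel. cauchy_kernel t u"

lemma far_borel [measurable]: "far t r \<in> sets borel"
proof -
  have "far t r = {u. 0 \<le> u \<and> u \<le> l \<and> r < arc_dist l t u}" by (auto simp: far_def)
  also have "\<dots> \<in> sets borel" unfolding arc_dist_def by measurable
  finally show ?thesis .
qed

lemma far_subset: "far t r \<subseteq> {0..l}" by (auto simp: far_def)

lemma cauchy_kernel_bound:
  assumes "t \<in> {0..l}" "u \<in> {0..l}" "0 < arc_dist l t u"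
  shows "cmod (cauchy_kernel t u) \<le> 1 / (c * arc_dist l t u)"
proof -
  have "c * arc_dist l t u \<le> cmod (\<gamma> u - \<gamma> t)"
    using chord_arc[OF assms(1,2)] by (simp add: norm_minus_commute)
  moreover have "0 < c * arc_dist l t u" using assms c_pos by simp
  ultimately show ?thesis
    unfolding cauchy_kernel_def norm_divide using D_le_1[of u] by (intro frac_le) auto
qed

lemma cauchy_kernel_integrable_far:
  assumes "t \<in> {0..l}" "0 < r"
  shows "set_integrable lborel (far t r) (cauchy_kernel t)"
proof (rule set_integrable_bounded[OF far_borel far_subset])
  show "set_borel_measurable lborel (far t r) (cauchy_kernel t)"
    unfolding cauchy_kernel_def by (rule set_measurable_kernel[OF far_borel far_subset])
  fix u assume u: "u \<in> far t r"
  have "cmod (cauchy_kernel t u) \<le> 1 / (c * arc_dist l t u)"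
    using u assms by (intro cauchy_kernel_bound) (auto simp: far_def)
  also have "\<dots> \<le> 1 / (c * r)" using u assms c_pos by (intro divide_left_mono mult_left_mono) (auto simp: far_def)
  finally show "cmod (cauchy_kernel t u) \<le> 1 / (c * r)" .
qed

text \<open>
  The parameters of nondegenerate chords.  The condition \<open>y - x < l\<close> removes only the corner
  \<open>(0, l)\<close>, where the chord of the closed curve vanishes, and the set remains convex, hence
  contractible: a continuous logarithm of the chord exists.
\<close>

definition chord_params :: "(real \<times> real) set" where
  "chord_params = {(x, y). 0 \<le> x \<and> x < y \<and> y \<le> l \<and> y - x < l}"

lemma convex_chord_params: "convex chord_params"
proof -
  have eq: "chord_params = {p. 0 \<le> fst p} \<inter> {p. 0 < snd p - fst p} \<inter> {p. snd p \<le> l} \<inter> {p. snd p - fst p < l}"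
    by (auto simp: chord_params_def)
  have lin: "linear (\<lambda>p::real\<times>real. snd p - fst p)" "linear (fst :: real\<times>real \<Rightarrow> real)" "linear (snd :: real\<times>real \<Rightarrow> real)"
    by (auto intro!: linearI simp: algebra_simps)
  have "convex ((\<lambda>p::real\<times>real. snd p - fst p) -` {0<..})" "convex ((\<lambda>p::real\<times>real. snd p - fst p) -` {..<l})"
    "convex ((fst :: real\<times>real \<Rightarrow> real) -` {0..})" "convex ((snd :: real\<times>real \<Rightarrow> real) -` {..l})"
    by (intro convex_linear_vimage lin convex_real_interval)+
  then show ?thesis unfolding eq by (intro convex_Int) (auto simp: vimage_def)
qed

definition chord_log :: "real \<times> real \<Rightarrow> complex" where
  "chord_log = (SOME \<psi>. continuous_on chord_params \<psi> \<and> (\<forall>x y. (x, y) \<in> chord_params \<longrightarrow> exp (\<psi> (x, y)) = \<gamma> y - \<gamma> x))"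

lemma chord_log: "continuous_on chord_params chord_log" "\<And>x y. (x, y) \<in> chord_params \<Longrightarrow> exp (chord_log (x, y)) = \<gamma> y - \<gamma> x"
proof -
  have nz: "(\<lambda>p. \<gamma> (snd p) - \<gamma> (fst p)) p \<noteq> 0" if "p \<in> chord_params" for p
    using that \<gamma>_diff_nonzero[of "snd p" "fst p"] by (auto simp: chord_params_def arc_dist_def)
  have "continuous_on chord_params (\<lambda>p. \<gamma> (snd p) - \<gamma> (fst p))"
    by (intro continuous_intros continuous_on_compose2[OF continuous_\<gamma>]) (auto simp: chord_params_def)
  from continuous_logarithm_on_contractible[OF this convex_imp_contractible[OF convex_chord_params] nz]
  obtain \<psi> where \<psi>: "continuous_on chord_params \<psi>" "\<And>p. p \<in> chord_params \<Longrightarrow> \<gamma> (snd p) - \<gamma> (fst p) = exp (\<psi> p)"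
    by blast
  have "\<exists>\<psi>. continuous_on chord_params \<psi> \<and> (\<forall>x y. (x, y) \<in> chord_params \<longrightarrow> exp (\<psi> (x, y)) = \<gamma> y - \<gamma> x)"
    using \<psi>(1) \<psi>(2)[symmetric] by (intro exI[of _ \<psi>]) simp
  from someI_ex[OF this] show "continuous_on chord_params chord_log" "\<And>x y. (x, y) \<in> chord_params \<Longrightarrow> exp (chord_log (x, y)) = \<gamma> y - \<gamma> x"
    unfolding chord_log_def[symmetric] by auto
qed

text \<open>
  Sliding a chord along the curve with fixed parameter difference \<open>r\<close>: it moves with speed at
  most 2 and keeps at least the length \<open>c \<cdot> min r (l - r)\<close>.
\<close>

lemma chord_log_diagonal:
  assumes "0 < r" "r < l" and xy: "0 \<le> x" "x + r \<le> l" "0 \<le> y" "y + r \<le> l"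
  shows "cmod (chord_log (y, y + r) - chord_log (x, x + r)) \<le> 4 / (c * min r (l - r)) * \<bar>y - x\<bar>"
proof -
  have "cmod (chord_log (y, y + r) - chord_log (x, x + r)) \<le> 2 * 2 / (c * min r (l - r)) * \<bar>y - x\<bar>"
  proof (rule continuous_log_lipschitz[where a = 0 and b = "l - r" and w = "\<lambda>u. \<gamma> (u + r) - \<gamma> u"])
    show "continuous_on {0..l - r} (\<lambda>u. chord_log (u, u + r))"
      using assms by (intro continuous_on_compose2[OF chord_log(1)] continuous_intros) (auto simp: chord_params_def)
    show "exp (chord_log (u, u + r)) = \<gamma> (u + r) - \<gamma> u" if "u \<in> {0..l - r}" for u
      using assms that by (intro chord_log(2)) (auto simp: chord_params_def)
    show "cmod ((\<gamma> (u + r) - \<gamma> u) - (\<gamma> (v + r) - \<gamma> v)) \<le> 2 * \<bar>u - v\<bar>" if "u \<in> {0..l - r}" "v \<in> {0..l - r}" for u v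
    proof -
      have "cmod ((\<gamma> (u + r) - \<gamma> u) - (\<gamma> (v + r) - \<gamma> v)) \<le> cmod (\<gamma> (u + r) - \<gamma> (v + r)) + cmod (\<gamma> u - \<gamma> v)"
        using norm_triangle_ineq4[of "\<gamma> (u + r) - \<gamma> (v + r)" "\<gamma> u - \<gamma> v"] by (simp add: algebra_simps)
      also have "\<dots> \<le> \<bar>u + r - (v + r)\<bar> + \<bar>u - v\<bar>"
        using that assms by (intro add_mono nonexpansive) auto
      finally show ?thesis by simp
    qed
    show "c * min r (l - r) \<le> cmod (\<gamma> (u + r) - \<gamma> u)" if "u \<in> {0..l - r}" for u
      using chord_arc[of "u + r" u] that assms by (simp add: arc_dist_def)
    show "0 < c * min r (l - r)" using c_pos assms by simp
  qed (use xy in auto)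
  then show ?thesis by simp
qed

text \<open>
  The change of the logarithm of the chord when the end points are exchanged, an odd multiple of
  \<open>\<pi>\<i>\<close>.  It is evaluated at the midpoint because there the sliding estimate bounds it at once.
\<close>

definition cauchy_jump :: complex where
  "cauchy_jump = chord_log (l / 2, l) - chord_log (0, l / 2)"

text \<open>
  The numbers \<open>\<gamma> l - \<gamma> t\<close> and \<open>\<gamma> t - \<gamma> 0\<close> are negatives of each other, so the exponential of the
  left-hand side is \<open>-1\<close> for every \<open>t\<close> and the left-hand side is locally constant.
\<close>

lemma cauchy_jump_eq:
  assumes "0 < t" "t < l"
  shows "chord_log (t, l) - chord_log (0, t) = cauchy_jump"
proof -
  have "(\<lambda>t. chord_log (t, l) - chord_log (0, t)) t = (\<lambda>t. chord_log (t, l) - chord_log (0, t)) (l / 2)"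
  proof (rule exp_one_range_discrete[where S = "{0<..<l}" and c = "-1"])
    show "continuous_on {0<..<l} (\<lambda>t. chord_log (t, l) - chord_log (0, t))"
      by (intro continuous_intros continuous_on_compose2[OF chord_log(1)]) (auto simp: chord_params_def)
    fix u assume u: "u \<in> {0<..<l}"
    then have "(u, l) \<in> chord_params" "(0, u) \<in> chord_params" by (auto simp: chord_params_def)
    then have "exp (chord_log (u, l) - chord_log (0, u)) = (\<gamma> l - \<gamma> u) / (\<gamma> u - \<gamma> 0)"
      by (simp add: exp_diff chord_log)
    also have "\<dots> = -1"
      using closed \<gamma>_diff_nonzero[of u 0] u by (simp add: arc_dist_def divide_eq_minus_1_iff)
    finally show "exp (chord_log (u, l) - chord_log (0, u)) = -1" .
  qed (use assms in auto)
  then show ?thesis by (simp add: cauchy_jump_def)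
qed

lemma cauchy_jump_bound: "cmod cauchy_jump \<le> 4 / c"
  using chord_log_diagonal[of "l / 2" 0 "l / 2"] l_pos c_pos by (simp add: cauchy_jump_def)

text \<open>
  The logarithm of the chord is an antiderivative of the Cauchy kernel.  The sign \<open>\<sigma>\<close> accounts for
  parameters \<open>u\<close> before \<open>t\<close>, where \<open>chord_log\<close> is a logarithm of \<open>\<gamma> t - \<gamma> u\<close>.
\<close>

lemma cauchy_kernel_integral_eq_log_increment:
  assumes tab: "t \<in> {0..l}" "0 \<le> a" "a \<le> b" "b \<le> l"
    and m: "0 < m" "\<And>u. u \<in> {a..b} \<Longrightarrow> m \<le> arc_dist l u t"
    and \<psi>: "continuous_on {a..b} \<psi>"
    and e: "\<sigma> = 1 \<or> \<sigma> = -1" "\<And>u. u \<in> {a..b} \<Longrightarrow> exp (\<psi> u) = \<sigma> * (\<gamma> u - \<gamma> t)"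
  shows "set_integrable lborel {a..b} (cauchy_kernel t)"
    "(LINT u:{a..b}|lborel. cauchy_kernel t u) = \<psi> b - \<psi> a"
proof -
  let ?w = "\<lambda>u. \<sigma> * (\<gamma> u - \<gamma> t)"
  have \<sigma>: "cmod \<sigma> = 1" "\<sigma> \<noteq> 0" using e(1) by auto
  have lip: "cmod (\<psi> x - \<psi> y) \<le> 2 * 1 / (c * m) * \<bar>x - y\<bar>" if "x \<in> {a..b}" "y \<in> {a..b}" for x y
  proof (rule continuous_log_lipschitz[where a = a and b = b and w = ?w])
    show "cmod (?w u - ?w v) \<le> 1 * \<bar>u - v\<bar>" if "u \<in> {a..b}" "v \<in> {a..b}" for u v
      using nonexpansive[of u v] that tab \<sigma> by (simp add: right_diff_distrib[symmetric] norm_mult)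
    show "c * m \<le> cmod (?w u)" if "u \<in> {a..b}" for u
    proof -
      have "c * m \<le> c * arc_dist l u t" using c_pos m(2)[OF that] by (intro mult_left_mono) auto
      also have "\<dots> \<le> cmod (\<gamma> u - \<gamma> t)" using that tab by (intro chord_arc) auto
      finally show ?thesis by (simp add: norm_mult \<sigma>)
    qed
  qed (use m c_pos e \<psi> that in auto)
  have meas: "set_borel_measurable lborel {a..b} (cauchy_kernel t)"
    unfolding cauchy_kernel_def using tab by (intro set_measurable_kernel) auto
  have der: "AE u in lborel. u \<in> {a<..<b} \<longrightarrow> (\<psi> has_vector_derivative cauchy_kernel t u) (at u)"
    using D_derivative
  proof (rule AE_mp, intro AE_I2 impI)
    fix u assume u: "u \<in> {0<..<l} \<longrightarrow> (\<gamma> has_vector_derivative D u) (at u)" "u \<in> {a<..<b}"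
    then have "(\<gamma> has_vector_derivative D u) (at u)" using tab by auto
    from has_vector_derivative_diff[OF this has_vector_derivative_const, of "\<gamma> t"]
    have "(?w has_vector_derivative \<sigma> * D u) (at u)"
      using has_vector_derivative_mult_right[of "\<lambda>u. \<gamma> u - \<gamma> t" "D u" "at u" \<sigma>] by simp
    then have "(\<psi> has_vector_derivative \<sigma> * D u / ?w u) (at u)"
      using e(2) u(2)
      by (intro continuous_log_has_vector_derivative[where a=a and b=b and w = ?w] continuous_on_subset[OF \<psi>]) auto
    then show "(\<psi> has_vector_derivative cauchy_kernel t u) (at u)"
      using \<sigma> by (simp add: cauchy_kernel_def)
  qed
  show "set_integrable lborel {a..b} (cauchy_kernel t)"
    by (rule lipschitz_FTC(1)[OF tab(3) lip meas der])
  show "(LINT u:{a..b}|lborel. cauchy_kernel t u) = \<psi> b - \<psi> a"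
    by (rule lipschitz_FTC(2)[OF tab(3) lip meas der])
qed

lemma cauchy_integral_after:
  assumes "0 \<le> t" "t < a" "a \<le> b" "b \<le> l" "b - t < l"
  shows "set_integrable lborel {a..b} (cauchy_kernel t)"
    "(LINT u:{a..b}|lborel. cauchy_kernel t u) = chord_log (t, b) - chord_log (t, a)"
proof -
  have "t \<in> {0..l}" "0 \<le> a" "0 < min (a - t) (l - (b - t))" using assms by auto
  moreover have "min (a - t) (l - (b - t)) \<le> arc_dist l u t" if "u \<in> {a..b}" for u
    using that assms by (auto simp: arc_dist_def)
  moreover have "continuous_on {a..b} (\<lambda>u. chord_log (t, u))"
    using assms by (intro continuous_on_compose2[OF chord_log(1)] continuous_intros) (auto simp: chord_params_def)
  moreover have "exp (chord_log (t, u)) = 1 * (\<gamma> u - \<gamma> t)" if "u \<in> {a..b}" for u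
    using assms that chord_log(2)[of t u] by (auto simp: chord_params_def)
  ultimately show "set_integrable lborel {a..b} (cauchy_kernel t)"
    "(LINT u:{a..b}|lborel. cauchy_kernel t u) = chord_log (t, b) - chord_log (t, a)"
    using cauchy_kernel_integral_eq_log_increment[of t a b _ "\<lambda>u. chord_log (t, u)" 1] assms by blast+
qed

lemma cauchy_integral_before:
  assumes "0 \<le> a" "a \<le> b" "b < t" "t \<le> l" "t - a < l"
  shows "set_integrable lborel {a..b} (cauchy_kernel t)"
    "(LINT u:{a..b}|lborel. cauchy_kernel t u) = chord_log (b, t) - chord_log (a, t)"
proof -
  have "t \<in> {0..l}" "b \<le> l" "0 < min (t - b) (l - (t - a))" using assms by auto
  moreover have "min (t - b) (l - (t - a)) \<le> arc_dist l u t" if "u \<in> {a..b}" for u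
    using that assms by (auto simp: arc_dist_def)
  moreover have "continuous_on {a..b} (\<lambda>u. chord_log (u, t))"
    using assms by (intro continuous_on_compose2[OF chord_log(1)] continuous_intros) (auto simp: chord_params_def)
  moreover have "exp (chord_log (u, t)) = -1 * (\<gamma> u - \<gamma> t)" if "u \<in> {a..b}" for u
    using assms that chord_log(2)[of u t] by (auto simp: chord_params_def)
  ultimately show "set_integrable lborel {a..b} (cauchy_kernel t)"
    "(LINT u:{a..b}|lborel. cauchy_kernel t u) = chord_log (b, t) - chord_log (a, t)"
    using cauchy_kernel_integral_eq_log_increment[of t a b _ "\<lambda>u. chord_log (u, t)" "-1"] assms by blast+
qed

lemma kernel_integral_cong_off_finite:
  assumes "finite N" "far t r - N = B - N" "B \<in> sets borel" "B \<subseteq> {0..l}"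
  shows "far_integral t r = (LINT u:B|lborel. cauchy_kernel t u)"
proof (rule set_integral_cong_off_finite[OF assms(1,2) far_borel assms(3)])
  show "set_borel_measurable lborel (far t r \<union> B) (cauchy_kernel t)"
    unfolding cauchy_kernel_def using assms far_subset by (intro set_measurable_kernel) auto
qed

text \<open>
  The integral splits at \<open>t\<close> into two increments of \<open>chord_log\<close>; the values at the end points \<open>0\<close>
  and \<open>l\<close> of the parameter interval combine to \<open>cauchy_jump\<close>.
\<close>

lemma far_integral_middle:
  assumes r: "0 < r" "2 * r < l" and t: "r \<le> t" "t \<le> l - r"
  shows "far_integral t r = cauchy_jump + (chord_log (t - r, t) - chord_log (t, t + r))"
proof -
  have "far_integral t r = (LINT u:{0..t - r} \<union> {t + r..l}|lborel. cauchy_kernel t u)"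
    by (rule kernel_integral_cong_off_finite[of "{0, t - r, t + r, l}"])
      (use r t in \<open>auto simp: far_def arc_dist_def\<close>)
  also have "\<dots> = (LINT u:{0..t - r}|lborel. cauchy_kernel t u) + (LINT u:{t + r..l}|lborel. cauchy_kernel t u)"
    using r t by (intro set_integral_Un cauchy_integral_before(1) cauchy_integral_after(1)) auto
  also have "\<dots> = (chord_log (t - r, t) - chord_log (0, t)) + (chord_log (t, l) - chord_log (t, t + r))"
    using r t by (subst cauchy_integral_before(2); (subst cauchy_integral_after(2))?) auto
  also have "\<dots> = cauchy_jump + (chord_log (t - r, t) - chord_log (t, t + r))"
    using cauchy_jump_eq[of t] r t by (simp add: algebra_simps)
  finally show ?thesis .
qed

text \<open>
  If \<open>t\<close> is closer than \<open>r\<close> to an end of the parameter interval, the far set is a single interval.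
  Its increment is compared with the chord that ends at the base point \<open>\<gamma> 0 = \<gamma> l\<close>, where
  \<open>cauchy_jump_eq\<close> passes from the chord of \<open>{r..l}\<close> to that of \<open>{0..r}\<close>.
\<close>

lemma far_integral_bound:
  assumes t: "t \<in> {0..l}" and r: "0 < r"
  shows "cmod (far_integral t r) \<le> 8 / c"
proof (cases "2 * r < l")
  case False
  then have "far t r = {}" using r by (auto simp: far_def arc_dist_def)
  then show ?thesis using c_pos by (simp add: set_lebesgue_integral_def)
next
  case True
  have min: "min r (l - r) = r" "min (l - r) (l - (l - r)) = r" using True r by auto
  have tri3: "cmod (p + q + s) \<le> cmod p + cmod q + cmod s" for p q s :: complex
    by (meson norm_triangle_ineq norm_triangle_le add_right_mono order_trans)
  consider "r \<le> t" "t \<le> l - r" | "t < r" | "l - r < t" by linarith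
  then show ?thesis
  proof cases
    case 1
    have "cmod (chord_log (t - r, t) - chord_log (t, t + r)) \<le> 4 / c"
      using chord_log_diagonal[of r t "t - r"] 1 True r by (simp add: min)
    then show ?thesis
      unfolding far_integral_middle[OF r True 1]
      using cauchy_jump_bound norm_triangle_ineq[of cauchy_jump "chord_log (t - r, t) - chord_log (t, t + r)"] by simp
  next
    case 2
    have "far_integral t r = (LINT u:{t + r..t + (l - r)}|lborel. cauchy_kernel t u)"
      by (rule kernel_integral_cong_off_finite[of "{t + r, t + (l - r)}"])
        (use r t 2 True in \<open>auto simp: far_def arc_dist_def\<close>)
    also have "\<dots> = chord_log (t, t + (l - r)) - chord_log (t, t + r)"
      using t r 2 True by (intro cauchy_integral_after(2)) auto
    also have "\<dots> = cauchy_jump + (chord_log (t, t + (l - r)) - chord_log (r, r + (l - r))) + (chord_log (0, 0 + r) - chord_log (t, t + r))"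
      using cauchy_jump_eq[of r] r True by (simp add: algebra_simps)
    also have "cmod \<dots> \<le> 4 / c + 4 / (c * r) * \<bar>t - r\<bar> + 4 / (c * r) * \<bar>0 - t\<bar>"
      using chord_log_diagonal[of "l - r" r t] chord_log_diagonal[of r t 0] 2 r t True
      by (intro order_trans[OF tri3] add_mono cauchy_jump_bound) (auto simp: min)
    also have "\<dots> = 4 / c + 4 / (c * r) * (\<bar>t - r\<bar> + \<bar>0 - t\<bar>)"
      by (simp only: distrib_left add.assoc)
    also have "\<bar>t - r\<bar> + \<bar>0 - t\<bar> = r" using 2 t by auto
    also have "4 / c + 4 / (c * r) * r = 8 / c" using r by simp
    finally show ?thesis .
  next
    case 3
    have "far_integral t r = (LINT u:{t - (l - r)..t - r}|lborel. cauchy_kernel t u)"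
      by (rule kernel_integral_cong_off_finite[of "{t - r, t - (l - r)}"])
        (use r t 3 True in \<open>auto simp: far_def arc_dist_def\<close>)
    also have "\<dots> = chord_log (t - r, t) - chord_log (t - (l - r), t)"
      using t r 3 True by (intro cauchy_integral_before(2)) auto
    also have "\<dots> = cauchy_jump + (chord_log (t - r, t - r + r) - chord_log (l - r, l - r + r)) + (chord_log (0, 0 + (l - r)) - chord_log (t - (l - r), t - (l - r) + (l - r)))"
      using cauchy_jump_eq[of "l - r"] r True by (simp add: algebra_simps)
    also have "cmod \<dots> \<le> 4 / c + 4 / (c * r) * \<bar>t - r - (l - r)\<bar> + 4 / (c * r) * \<bar>0 - (t - (l - r))\<bar>"
      using chord_log_diagonal[of r "l - r" "t - r"] chord_log_diagonal[of "l - r" "t - (l - r)" 0] 3 r t True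
      by (intro order_trans[OF tri3] add_mono cauchy_jump_bound) (auto simp: min)
    also have "\<dots> = 4 / c + 4 / (c * r) * (\<bar>t - r - (l - r)\<bar> + \<bar>0 - (t - (l - r))\<bar>)"
      by (simp only: distrib_left add.assoc)
    also have "\<bar>t - r - (l - r)\<bar> + \<bar>0 - (t - (l - r))\<bar> = r" using 3 t by auto
    also have "4 / c + 4 / (c * r) * r = 8 / c" using r by simp
    finally show ?thesis .
  qed
qed

section \<open>The principal value of the constant function\<close>

lemma chord_derivative_approx:
  assumes der: "(\<gamma> has_vector_derivative v) (at t)" and t: "0 < t" "t < l" and \<eta>: "0 < \<eta>"
  obtains \<delta> where "0 < \<delta>" "\<delta> \<le> t" "\<delta> \<le> l - t"
    "\<And>u. \<bar>u - t\<bar> < \<delta> \<Longrightarrow> cmod (\<gamma> u - \<gamma> t - (u - t) *\<^sub>R v) \<le> \<eta> * \<bar>u - t\<bar>"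
proof -
  obtain d where d: "0 < d" "\<And>u. norm (u - t) < d \<Longrightarrow> cmod (\<gamma> u - \<gamma> t - (u - t) *\<^sub>R v) \<le> \<eta> * norm (u - t)"
    using der \<eta> unfolding has_vector_derivative_def has_derivative_at_alt by blast
  show ?thesis
    by (rule that[of "min d (min t (l - t))"]) (use d t in auto)
qed

text \<open>
  The chord-arc inequality survives division by \<open>\<bar>u - t\<bar>\<close> and passage to the limit.
\<close>

lemma tangent_ge:
  assumes der: "(\<gamma> has_vector_derivative v) (at t)" and t: "0 < t" "t < l"
  shows "c \<le> cmod v"
proof (rule field_le_epsilon)
  fix \<eta> :: real assume \<eta>: "0 < \<eta>"
  obtain \<delta> where \<delta>: "0 < \<delta>" "\<delta> \<le> t" "\<delta> \<le> l - t"
    "\<And>u. \<bar>u - t\<bar> < \<delta> \<Longrightarrow> cmod (\<gamma> u - \<gamma> t - (u - t) *\<^sub>R v) \<le> \<eta> * \<bar>u - t\<bar>"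
    using chord_derivative_approx[OF der t \<eta>] by metis
  define x where "x = \<delta> / 2"
  have x: "0 < x" "x < \<delta>" "x \<le> l - x" using \<delta> by (auto simp: x_def)
  have "c * x = c * arc_dist l (t + x) t" using x by (simp add: arc_dist_def)
  also have "\<dots> \<le> cmod (\<gamma> (t + x) - \<gamma> t)" using x \<delta> t by (intro chord_arc) auto
  also have "\<dots> \<le> cmod (\<gamma> (t + x) - \<gamma> t - x *\<^sub>R v) + cmod (x *\<^sub>R v)"
    using norm_triangle_ineq[of "\<gamma> (t + x) - \<gamma> t - x *\<^sub>R v" "x *\<^sub>R v"] by simp
  also have "\<dots> \<le> \<eta> * x + x * cmod v" using \<delta>(4)[of "t + x"] x by (intro add_mono) auto
  finally have "x * c \<le> x * (cmod v + \<eta>)" by (simp add: algebra_simps)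
  then show "c \<le> cmod v + \<eta>" using x(1) by (rule mult_left_le_imp_le)
qed

text \<open>
  All chords that occur while sliding from \<open>{t - r..t}\<close> to \<open>{t..t + r}\<close> contain the parameter \<open>t\<close>,
  so the derivative at \<open>t\<close> alone shows that each of them is \<open>r v\<close> up to a small multiple of \<open>r\<close>.
\<close>

lemma chord_log_symmetric_difference_small:
  assumes der: "(\<gamma> has_vector_derivative v) (at t)" and t: "0 < t" "t < l" and e: "0 < e"
  obtains \<delta> where "0 < \<delta>" "\<delta> \<le> t" "\<delta> \<le> l - t"
    "\<And>r. 0 < r \<Longrightarrow> r < \<delta> \<Longrightarrow> cmod (chord_log (t - r, t) - chord_log (t, t + r)) \<le> e"
proof -
  \<comment> \<open>The increment below is \<open>Ln (1 + z)\<close> with \<open>\<bar>z\<bar> \<le> 2 \<eta>\<close>, hence at most \<open>4 \<eta>\<close>.\<close>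
  define \<eta> where "\<eta> = min (1 / 8) (e / 4)"
  have \<eta>: "0 < \<eta>" "\<eta> \<le> 1 / 8" "4 * \<eta> \<le> e" using e by (auto simp: \<eta>_def)
  obtain \<delta> where \<delta>: "0 < \<delta>" "\<delta> \<le> t" "\<delta> \<le> l - t"
    "\<And>u. \<bar>u - t\<bar> < \<delta> \<Longrightarrow> cmod (\<gamma> u - \<gamma> t - (u - t) *\<^sub>R v) \<le> (c * \<eta>) * \<bar>u - t\<bar>"
    using chord_derivative_approx[OF der t, of "c * \<eta>"] c_pos \<eta> by auto
  show ?thesis
  proof (rule that[OF \<delta>(1-3)])
    fix r assume r: "0 < r" "r < \<delta>"
    define w where "w x = \<gamma> (x + r) - \<gamma> x" for x
    have approx: "cmod (w x - r *\<^sub>R v) \<le> c * \<eta> * r" if "x \<in> {t - r..t}" for x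
    proof -
      have "w x - r *\<^sub>R v = (\<gamma> (x + r) - \<gamma> t - (x + r - t) *\<^sub>R v) - (\<gamma> x - \<gamma> t - (x - t) *\<^sub>R v)"
        by (simp add: w_def algebra_simps)
      also have "cmod \<dots> \<le> cmod (\<gamma> (x + r) - \<gamma> t - (x + r - t) *\<^sub>R v) + cmod (\<gamma> x - \<gamma> t - (x - t) *\<^sub>R v)"
        by (rule norm_triangle_ineq4)
      also have "\<dots> \<le> c * \<eta> * \<bar>x + r - t\<bar> + c * \<eta> * \<bar>x - t\<bar>"
        using that r by (intro add_mono \<delta>(4)) auto
      also have "\<dots> = c * \<eta> * (\<bar>x + r - t\<bar> + \<bar>x - t\<bar>)" by (simp only: distrib_left)
      also have "\<bar>x + r - t\<bar> + \<bar>x - t\<bar> = r" using that by auto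
      finally show ?thesis .
    qed
    have close: "cmod (w x - w t) \<le> 2 * \<eta> * (c * r)" if "x \<in> {t - r..t}" for x
    proof -
      have "cmod (w x - w t) \<le> cmod (w x - r *\<^sub>R v) + cmod (w t - r *\<^sub>R v)"
        using norm_triangle_ineq4[of "w x - r *\<^sub>R v" "w t - r *\<^sub>R v"] by simp
      also have "\<dots> \<le> c * \<eta> * r + c * \<eta> * r" using that r by (intro add_mono approx) auto
      finally show ?thesis by (simp add: algebra_simps)
    qed
    have low: "c * r \<le> cmod (w t)"
      using chord_arc[of "t + r" t] r \<delta> t by (simp add: w_def arc_dist_def min_def)
    have cr: "0 < c * r" using c_pos r by simp
    then have wt: "w t \<noteq> 0" using low by auto
    have "(\<lambda>x. chord_log (x, x + r)) (t - r) - (\<lambda>x. chord_log (x, x + r)) t = Ln (w (t - r) / w t)"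
    proof (rule continuous_log_increment[where S = "{t - r..t}"])
      show "continuous_on {t - r..t} (\<lambda>x. chord_log (x, x + r))"
        using r \<delta> t by (intro continuous_on_compose2[OF chord_log(1)] continuous_intros) (auto simp: chord_params_def)
      show "exp (chord_log (x, x + r)) = w x" if "x \<in> {t - r..t}" for x
        unfolding w_def using r \<delta> t that by (intro chord_log(2)) (auto simp: chord_params_def)
      show "cmod (w x - w t) < cmod (w t)" if "x \<in> {t - r..t}" for x
      proof -
        have "2 * \<eta> * (c * r) < 1 * (c * r)" using \<eta> cr by (intro mult_strict_right_mono) auto
        then show ?thesis using close[OF that] low by linarith
      qed
    qed (use r in auto)
    also have "w (t - r) / w t = 1 + (w (t - r) - w t) / w t" using wt by (simp add: field_simps)
    finally have eq: "chord_log (t - r, t) - chord_log (t, t + r) = Ln (1 + (w (t - r) - w t) / w t)" by simp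
    have q: "cmod ((w (t - r) - w t) / w t) \<le> 2 * \<eta>"
    proof -
      have "cmod ((w (t - r) - w t) / w t) \<le> 2 * \<eta> * (c * r) / (c * r)"
        unfolding norm_divide using close[of "t - r"] low cr r \<eta> by (intro frac_le) auto
      also have "\<dots> = 2 * \<eta>" using cr by (metis less_irrefl nonzero_mult_div_cancel_right)
      finally show ?thesis .
    qed
    have "cmod (Ln (1 + (w (t - r) - w t) / w t)) \<le> 2 * cmod ((w (t - r) - w t) / w t)"
      using q \<eta> by (intro norm_Ln_le) linarith
    also have "\<dots> \<le> e" using q \<eta> by linarith
    finally show "cmod (chord_log (t - r, t) - chord_log (t, t + r)) \<le> e" by (simp add: eq)
  qed
qed

lemma far_integral_tendsto:
  assumes der: "(\<gamma> has_vector_derivative v) (at t)" and t: "0 < t" "t < l"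
  shows "((\<lambda>r. far_integral t r) \<longlongrightarrow> cauchy_jump) (at_right 0)"
proof (rule tendstoI)
  fix e :: real assume e: "0 < e"
  obtain \<delta> where \<delta>: "0 < \<delta>" "\<delta> \<le> t" "\<delta> \<le> l - t"
    "\<And>r. 0 < r \<Longrightarrow> r < \<delta> \<Longrightarrow> cmod (chord_log (t - r, t) - chord_log (t, t + r)) \<le> e / 2"
    using chord_log_symmetric_difference_small[OF der t half_gt_zero[OF e]] by metis
  have "dist (far_integral t r) cauchy_jump < e" if "0 < r" "r < \<delta>" for r
    using far_integral_middle[of r t] \<delta>(1-3) \<delta>(4)[OF that] that e by (simp add: dist_norm)
  then show "\<forall>\<^sub>F r in at_right 0. dist (far_integral t r) cauchy_jump < e"
    using \<delta>(1) by (auto simp: eventually_at_right_field)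
qed

definition chord_far :: "complex \<Rightarrow> real \<Rightarrow> real set" where
  "chord_far z \<epsilon> = {u \<in> {0..l}. \<epsilon> < cmod (\<gamma> u - z)}"

abbreviation chord_far_integral :: "real \<Rightarrow> real \<Rightarrow> complex" where
  "chord_far_integral t \<epsilon> \<equiv> LINT u:chord_far (\<gamma> t) \<epsilon>|lborel. cauchy_kernel t u"

lemma chord_far_borel [measurable]: "chord_far z \<epsilon> \<in> sets borel"
proof -
  have 1: "(\<lambda>u. indicator {0..l} u *\<^sub>R (\<gamma> u - z)) \<in> borel_measurable borel"
    by (intro borel_measurable_continuous_on_indicator continuous_intros continuous_\<gamma>) auto
  have "chord_far z \<epsilon> = {u. 0 \<le> u \<and> u \<le> l \<and> \<epsilon> < cmod (indicator {0..l} u *\<^sub>R (\<gamma> u - z))}"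
    by (auto simp: chord_far_def)
  also have "\<dots> \<in> sets borel" using 1 by measurable
  finally show ?thesis .
qed

lemma chord_far_subset: "chord_far z \<epsilon> \<subseteq> {0..l}"
  by (auto simp: chord_far_def)

lemma kernel_integrable_chord_far:
  assumes "0 < \<epsilon>"
  shows "set_integrable lborel (chord_far z \<epsilon>) (\<lambda>u. D u / (\<gamma> u - z))"
proof (rule set_integrable_bounded[OF chord_far_borel chord_far_subset set_measurable_kernel[OF chord_far_borel chord_far_subset]])
  fix u assume "u \<in> chord_far z \<epsilon>"
  then show "cmod (D u / (\<gamma> u - z)) \<le> 1 / \<epsilon>"
    unfolding norm_divide using D_le_1[of u] assms by (intro frac_le) (auto simp: chord_far_def)
qed

text \<open>
  A chord of length \<open>\<epsilon>\<close> corresponds to a parameter distance between \<open>\<epsilon> / (\<bar>v\<bar> (1 + \<eta>))\<close> and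
  \<open>\<epsilon> / (\<bar>v\<bar> (1 - \<eta>))\<close>.  The two truncations thus differ on a set of measure \<open>O(\<eta> \<epsilon>)\<close>, on which
  the kernel is \<open>O(1 / \<epsilon>)\<close>.
\<close>

lemma chord_far_integral_near_far_integral:
  assumes der: "(\<gamma> has_vector_derivative v) (at t)" and t: "0 < t" "t < l" and \<eta>: "0 < \<eta>" "\<eta> \<le> 1 / 2"
  obtains \<epsilon>0 where "0 < \<epsilon>0"
    "\<And>\<epsilon>. 0 < \<epsilon> \<Longrightarrow> \<epsilon> < \<epsilon>0 \<Longrightarrow>
      cmod ((chord_far_integral t \<epsilon>)
        - (far_integral t (\<epsilon> / cmod v))) \<le> 12 * \<eta> / c"
proof -
  define L where "L = cmod v"
  have cL: "c \<le> L" unfolding L_def by (rule tangent_ge[OF der t])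
  then have L: "0 < L" using c_pos by simp
  obtain \<delta> where \<delta>: "0 < \<delta>" "\<delta> \<le> t" "\<delta> \<le> l - t"
    "\<And>u. \<bar>u - t\<bar> < \<delta> \<Longrightarrow> cmod (\<gamma> u - \<gamma> t - (u - t) *\<^sub>R v) \<le> (L * \<eta>) * \<bar>u - t\<bar>"
    using chord_derivative_approx[OF der t, of "L * \<eta>"] L \<eta> by auto
  have near: "L * (1 - \<eta>) * \<bar>u - t\<bar> \<le> cmod (\<gamma> u - \<gamma> t)" "cmod (\<gamma> u - \<gamma> t) \<le> L * (1 + \<eta>) * \<bar>u - t\<bar>"
    if "\<bar>u - t\<bar> < \<delta>" for u
  proof -
    have n: "cmod ((u - t) *\<^sub>R v) = L * \<bar>u - t\<bar>" by (simp add: L_def)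
    have "cmod ((u - t) *\<^sub>R v) - cmod (\<gamma> u - \<gamma> t - (u - t) *\<^sub>R v) \<le> cmod (\<gamma> u - \<gamma> t)"
      using norm_triangle_ineq4[of "\<gamma> u - \<gamma> t" "\<gamma> u - \<gamma> t - (u - t) *\<^sub>R v"] by simp
    then show "L * (1 - \<eta>) * \<bar>u - t\<bar> \<le> cmod (\<gamma> u - \<gamma> t)"
      using \<delta>(4)[OF that] unfolding n by (simp add: algebra_simps)
    have "cmod (\<gamma> u - \<gamma> t) \<le> cmod ((u - t) *\<^sub>R v) + cmod (\<gamma> u - \<gamma> t - (u - t) *\<^sub>R v)"
      using norm_triangle_ineq[of "(u - t) *\<^sub>R v" "\<gamma> u - \<gamma> t - (u - t) *\<^sub>R v"] by simp
    then show "cmod (\<gamma> u - \<gamma> t) \<le> L * (1 + \<eta>) * \<bar>u - t\<bar>"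
      using \<delta>(4)[OF that] unfolding n by (simp add: algebra_simps)
  qed
  show ?thesis
  proof (rule that[of "c * \<delta>"])
    show "0 < c * \<delta>" using c_pos \<delta> by simp
    fix \<epsilon> :: real assume \<epsilon>: "0 < \<epsilon>" "\<epsilon> < c * \<delta>"
    define A where "A = chord_far (\<gamma> t) \<epsilon>"
    define B where "B = far t (\<epsilon> / L)"
    define p where "p = \<epsilon> / (L * (1 + \<eta>))"
    define q where "q = \<epsilon> / (L * (1 - \<eta>))"
    have pq: "0 < p" "p \<le> q" using \<epsilon> L \<eta> by (auto simp: p_def q_def intro!: frac_le)
    define J where "J = {t - q..t - p} \<union> {t + p..t + q}"
    have ad: "arc_dist l t u = \<bar>u - t\<bar>" "\<bar>u - t\<bar> < \<delta>" if "u \<in> {0..l}" "arc_dist l t u < \<delta>" for u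
      using that t \<delta> by (auto simp: arc_dist_def min_def split: if_splits)
    have sub: "u \<in> J \<and> \<bar>u - t\<bar> < \<delta> \<and> arc_dist l t u = \<bar>u - t\<bar>" if u: "(u \<in> A) \<noteq> (u \<in> B)" for u
    proof -
      have ul: "u \<in> {0..l}" using u by (auto simp: A_def B_def chord_far_def far_def)
      have cases: "\<epsilon> < cmod (\<gamma> u - \<gamma> t) \<and> arc_dist l t u \<le> \<epsilon> / L \<or> cmod (\<gamma> u - \<gamma> t) \<le> \<epsilon> \<and> \<epsilon> / L < arc_dist l t u"
        using u ul by (auto simp: A_def B_def chord_far_def far_def)
      have "arc_dist l t u \<le> \<epsilon> / c"
      proof (cases "arc_dist l t u \<le> \<epsilon> / L")
        case True
        also have "\<epsilon> / L \<le> \<epsilon> / c" using cL c_pos \<epsilon> by (intro frac_le) auto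
        finally show ?thesis .
      next
        case False
        then have "c * arc_dist l t u \<le> \<epsilon>"
          using cases chord_arc[of t u] ul t by (auto simp: norm_minus_commute)
        then show ?thesis using c_pos by (simp add: field_simps)
      qed
      also have "\<epsilon> / c < \<delta>" using \<epsilon> c_pos by (simp add: field_simps)
      finally have d: "arc_dist l t u = \<bar>u - t\<bar>" "\<bar>u - t\<bar> < \<delta>" using ad[OF ul] by auto
      have L1: "0 < L * (1 + \<eta>)" "0 < L * (1 - \<eta>)" using L \<eta> by auto
      have "p \<le> \<bar>u - t\<bar> \<and> \<bar>u - t\<bar> \<le> q"
        using cases unfolding d(1)
      proof (elim disjE conjE)
        assume 1: "\<epsilon> < cmod (\<gamma> u - \<gamma> t)" "\<bar>u - t\<bar> \<le> \<epsilon> / L"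
        have "\<epsilon> \<le> \<bar>u - t\<bar> * (L * (1 + \<eta>))" using near(2)[OF d(2)] 1 by (simp add: mult.commute)
        then have "p \<le> \<bar>u - t\<bar>" using L1 by (simp add: p_def pos_divide_le_eq)
        moreover have "\<epsilon> / L \<le> q" unfolding q_def using \<epsilon> L L1 \<eta> by (intro frac_le) (auto simp: mult_le_cancel_left1)
        ultimately show ?thesis using 1 by simp
      next
        assume 1: "cmod (\<gamma> u - \<gamma> t) \<le> \<epsilon>" "\<epsilon> / L < \<bar>u - t\<bar>"
        have "\<bar>u - t\<bar> * (L * (1 - \<eta>)) \<le> \<epsilon>" using near(1)[OF d(2)] 1 by (simp add: mult.commute)
        then have "\<bar>u - t\<bar> \<le> q" using L1 by (simp add: q_def pos_le_divide_eq)
        moreover have "p \<le> \<epsilon> / L" unfolding p_def using \<epsilon> L L1 \<eta> by (intro frac_le) (auto simp: mult_le_cancel_left1)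
        ultimately show ?thesis using 1 by simp
      qed
      then show ?thesis using d by (auto simp: J_def abs_if split: if_splits)
    qed
    have intA: "set_integrable lborel A (cauchy_kernel t)"
      unfolding A_def cauchy_kernel_def by (rule kernel_integrable_chord_far[OF \<epsilon>(1)])
    have intB: "set_integrable lborel B (cauchy_kernel t)"
      unfolding B_def using t \<epsilon> L by (intro cauchy_kernel_integrable_far) auto
    define f where "f u = indicator A u *\<^sub>R cauchy_kernel t u - indicator B u *\<^sub>R cauchy_kernel t u" for u
    have "(LINT u:A|lborel. cauchy_kernel t u) - (LINT u:B|lborel. cauchy_kernel t u) = integral\<^sup>L lborel f"
      unfolding f_def set_lebesgue_integral_def using intA intB
      by (intro Bochner_Integration.integral_diff[symmetric]) (auto simp: set_integrable_def)
    also have "cmod \<dots> \<le> (LINT u|lborel. indicator J u * (1 / (c * p)))"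
    proof (rule Bochner_Integration.integral_norm_bound_integral)
      show "integrable lborel f" unfolding f_def
        using intA intB by (intro Bochner_Integration.integrable_diff) (auto simp: set_integrable_def)
      show "integrable lborel (\<lambda>u. indicator J u * (1 / (c * p)))"
        unfolding J_def by (intro integrable_mult_left integrable_real_indicator)
          (use pq in \<open>auto intro!: order.strict_trans1[OF emeasure_subadditive] simp: ennreal_add_less_top\<close>)
      show "cmod (f u) \<le> indicator J u * (1 / (c * p))" if "u \<in> space lborel" for u
      proof (cases "(u \<in> A) = (u \<in> B)")
        case True
        then show ?thesis using c_pos pq by (auto simp: f_def indicator_def)
      next
        case False
        have ul: "u \<in> {0..l}" using False by (auto simp: A_def B_def chord_far_def far_def)
        have u: "u \<in> J" "arc_dist l t u = \<bar>u - t\<bar>" using sub[OF False] by auto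
        have pu: "p \<le> \<bar>u - t\<bar>" using u(1) pq by (auto simp: J_def)
        have "cmod (f u) = cmod (cauchy_kernel t u)" using False by (auto simp: f_def indicator_def)
        also have "\<dots> \<le> 1 / (c * arc_dist l t u)"
          using t ul u pu pq by (intro cauchy_kernel_bound) auto
        also have "\<dots> \<le> 1 / (c * p)" using u pu pq c_pos by (intro divide_left_mono mult_left_mono) auto
        finally show ?thesis using u by simp
      qed
    qed
    also have "\<dots> = measure lborel J * (1 / (c * p))" by simp
    also have "\<dots> \<le> (2 * (q - p)) * (1 / (c * p))"
    proof (intro mult_right_mono)
      have "measure lborel J \<le> measure lborel {t - q..t - p} + measure lborel {t + p..t + q}"
        unfolding J_def by (rule measure_Un_le) auto
      then show "measure lborel J \<le> 2 * (q - p)" using pq by simp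
    qed (use c_pos pq in auto)
    also have "\<dots> = 2 * (q / p - 1) / c" using pq c_pos by (simp add: field_simps)
    also have "q / p - 1 = 2 * \<eta> / (1 - \<eta>)" using \<epsilon> L \<eta> by (simp add: p_def q_def field_simps)
    also have "2 * (2 * \<eta> / (1 - \<eta>)) / c \<le> 12 * \<eta> / c"
      using \<eta> c_pos by (intro divide_right_mono) (auto simp: field_simps mult_left_mono)
    finally show "cmod ((chord_far_integral t \<epsilon>)
        - (far_integral t (\<epsilon> / cmod v))) \<le> 12 * \<eta> / c"
      by (simp add: A_def B_def L_def)
  qed
qed

lemma chord_far_integral_tendsto:
  assumes der: "(\<gamma> has_vector_derivative v) (at t)" and t: "0 < t" "t < l"
  shows "((\<lambda>\<epsilon>. chord_far_integral t \<epsilon>) \<longlongrightarrow> cauchy_jump) (at_right 0)"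
proof -
  let ?T = "chord_far_integral t"
  let ?F = "\<lambda>\<epsilon>. far_integral t (\<epsilon> / cmod v)"
  have v: "0 < cmod v" using tangent_ge[OF der t] c_pos by linarith
  have "filterlim (\<lambda>\<epsilon>. \<epsilon> / cmod v) (at_right 0) (at_right 0)"
    using v unfolding filterlim_at
    by (auto simp: eventually_at_right_field intro!: tendsto_eq_intros exI[of _ 1])
  then have F: "(?F \<longlongrightarrow> cauchy_jump) (at_right 0)"
    by (rule filterlim_compose[OF far_integral_tendsto[OF der t]])
  have "((\<lambda>\<epsilon>. ?T \<epsilon> - ?F \<epsilon>) \<longlongrightarrow> 0) (at_right 0)"
  proof (rule tendstoI)
    fix e :: real assume e: "0 < e"
    define \<eta> where "\<eta> = min (1/2) (e * c / 24)"
    have \<eta>: "0 < \<eta>" "\<eta> \<le> 1 / 2" "\<eta> \<le> e * c / 24" using e c_pos by (auto simp: \<eta>_def)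
    obtain \<epsilon>0 where \<epsilon>0: "0 < \<epsilon>0" "\<And>\<epsilon>. 0 < \<epsilon> \<Longrightarrow> \<epsilon> < \<epsilon>0 \<Longrightarrow> cmod (?T \<epsilon> - ?F \<epsilon>) \<le> 12 * \<eta> / c"
      using chord_far_integral_near_far_integral[OF der t \<eta>(1,2)] by metis
    have "12 * \<eta> / c \<le> e / 2" using \<eta> c_pos by (simp add: field_simps)
    then have "dist (?T \<epsilon> - ?F \<epsilon>) 0 < e" if "0 < \<epsilon>" "\<epsilon> < \<epsilon>0" for \<epsilon>
      using \<epsilon>0(2)[OF that] e by (simp add: dist_norm)
    then show "\<forall>\<^sub>F \<epsilon> in at_right 0. dist (?T \<epsilon> - ?F \<epsilon>) 0 < e"
      using \<epsilon>0(1) by (auto simp: eventually_at_right_field)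
  qed
  from tendsto_add[OF this F] show ?thesis by simp
qed

end

section \<open>A Hardy-type inequality on the circle\<close>

text \<open>
  For each \<open>u\<close> the arc distance is one of the four affine functions \<open>u - t\<close>, \<open>t - u\<close>,
  \<open>l + t - u\<close>, \<open>l - t + u\<close> of \<open>u\<close>, all of slope 1 or \<open>-1\<close>.
\<close>

lemma nn_integral_arc_dist_le:
  fixes \<phi> :: "real \<Rightarrow> ennreal"
  assumes [measurable]: "\<phi> \<in> borel_measurable borel" and t: "t \<in> {0..l}"
  shows "(\<integral>\<^sup>+u. \<phi> (arc_dist l t u) \<partial>restrict_space lborel {0..l}) \<le> 4 * (\<integral>\<^sup>+x. \<phi> x * indicator {0..} x \<partial>lborel)"
proof -
  define G where "G x = \<phi> x * indicator {0..} x" for x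
  have [measurable]: "G \<in> borel_measurable borel" unfolding G_def by measurable
  have aff: "(\<integral>\<^sup>+u. G (a + b * u) \<partial>lborel) = (\<integral>\<^sup>+x. G x \<partial>lborel)" if "b = 1 \<or> b = -1" for a b :: real
    using nn_integral_real_affine[of G b a] that by auto
  have "(\<integral>\<^sup>+u. \<phi> (arc_dist l t u) \<partial>restrict_space lborel {0..l}) = (\<integral>\<^sup>+u. \<phi> (arc_dist l t u) * indicator {0..l} u \<partial>lborel)"
    by (rule nn_integral_restrict_space) auto
  also have "\<dots> \<le> (\<integral>\<^sup>+u. G (- t + 1 * u) + G (t + (-1) * u) + G (l + t + (-1) * u) + G (l - t + 1 * u) \<partial>lborel)"
  proof (rule nn_integral_mono)
    fix u
    show "\<phi> (arc_dist l t u) * indicator {0..l} u \<le> G (- t + 1 * u) + G (t + (-1) * u) + G (l + t + (-1) * u) + G (l - t + 1 * u)"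
    proof (cases "u \<in> {0..l}")
      case True
      have pos: "0 \<le> arc_dist l t u" using True t by (auto simp: arc_dist_def)
      have "arc_dist l t u = - t + 1 * u \<or> arc_dist l t u = t + (-1) * u
        \<or> arc_dist l t u = l + t + (-1) * u \<or> arc_dist l t u = l - t + 1 * u"
        by (auto simp: arc_dist_def min_def abs_if)
      then have "G (arc_dist l t u) \<le> G (- t + 1 * u) + G (t + (-1) * u) + G (l + t + (-1) * u) + G (l - t + 1 * u)"
        by (elim disjE) (simp_all add: add_increasing add_increasing2)
      then show ?thesis using pos True by (simp add: G_def)
    qed simp
  qed
  also have "\<dots> = (\<integral>\<^sup>+u. G (- t + 1 * u) \<partial>lborel) + (\<integral>\<^sup>+u. G (t + (-1) * u) \<partial>lborel)
      + (\<integral>\<^sup>+u. G (l + t + (-1) * u) \<partial>lborel) + (\<integral>\<^sup>+u. G (l - t + 1 * u) \<partial>lborel)"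
    by (simp add: nn_integral_add)
  also have "\<dots> = 4 * (\<integral>\<^sup>+x. G x \<partial>lborel)"
  proof -
    have "(4::ennreal) = 1 + 1 + 1 + 1" by simp
    then have four: "x + x + x + x = 4 * x" for x :: ennreal by (simp only: distrib_right mult_1)
    show ?thesis using aff[of 1 "- t"] aff[of "-1" t] aff[of "-1" "l + t"] aff[of 1 "l - t"] by (simp only: four simp_thms)
  qed
  finally show ?thesis by (simp add: G_def)
qed

text \<open>
  The size of the kernel of \<open>g(t) - g(v)\<close> at arc distance \<open>x\<close> from \<open>t\<close>, where \<open>d\<close> is the distance of
  \<open>t\<close> and \<open>v\<close>: the singularity \<open>1 / x\<close> for \<open>x \<le> d\<close>, and the decay \<open>d / x\<^sup>2\<close> of a difference of
  two Cauchy kernels for \<open>x \<ge> d\<close>.  It is 0 for \<open>x = 0\<close>.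
\<close>

definition decay :: "real \<Rightarrow> real \<Rightarrow> real" where
  "decay d x = min (1 / x) (d / x\<^sup>2)"

lemma decay_nonneg: "0 \<le> d \<Longrightarrow> 0 \<le> x \<Longrightarrow> 0 \<le> decay d x"
  by (simp add: decay_def)

lemma decay_0 [simp]: "decay d 0 = 0"
  by (simp add: decay_def)

lemma decay_measurable [measurable (raw)]:
  assumes "f \<in> borel_measurable M" "g \<in> borel_measurable M"
  shows "(\<lambda>x. decay (f x) (g x)) \<in> borel_measurable M"
  unfolding decay_def using assms by measurable

lemma arc_dist_measurable [measurable (raw)]:
  assumes "f \<in> borel_measurable M" "g \<in> borel_measurable M"
  shows "(\<lambda>x. arc_dist l (f x) (g x)) \<in> borel_measurable M"
  unfolding arc_dist_def using assms by measurable

lemma nn_integral_powr_near_0: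
  assumes "-1 < a" "0 \<le> d"
  shows "(\<integral>\<^sup>+x. indicator {0..d} x * ennreal (x powr a) \<partial>lborel) = ennreal (d powr (a + 1) / (a + 1))"
  using nn_integral_has_integral_lebesgue'[OF _ has_integral_powr_from_0[OF assms]] by (simp add: mult.commute)

lemma nn_integral_powr_near_top:
  assumes "a < -1" "0 < d"
  shows "(\<integral>\<^sup>+x. indicator {d..} x * ennreal (x powr a) \<partial>lborel) = ennreal (- (d powr (a + 1)) / (a + 1))"
  using nn_integral_has_integral_lebesgue'[OF _ has_integral_powr_to_inf[OF assms]] by (simp add: mult.commute)

lemma nn_integral_split_powr_le:
  fixes f :: "real \<Rightarrow> real"
  assumes d: "0 < d" and a: "-1 < a" and b: "b < -1" and A: "0 \<le> A" and B: "0 \<le> B"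
    and lo: "\<And>x. 0 \<le> x \<Longrightarrow> x \<le> d \<Longrightarrow> f x \<le> A * x powr a"
    and hi: "\<And>x. d \<le> x \<Longrightarrow> f x \<le> B * x powr b"
  shows "(\<integral>\<^sup>+x. ennreal (f x) * indicator {0..} x \<partial>lborel)
    \<le> ennreal (A * (d powr (a + 1) / (a + 1)) + B * (- (d powr (b + 1)) / (b + 1)))"
proof -
  have "(\<integral>\<^sup>+x. ennreal (f x) * indicator {0..} x \<partial>lborel)
    \<le> (\<integral>\<^sup>+x. ennreal A * (indicator {0..d} x * ennreal (x powr a)) + ennreal B * (indicator {d..} x * ennreal (x powr b)) \<partial>lborel)"
  proof (rule nn_integral_mono)
    fix x :: real
    consider "x < 0" | "0 \<le> x" "x \<le> d" | "d < x" by linarith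
    then show "ennreal (f x) * indicator {0..} x
      \<le> ennreal A * (indicator {0..d} x * ennreal (x powr a)) + ennreal B * (indicator {d..} x * ennreal (x powr b))"
    proof cases
      case 1 then show ?thesis by simp
    next
      case 2
      have "ennreal (f x) \<le> ennreal A * ennreal (x powr a)"
        using lo[OF 2] A by (simp add: ennreal_mult[symmetric] ennreal_leI)
      then show ?thesis using 2 by (simp add: add_increasing2)
    next
      case 3
      have "ennreal (f x) \<le> ennreal B * ennreal (x powr b)"
        using hi[of x] 3 B by (simp add: ennreal_mult[symmetric] ennreal_leI)
      then show ?thesis using 3 d by (simp add: add_increasing)
    qed
  qed
  also have "\<dots> = ennreal A * ennreal (d powr (a + 1) / (a + 1)) + ennreal B * ennreal (- (d powr (b + 1)) / (b + 1))"
    using a b d nn_integral_powr_near_0[of a d] nn_integral_powr_near_top[of b d]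
    by (simp add: nn_integral_add nn_integral_cmult)
  also have "\<dots> = ennreal (A * (d powr (a + 1) / (a + 1)) + B * (- (d powr (b + 1)) / (b + 1)))"
  proof -
    have "0 \<le> d powr (a + 1) / (a + 1)" "0 \<le> - (d powr (b + 1)) / (b + 1)"
      using a b by (auto intro: divide_nonneg_neg)
    then show ?thesis using A B
      by (simp only: ennreal_mult[symmetric] ennreal_plus[symmetric] mult_nonneg_nonneg)
  qed
  finally show ?thesis .
qed

definition hardy_const :: "real \<Rightarrow> real" where
  "hardy_const s = 1 / s + 1 / (1 - s)"

lemma decay_integral_fst:
  assumes s: "0 < s" "s < 1" and d: "0 < d"
  shows "(\<integral>\<^sup>+x. ennreal (decay d x * x powr s) * indicator {0..} x \<partial>lborel) \<le> ennreal (hardy_const s * d powr s)"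
proof -
  have "(\<integral>\<^sup>+x. ennreal (decay d x * x powr s) * indicator {0..} x \<partial>lborel)
    \<le> ennreal (1 * (d powr (s - 1 + 1) / (s - 1 + 1)) + d * (- (d powr (s - 2 + 1)) / (s - 2 + 1)))"
  proof (rule nn_integral_split_powr_le[OF d])
    fix x :: real assume x: "0 \<le> x" "x \<le> d"
    have "decay d x * x powr s \<le> (1 / x) * x powr s" by (intro mult_right_mono) (auto simp: decay_def)
    also have "\<dots> = 1 * x powr (s - 1)" using x by (cases "x = 0") (auto simp: powr_diff)
    finally show "decay d x * x powr s \<le> 1 * x powr (s - 1)" .
  next
    fix x :: real assume x: "d \<le> x"
    have "decay d x * x powr s \<le> (d / x\<^sup>2) * x powr s" by (intro mult_right_mono) (auto simp: decay_def)
    also have "\<dots> = d * x powr (s - 2)" using x d by (simp add: powr_diff)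
    finally show "decay d x * x powr s \<le> d * x powr (s - 2)" .
  qed (use s d in auto)
  also have "1 * (d powr (s - 1 + 1) / (s - 1 + 1)) + d * (- (d powr (s - 2 + 1)) / (s - 2 + 1)) = hardy_const s * d powr s"
  proof -
    have "d * d powr (s - 1) = d powr s" using d by (simp add: powr_diff)
    moreover have "- y / (s - 1) = y / (1 - s)" for y by (metis minus_diff_eq minus_divide_left minus_divide_right)
    ultimately show ?thesis by (simp add: hardy_const_def algebra_simps)
  qed
  finally show ?thesis .
qed

lemma decay_integral_snd:
  assumes s: "0 < s" "s < 1" and x: "0 < x"
  shows "(\<integral>\<^sup>+d. ennreal (decay d x * d powr (- 1 - s)) * indicator {0..} d \<partial>lborel) \<le> ennreal (hardy_const s * x powr (- 1 - s))"
proof -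
  have "(\<integral>\<^sup>+d. ennreal (decay d x * d powr (- 1 - s)) * indicator {0..} d \<partial>lborel)
    \<le> ennreal ((1 / x\<^sup>2) * (x powr (- s + 1) / (- s + 1)) + (1 / x) * (- (x powr (- 1 - s + 1)) / (- 1 - s + 1)))"
  proof (rule nn_integral_split_powr_le[OF x])
    fix d :: real assume d: "0 \<le> d" "d \<le> x"
    have "decay d x * d powr (- 1 - s) \<le> (d / x\<^sup>2) * d powr (- 1 - s)" by (intro mult_right_mono) (auto simp: decay_def)
    also have "\<dots> = (1 / x\<^sup>2) * (d * d powr (- 1 - s))" by simp
    also have "d * d powr (- 1 - s) = d powr (- s)" using d by (cases "d = 0") (auto simp: powr_diff powr_minus_divide powr_add)
    finally show "decay d x * d powr (- 1 - s) \<le> (1 / x\<^sup>2) * d powr (- s)" .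
  next
    fix d :: real assume "x \<le> d"
    show "decay d x * d powr (- 1 - s) \<le> (1 / x) * d powr (- 1 - s)" by (intro mult_right_mono) (auto simp: decay_def)
  qed (use s x in auto)
  also have "(1 / x\<^sup>2) * (x powr (- s + 1) / (- s + 1)) + (1 / x) * (- (x powr (- 1 - s + 1)) / (- 1 - s + 1)) = hardy_const s * x powr (- 1 - s)"
  proof -
    have 1: "(1 / x\<^sup>2) * x powr (- s + 1) = x powr (- 1 - s)"
      using x by (simp add: powr_diff powr_add powr_minus_divide field_simps power2_eq_square)
    have 2: "(1 / x) * x powr (- s) = x powr (- 1 - s)"
      using x by (simp add: powr_diff powr_minus_divide field_simps)
    have "(1 / x\<^sup>2) * (x powr (- s + 1) / (- s + 1)) + (1 / x) * (- (x powr (- 1 - s + 1)) / (- 1 - s + 1))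
       = ((1 / x\<^sup>2) * x powr (- s + 1)) / (1 - s) + ((1 / x) * x powr (- s)) / s" by simp
    also have "\<dots> = hardy_const s * x powr (- 1 - s)" unfolding 1 2 by (simp add: hardy_const_def algebra_simps)
    finally show ?thesis .
  qed
  finally show ?thesis .
qed

lemma hardy_const_pos: "0 < s \<Longrightarrow> s < 1 \<Longrightarrow> 0 < hardy_const s"
  by (simp add: hardy_const_def add_pos_pos)

lemma arc_dist_nonneg: "t \<in> {0..l} \<Longrightarrow> u \<in> {0..l} \<Longrightarrow> 0 \<le> arc_dist l t u"
  by (auto simp: arc_dist_def)

lemma four_times_ennreal_mult:
  assumes "0 \<le> a"
  shows "4 * ennreal (a * b) = ennreal (4 * a) * ennreal b"
proof -
  have "ennreal (4 * a) = ennreal 4 * ennreal a" by (rule ennreal_mult') simp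
  moreover have "ennreal (a * b) = ennreal a * ennreal b" using assms by (rule ennreal_mult')
  ultimately show ?thesis by (simp add: mult.assoc)
qed

text \<open>
  A Schur test for the homogeneous kernel \<open>decay\<close>: the Cauchy-Schwarz inequality with the weight
  \<open>x\<^sup>s\<close>, followed by Tonelli's theorem.  The convergence of \<open>decay_integral_fst\<close> and
  \<open>decay_integral_snd\<close> at 0 uses \<open>s > 0\<close> and \<open>s < 1\<close>, respectively, and at infinity the other
  way round.
\<close>

lemma hardy_inequality:
  fixes q :: "real \<Rightarrow> real"
  defines "N \<equiv> \<lambda>l. restrict_space lborel {0..l}"
  assumes s: "0 < s" "s < 1" and t: "t \<in> {0..l}"
    and q [measurable]: "q \<in> borel_measurable (N l)" and q0: "\<And>u. 0 \<le> q u"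
  shows "(\<integral>\<^sup>+v. (\<integral>\<^sup>+u. ennreal (q u * decay (arc_dist l t v) (arc_dist l t u)) \<partial>N l)\<^sup>2 * ennreal (arc_dist l t v powr (- 1 - 2 * s)) \<partial>N l)
    \<le> ennreal ((4 * hardy_const s)\<^sup>2) * (\<integral>\<^sup>+u. ennreal ((q u)\<^sup>2 * arc_dist l t u powr (- 1 - 2 * s)) \<partial>N l)"
proof -
  define x where "x = arc_dist l t"
  define H where "H = 4 * hardy_const s"
  have H: "0 < H" using hardy_const_pos[OF s] by (simp add: H_def)
  have sp: "space (N l) = {0..l}" by (simp add: N_def space_restrict_space)
  have [measurable]: "x \<in> borel_measurable (N l)" unfolding x_def N_def by (rule measurable_restrict_space1) measurable
  have x0: "0 \<le> x u" if "u \<in> space (N l)" for u using arc_dist_nonneg[OF t] that sp by (simp add: x_def)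
  have dk: "0 \<le> decay (x v) (x u)" if "u \<in> space (N l)" "v \<in> space (N l)" for u v
    using that x0 by (intro decay_nonneg) auto
  interpret N: finite_measure "N l"
    by (rule finite_measureI) (use t in \<open>simp add: N_def emeasure_restrict_space space_restrict_space\<close>)
  interpret NN: pair_sigma_finite "N l" "N l" by unfold_locales
  define W where "W v u = ennreal ((q u)\<^sup>2 * decay (x v) (x u) * x u powr (- s))" for u v
  have [measurable]: "(\<lambda>(v, u). W v u) \<in> borel_measurable (N l \<Otimes>\<^sub>M N l)" unfolding W_def by measurable
  \<comment> \<open>The factors are \<open>(q \<surd>decay x\<^sup>-\<^sup>s\<^sup>/\<^sup>2)\<close> and \<open>(\<surd>decay x\<^sup>s\<^sup>/\<^sup>2)\<close>; the second integral is \<open>O(d\<^sup>s)\<close>.\<close>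
  have cs: "(\<integral>\<^sup>+u. ennreal (q u * decay (x v) (x u)) \<partial>N l)\<^sup>2 * ennreal (x v powr (- 1 - 2 * s))
      \<le> ennreal H * ((\<integral>\<^sup>+u. W v u \<partial>N l) * ennreal (x v powr (- 1 - s)))" if v: "v \<in> space (N l)" for v
  proof (cases "x v = 0")
    case True then show ?thesis by simp
  next
    case False
    then have d: "0 < x v" using x0[OF v] by simp
    have "(\<integral>\<^sup>+u. ennreal (q u * decay (x v) (x u)) \<partial>N l)
      = (\<integral>\<^sup>+u. ennreal (q u * sqrt (decay (x v) (x u)) * x u powr (- s / 2)) * ennreal (sqrt (decay (x v) (x u)) * x u powr (s / 2)) \<partial>N l)"
    proof (rule nn_integral_cong)
      fix u assume u: "u \<in> space (N l)"
      have "q u * decay (x v) (x u) = (q u * sqrt (decay (x v) (x u)) * x u powr (- s / 2)) * (sqrt (decay (x v) (x u)) * x u powr (s / 2))"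
      proof (cases "x u = 0")
        case False
        then have "x u powr (- s / 2) * x u powr (s / 2) = 1" using x0[OF u] by (simp add: powr_add[symmetric])
        moreover have "sqrt (decay (x v) (x u)) * sqrt (decay (x v) (x u)) = decay (x v) (x u)"
          using dk[OF u v] by simp
        moreover have "(q u * a * P) * (a * Q) = q u * (a * a) * (P * Q)" for a P Q by simp
        ultimately show ?thesis by (metis mult_1_right)
      qed simp
      then show "ennreal (q u * decay (x v) (x u)) = ennreal (q u * sqrt (decay (x v) (x u)) * x u powr (- s / 2)) * ennreal (sqrt (decay (x v) (x u)) * x u powr (s / 2))"
        using q0[of u] dk[OF u v] by (simp add: ennreal_mult[symmetric])
    qed
    then have "(\<integral>\<^sup>+u. ennreal (q u * decay (x v) (x u)) \<partial>N l)\<^sup>2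
      \<le> (\<integral>\<^sup>+u. (ennreal (q u * sqrt (decay (x v) (x u)) * x u powr (- s / 2)))\<^sup>2 \<partial>N l) * (\<integral>\<^sup>+u. (ennreal (sqrt (decay (x v) (x u)) * x u powr (s / 2)))\<^sup>2 \<partial>N l)"
      by (simp only:) (rule Cauchy_Schwarz_nn_integral; measurable)
    also have "(\<integral>\<^sup>+u. (ennreal (q u * sqrt (decay (x v) (x u)) * x u powr (- s / 2)))\<^sup>2 \<partial>N l) = (\<integral>\<^sup>+u. W v u \<partial>N l)"
    proof (rule nn_integral_cong)
      fix u assume u: "u \<in> space (N l)"
      have "(x u powr (- s / 2))\<^sup>2 = x u powr (- s)"
        using x0[OF u] by (cases "x u = 0") (simp_all add: powr_power)
      then show "(ennreal (q u * sqrt (decay (x v) (x u)) * x u powr (- s / 2)))\<^sup>2 = W v u"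
        using q0[of u] dk[OF u v] by (simp add: W_def ennreal_power power_mult_distrib)
    qed
    also have "(\<integral>\<^sup>+u. (ennreal (sqrt (decay (x v) (x u)) * x u powr (s / 2)))\<^sup>2 \<partial>N l) = (\<integral>\<^sup>+u. ennreal (decay (x v) (x u) * x u powr s) \<partial>N l)"
    proof (rule nn_integral_cong)
      fix u assume u: "u \<in> space (N l)"
      have "(x u powr (s / 2))\<^sup>2 = x u powr s"
        using x0[OF u] by (cases "x u = 0") (simp_all add: powr_power)
      then show "(ennreal (sqrt (decay (x v) (x u)) * x u powr (s / 2)))\<^sup>2 = ennreal (decay (x v) (x u) * x u powr s)"
        using dk[OF u v] by (simp add: ennreal_power power_mult_distrib)
    qed
    also have "\<dots> \<le> 4 * (\<integral>\<^sup>+y. ennreal (decay (x v) y * y powr s) * indicator {0..} y \<partial>lborel)"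
      unfolding N_def x_def by (rule nn_integral_arc_dist_le[OF _ t]) measurable
    also have "\<dots> \<le> 4 * ennreal (hardy_const s * x v powr s)"
      by (intro mult_left_mono decay_integral_fst s d) auto
    also have "\<dots> = ennreal H * ennreal (x v powr s)"
      unfolding H_def using hardy_const_pos[OF s] by (intro four_times_ennreal_mult) simp
    finally have "(\<integral>\<^sup>+u. ennreal (q u * decay (x v) (x u)) \<partial>N l)\<^sup>2 \<le> (\<integral>\<^sup>+u. W v u \<partial>N l) * (ennreal H * ennreal (x v powr s))"
      by (simp add: mult_left_mono)
    then have "(\<integral>\<^sup>+u. ennreal (q u * decay (x v) (x u)) \<partial>N l)\<^sup>2 * ennreal (x v powr (- 1 - 2 * s))
      \<le> (\<integral>\<^sup>+u. W v u \<partial>N l) * (ennreal H * ennreal (x v powr s)) * ennreal (x v powr (- 1 - 2 * s))"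
      by (rule mult_right_mono) simp
    also have "\<dots> = ennreal H * ((\<integral>\<^sup>+u. W v u \<partial>N l) * (ennreal (x v powr s) * ennreal (x v powr (- 1 - 2 * s))))"
      by (simp add: mult_ac)
    also have "ennreal (x v powr s) * ennreal (x v powr (- 1 - 2 * s)) = ennreal (x v powr (- 1 - s))"
      by (simp add: ennreal_mult[symmetric] powr_add[symmetric] algebra_simps)
    finally show ?thesis .
  qed
  have "(\<integral>\<^sup>+v. (\<integral>\<^sup>+u. ennreal (q u * decay (x v) (x u)) \<partial>N l)\<^sup>2 * ennreal (x v powr (- 1 - 2 * s)) \<partial>N l)
    \<le> (\<integral>\<^sup>+v. ennreal H * ((\<integral>\<^sup>+u. W v u \<partial>N l) * ennreal (x v powr (- 1 - s))) \<partial>N l)"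
    by (rule nn_integral_mono) (rule cs)
  also have "\<dots> = ennreal H * (\<integral>\<^sup>+v. (\<integral>\<^sup>+u. W v u * ennreal (x v powr (- 1 - s)) \<partial>N l) \<partial>N l)"
  proof -
    have W1: "W v \<in> borel_measurable (N l)" for v unfolding W_def by measurable
    then show ?thesis by (subst nn_integral_cmult) (simp_all add: nn_integral_multc)
  qed
  also have "(\<integral>\<^sup>+v. (\<integral>\<^sup>+u. W v u * ennreal (x v powr (- 1 - s)) \<partial>N l) \<partial>N l)
     = (\<integral>\<^sup>+u. (\<integral>\<^sup>+v. W v u * ennreal (x v powr (- 1 - s)) \<partial>N l) \<partial>N l)"
    by (rule NN.Fubini'[symmetric]) measurable
  also have "\<dots> \<le> (\<integral>\<^sup>+u. ennreal H * ennreal ((q u)\<^sup>2 * x u powr (- 1 - 2 * s)) \<partial>N l)"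
  proof (rule nn_integral_mono)
    fix u assume u: "u \<in> space (N l)"
    show "(\<integral>\<^sup>+v. W v u * ennreal (x v powr (- 1 - s)) \<partial>N l) \<le> ennreal H * ennreal ((q u)\<^sup>2 * x u powr (- 1 - 2 * s))"
    proof (cases "x u = 0")
      case True
      then show ?thesis by (simp add: W_def)
    next
      case False
      then have xu: "0 < x u" using x0[OF u] by simp
      have "(\<integral>\<^sup>+v. W v u * ennreal (x v powr (- 1 - s)) \<partial>N l)
         = (\<integral>\<^sup>+v. ennreal ((q u)\<^sup>2 * x u powr (- s)) * ennreal (decay (x v) (x u) * x v powr (- 1 - s)) \<partial>N l)"
        unfolding W_def using dk[OF u] by (intro nn_integral_cong) (simp add: ennreal_mult[symmetric] mult_ac)
      also have "\<dots> = ennreal ((q u)\<^sup>2 * x u powr (- s)) * (\<integral>\<^sup>+v. ennreal (decay (x v) (x u) * x v powr (- 1 - s)) \<partial>N l)"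
        by (rule nn_integral_cmult) measurable
      also have "(\<integral>\<^sup>+v. ennreal (decay (x v) (x u) * x v powr (- 1 - s)) \<partial>N l)
         \<le> 4 * (\<integral>\<^sup>+d. ennreal (decay d (x u) * d powr (- 1 - s)) * indicator {0..} d \<partial>lborel)"
        unfolding N_def x_def by (rule nn_integral_arc_dist_le[OF _ t]) measurable
      also have "\<dots> \<le> 4 * ennreal (hardy_const s * x u powr (- 1 - s))"
        by (intro mult_left_mono decay_integral_snd s xu) auto
      also have "\<dots> = ennreal H * ennreal (x u powr (- 1 - s))"
        unfolding H_def using hardy_const_pos[OF s] by (intro four_times_ennreal_mult) simp
      also have "ennreal ((q u)\<^sup>2 * x u powr (- s)) * (ennreal H * ennreal (x u powr (- 1 - s)))
         = ennreal H * ennreal ((q u)\<^sup>2 * (x u powr (- s) * x u powr (- 1 - s)))"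
        using H by (simp add: ennreal_mult[symmetric] mult_ac)
      also have "x u powr (- s) * x u powr (- 1 - s) = x u powr (- 1 - 2 * s)"
        unfolding powr_add[symmetric] by (rule arg_cong[where f = "(powr) (x u)"]) simp
      finally show ?thesis by (simp add: mult_left_mono)
    qed
  qed
  also have "\<dots> = ennreal H * (\<integral>\<^sup>+u. ennreal ((q u)\<^sup>2 * x u powr (- 1 - 2 * s)) \<partial>N l)"
    by (rule nn_integral_cmult) measurable
  finally have "(\<integral>\<^sup>+v. (\<integral>\<^sup>+u. ennreal (q u * decay (x v) (x u)) \<partial>N l)\<^sup>2 * ennreal (x v powr (- 1 - 2 * s)) \<partial>N l)
    \<le> ennreal H * (ennreal H * (\<integral>\<^sup>+u. ennreal ((q u)\<^sup>2 * x u powr (- 1 - 2 * s)) \<partial>N l))"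
    by (simp add: mult_left_mono)
  then show ?thesis using H by (simp add: x_def H_def[symmetric] mult.assoc[symmetric] ennreal_mult[symmetric] power2_eq_square)
qed

section \<open>The regularised Cauchy integral\<close>

lemma arc_dist_commute: "arc_dist l t u = arc_dist l u t"
  by (simp add: arc_dist_def abs_minus_commute)

lemma arc_dist_triangle:
  "t \<in> {0..l} \<Longrightarrow> u \<in> {0..l} \<Longrightarrow> v \<in> {0..l} \<Longrightarrow> arc_dist l t v \<le> arc_dist l t u + arc_dist l u v"
  unfolding arc_dist_def min_def abs_if by (auto split: if_splits)

lemma inverse_le_decay:
  assumes "0 \<le> x" "x \<le> k * d" "1 \<le> k"
  shows "1 / x \<le> k * decay d x"
proof (cases "x = 0")
  case False
  then have x: "0 < x" using assms by simp
  have "1 / x = x / x\<^sup>2" by (simp add: power2_eq_square)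
  also have "\<dots> \<le> k * d / x\<^sup>2" using assms by (intro divide_right_mono) auto
  finally have "1 / x \<le> k * (d / x\<^sup>2)" by simp
  moreover have "1 / x \<le> k * (1 / x)" using assms x by (simp add: divide_right_mono)
  ultimately show ?thesis by (auto simp: decay_def min_def)
qed simp

lemma decay_far: "0 < d \<Longrightarrow> d \<le> x \<Longrightarrow> decay d x = d / x\<^sup>2"
  by (simp add: decay_def min_def power2_eq_square field_simps)

lemma ennreal_mult_add:
  "0 \<le> k \<Longrightarrow> 0 \<le> a \<Longrightarrow> 0 \<le> b \<Longrightarrow> ennreal k * (ennreal a + ennreal b) = ennreal (k * (a + b))"
  by (simp add: ennreal_mult)

lemma ennreal_square_sum3_le:
  fixes a b e :: ennreal
  shows "(a + b + e)\<^sup>2 \<le> 3 * (a\<^sup>2 + b\<^sup>2 + e\<^sup>2)"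
proof (cases "a = top \<or> b = top \<or> e = top")
  case True
  then show ?thesis by (auto simp: power2_eq_square ennreal_mult_eq_top_iff)
next
  case False
  then obtain x y z where xyz: "0 \<le> x" "a = ennreal x" "0 \<le> y" "b = ennreal y" "0 \<le> z" "e = ennreal z"
    by (metis ennreal_cases)
  have "0 \<le> (x - y)\<^sup>2 + (y - z)\<^sup>2 + (x - z)\<^sup>2" by simp
  then have "(x + y + z)\<^sup>2 \<le> 3 * (x\<^sup>2 + y\<^sup>2 + z\<^sup>2)" by (simp add: power2_eq_square algebra_simps)
  then have "ennreal ((x + y + z)\<^sup>2) \<le> ennreal (3 * (x\<^sup>2 + y\<^sup>2 + z\<^sup>2))" by (rule ennreal_leI)
  then show ?thesis using xyz
    by (simp add: ennreal_mult' ennreal_power[symmetric])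
qed

context chord_arc_loop
begin

abbreviation N :: "real measure" where "N \<equiv> restrict_space lborel {0..l}"

lemma space_N: "space N = {0..l}" by (simp add: space_restrict_space)

lemma finite_measure_N: "finite_measure N"
  by (rule finite_measureI) (use l_pos in \<open>simp add: emeasure_restrict_space space_restrict_space\<close>)

lemma pair_sigma_finite_N: "pair_sigma_finite N N"
proof -
  interpret finite_measure N by (rule finite_measure_N)
  show ?thesis by unfold_locales
qed

lemma \<gamma>_measurable [measurable]: "\<gamma> \<in> borel_measurable N"
proof -
  have "\<gamma> \<in> borel_measurable (restrict_space borel {0..l})"
    by (rule borel_measurable_continuous_on_restrict[OF continuous_\<gamma>])
  moreover have "measurable N borel = measurable (restrict_space borel {0..l}) (borel :: complex measure)"
    by (intro measurable_cong_sets sets_restrict_space_cong) auto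
  ultimately show ?thesis by simp
qed

lemma D_measurable_N [measurable]: "D \<in> borel_measurable N"
  by (rule measurable_restrict_space1) simp

lemma id_measurable_N [measurable]: "(\<lambda>u. u) \<in> borel_measurable N"
  by (rule measurable_restrict_space1) simp

lemma cauchy_kernel_measurable [measurable (raw)]:
  assumes "f \<in> M \<rightarrow>\<^sub>M N" "g \<in> M \<rightarrow>\<^sub>M N"
  shows "(\<lambda>x. cauchy_kernel (f x) (g x)) \<in> borel_measurable M"
  unfolding cauchy_kernel_def using measurable_compose[OF assms(1) \<gamma>_measurable]
    measurable_compose[OF assms(2) \<gamma>_measurable] measurable_compose[OF assms(2) D_measurable_N]
  by measurable

lemma arc_dist_measurable_N [measurable (raw)]:
  assumes "f \<in> M \<rightarrow>\<^sub>M N" "g \<in> M \<rightarrow>\<^sub>M N"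
  shows "(\<lambda>x. arc_dist l (f x) (g x)) \<in> borel_measurable M"
  using measurable_compose[OF assms(1) id_measurable_N] measurable_compose[OF assms(2) id_measurable_N]
  by measurable

text \<open>
  The curve is closed, so its points can also be joined through the base point.
\<close>

lemma chord_le_arc_dist:
  assumes "x \<in> {0..l}" "y \<in> {0..l}"
  shows "cmod (\<gamma> x - \<gamma> y) \<le> arc_dist l x y"
proof -
  have *: "cmod (\<gamma> x - \<gamma> y) \<le> l - (y - x)" if "0 \<le> x" "x \<le> y" "y \<le> l" for x y
  proof -
    have "cmod (\<gamma> x - \<gamma> y) = cmod ((\<gamma> x - \<gamma> 0) + (\<gamma> l - \<gamma> y))" by (simp add: closed)
    also have "\<dots> \<le> \<bar>x - 0\<bar> + \<bar>l - y\<bar>"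
      using that by (intro order_trans[OF norm_triangle_ineq] add_mono nonexpansive) auto
    finally show ?thesis using that by simp
  qed
  have "cmod (\<gamma> x - \<gamma> y) \<le> l - \<bar>x - y\<bar>"
    using *[of x y] *[of y x] assms by (cases "x \<le> y") (auto simp: norm_minus_commute)
  then show ?thesis using nonexpansive[OF assms] by (simp add: arc_dist_def)
qed

lemma c_le_1: "c \<le> 1"
proof -
  have "c * (l / 2) \<le> cmod (\<gamma> 0 - \<gamma> (l / 2))" using chord_arc[of 0 "l / 2"] l_pos by (simp add: arc_dist_def)
  also have "\<dots> \<le> 1 * (l / 2)" using nonexpansive[of 0 "l / 2"] l_pos by simp
  finally show ?thesis using l_pos by simp
qed

lemma cauchy_kernel_le:
  assumes "t \<in> {0..l}" "u \<in> {0..l}"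
  shows "cmod (cauchy_kernel t u) \<le> 1 / (c * arc_dist l t u)"
proof (cases "arc_dist l t u = 0")
  case True
  then have "\<gamma> u = \<gamma> t" using chord_le_arc_dist[OF assms] by auto
  then show ?thesis using True by (simp add: cauchy_kernel_def)
next
  case False
  then show ?thesis using cauchy_kernel_bound[OF assms] arc_dist_nonneg[OF assms] by simp
qed

lemma cauchy_kernel_diff_le:
  assumes tuv: "t \<in> {0..l}" "u \<in> {0..l}" "v \<in> {0..l}" and pos: "0 < arc_dist l t u" "0 < arc_dist l v u"
  shows "cmod (cauchy_kernel t u - cauchy_kernel v u) \<le> arc_dist l t v / (c\<^sup>2 * (arc_dist l t u * arc_dist l v u))"
proof -
  have ne: "\<gamma> u - \<gamma> t \<noteq> 0" "\<gamma> u - \<gamma> v \<noteq> 0"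
    using \<gamma>_diff_nonzero[of t u] \<gamma>_diff_nonzero[of v u] tuv pos by auto
  have "cauchy_kernel t u - cauchy_kernel v u = D u * (\<gamma> t - \<gamma> v) / ((\<gamma> u - \<gamma> t) * (\<gamma> u - \<gamma> v))"
    unfolding cauchy_kernel_def using ne by (simp add: field_simps)
  also have "cmod \<dots> = cmod (D u) * cmod (\<gamma> t - \<gamma> v) / (cmod (\<gamma> u - \<gamma> t) * cmod (\<gamma> u - \<gamma> v))"
    by (simp add: norm_mult norm_divide)
  also have "\<dots> \<le> 1 * arc_dist l t v / ((c * arc_dist l t u) * (c * arc_dist l v u))"
  proof (rule frac_le)
    show "cmod (D u) * cmod (\<gamma> t - \<gamma> v) \<le> 1 * arc_dist l t v"
      using tuv by (intro mult_mono D_le_1 chord_le_arc_dist) auto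
    show "(c * arc_dist l t u) * (c * arc_dist l v u) \<le> cmod (\<gamma> u - \<gamma> t) * cmod (\<gamma> u - \<gamma> v)"
      using tuv pos c_pos chord_arc[of t u] chord_arc[of v u] by (intro mult_mono) (auto simp: norm_minus_commute)
    show "0 < (c * arc_dist l t u) * (c * arc_dist l v u)" using pos c_pos by simp
    show "0 \<le> 1 * arc_dist l t v" using arc_dist_nonneg tuv by simp
  qed
  finally show ?thesis by (simp add: power2_eq_square mult_ac)
qed

definition reg_integrand :: "(real \<Rightarrow> complex) \<Rightarrow> real \<Rightarrow> real \<Rightarrow> complex" where
  "reg_integrand h t u = (h u - h t) * cauchy_kernel t u"

text \<open>
  The Cauchy integral with the singularity removed, up to the factor \<open>2\<pi>\<i>\<close>.
\<close>

definition reg_cauchy :: "(real \<Rightarrow> complex) \<Rightarrow> real \<Rightarrow> complex" where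
  "reg_cauchy h t = (LINT u|N. reg_integrand h t u)"

text \<open>
  The averaged oscillation of \<open>h\<close> around \<open>t\<close> at the scale of the distance from \<open>t\<close> to \<open>v\<close>.
\<close>

definition local_osc :: "(real \<Rightarrow> complex) \<Rightarrow> real \<Rightarrow> real \<Rightarrow> ennreal" where
  "local_osc h t v = (\<integral>\<^sup>+u. ennreal (cmod (h u - h t) * decay (arc_dist l t v) (arc_dist l t u)) \<partial>N)"

lemma far_integral_N:
  "(LINT u|N. indicator (far t r) u *\<^sub>R cauchy_kernel t u) = (far_integral t r)"
proof -
  have "(\<lambda>u. indicator {0..l} u *\<^sub>R (indicator (far t r) u *\<^sub>R cauchy_kernel t u)) = (\<lambda>u. indicator (far t r) u *\<^sub>R cauchy_kernel t u)"
    by (auto simp: indicator_def fun_eq_iff far_def)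
  then show ?thesis by (subst integral_restrict_space) (auto simp: set_lebesgue_integral_def)
qed

lemma far_integrable_N:
  assumes "t \<in> {0..l}" "0 < r"
  shows "integrable N (\<lambda>u. indicator (far t r) u *\<^sub>R cauchy_kernel t u)"
proof -
  have "(\<lambda>u. indicator {0..l} u *\<^sub>R (indicator (far t r) u *\<^sub>R cauchy_kernel t u)) = (\<lambda>u. indicator (far t r) u *\<^sub>R cauchy_kernel t u)"
    by (auto simp: indicator_def fun_eq_iff far_def)
  then show ?thesis
    using cauchy_kernel_integrable_far[OF assms]
    by (subst integrable_restrict_space) (auto simp: set_integrable_def)
qed

text \<open>
  Near \<open>t\<close> both integrands are estimated separately.  On the set \<open>far t (2 d)\<close>
  \<open>(h u - h t) K(t,u) - (h u - h v) K(v,u) = (h u - h v) (K(t,u) - K(v,u)) + (h v - h t) K(t,u)\<close>,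
  where the first term has the kernel \<open>decay\<close>, and the second one integrates to a truncated Cauchy
  integral of the constant function.
\<close>

lemma reg_cauchy_diff_bound:
  assumes tv: "t \<in> {0..l}" "v \<in> {0..l}" "0 < arc_dist l t v"
    and h [measurable]: "h \<in> borel_measurable N"
    and int: "integrable N (reg_integrand h t)" "integrable N (reg_integrand h v)"
  shows "ennreal (cmod (reg_cauchy h t - reg_cauchy h v))
    \<le> ennreal (8 / c\<^sup>2) * (local_osc h t v + local_osc h v t + ennreal (cmod (h t - h v)))"
proof -
  define d where "d = arc_dist l t v"
  have d: "0 < d" using tv by (simp add: d_def)
  have dv: "arc_dist l v t = d" by (simp add: d_def arc_dist_commute)
  define k where "k u = indicator (far t (2 * d)) u *\<^sub>R cauchy_kernel t u" for u
  have intk: "integrable N k" unfolding k_def using tv d by (intro far_integrable_N) auto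
  define R where "R u = reg_integrand h t u - reg_integrand h v u - (h v - h t) * k u" for u
  have c: "0 < c" "c \<le> 1" "c\<^sup>2 \<le> c" "0 < c\<^sup>2"
    using c_pos c_le_1 by (auto simp: power2_eq_square mult_left_le)
  have intR: "integrable N R"
    unfolding R_def by (intro Bochner_Integration.integrable_diff int integrable_mult_right intk)
  have Rb: "cmod (R u) \<le> 8 / c\<^sup>2 * (cmod (h u - h t) * decay d (arc_dist l t u) + cmod (h u - h v) * decay d (arc_dist l v u))"
    if u: "u \<in> {0..l}" for u
  proof -
    define x where "x = arc_dist l t u"
    define y where "y = arc_dist l v u"
    have x0: "0 \<le> x" "0 \<le> y" using arc_dist_nonneg tv u by (auto simp: x_def y_def)
    have yx: "y \<le> d + x" and xy: "x \<le> d + y"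
      using arc_dist_triangle[of v l t u] arc_dist_triangle[of t l v u] tv u
      by (auto simp: x_def y_def d_def arc_dist_commute)
    have dn: "0 \<le> decay d x" "0 \<le> decay d y" using x0 d by (auto intro: decay_nonneg)
    have "cmod (R u) \<le> 8 / c\<^sup>2 * (cmod (h u - h t) * decay d x + cmod (h u - h v) * decay d y)"
    proof (cases "u \<in> far t (2 * d)")
      case False
      then have x2: "x \<le> 2 * d" using u by (auto simp: far_def x_def)
      have kern: "cmod (cauchy_kernel t u) \<le> 8 / c\<^sup>2 * decay d x" "cmod (cauchy_kernel v u) \<le> 8 / c\<^sup>2 * decay d y"
      proof -
        have bd: "1 / (c * z) \<le> 8 / c\<^sup>2 * decay d z" if "0 \<le> z" "z \<le> 3 * d" for z
        proof -
          have "1 / (c * z) = (1 / c) * (1 / z)" by simp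
          also have "\<dots> \<le> (1 / c) * (3 * decay d z)"
            using that c(1) by (intro mult_left_mono inverse_le_decay) auto
          also have "\<dots> = 3 / c * decay d z" by simp
          also have "\<dots> \<le> 8 / c\<^sup>2 * decay d z"
            using c that d by (intro mult_right_mono frac_le decay_nonneg) auto
          finally show ?thesis .
        qed
        show "cmod (cauchy_kernel t u) \<le> 8 / c\<^sup>2 * decay d x"
          using cauchy_kernel_le[OF tv(1) u] bd[of x] x0 x2 d by (simp add: x_def)
        show "cmod (cauchy_kernel v u) \<le> 8 / c\<^sup>2 * decay d y"
          using cauchy_kernel_le[OF tv(2) u] bd[of y] x0 x2 yx by (simp add: y_def)
      qed
      have "R u = reg_integrand h t u - reg_integrand h v u" using False by (simp add: R_def k_def)
      then have "cmod (R u) \<le> cmod (h u - h t) * cmod (cauchy_kernel t u) + cmod (h u - h v) * cmod (cauchy_kernel v u)"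
        using norm_triangle_ineq4[of "reg_integrand h t u" "reg_integrand h v u"] by (simp add: reg_integrand_def norm_mult)
      also have "\<dots> \<le> cmod (h u - h t) * (8 / c\<^sup>2 * decay d x) + cmod (h u - h v) * (8 / c\<^sup>2 * decay d y)"
        by (intro add_mono mult_left_mono kern) auto
      finally show ?thesis by (simp add: algebra_simps)
    next
      case True
      then have x2: "2 * d < x" by (auto simp: far_def x_def)
      then have y: "d \<le> y" "0 < y" "2 * y \<le> 3 * x" "2 * x \<le> 4 * y" using xy yx d by auto
      have "R u = (h u - h v) * (cauchy_kernel t u - cauchy_kernel v u)"
        using True by (simp add: R_def k_def reg_integrand_def algebra_simps)
      then have "cmod (R u) = cmod (h u - h v) * cmod (cauchy_kernel t u - cauchy_kernel v u)" by (simp add: norm_mult)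
      also have "\<dots> \<le> cmod (h u - h v) * (d / (c\<^sup>2 * (x * y)))"
        using cauchy_kernel_diff_le[OF tv(1) u tv(2)] x2 y d by (intro mult_left_mono) (auto simp: x_def y_def d_def)
      also have "d / (c\<^sup>2 * (x * y)) \<le> d / (c\<^sup>2 * (1 / 8 * y\<^sup>2))"
      proof -
        have "1 / 8 * y\<^sup>2 \<le> x * y" using y x2 d by (simp add: power2_eq_square)
        then show ?thesis using c d y by (intro divide_left_mono mult_left_mono mult_pos_pos) (use x2 in auto)
      qed
      also have "d / (c\<^sup>2 * (1 / 8 * y\<^sup>2)) = 8 / c\<^sup>2 * decay d y"
        using decay_far[OF d y(1)] by simp
      finally have "cmod (R u) \<le> cmod (h u - h v) * (8 / c\<^sup>2 * decay d y)" by (simp add: mult_left_mono)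
      also have "\<dots> = 8 / c\<^sup>2 * (cmod (h u - h v) * decay d y)" by simp
      also have "\<dots> \<le> 8 / c\<^sup>2 * (cmod (h u - h t) * decay d x + cmod (h u - h v) * decay d y)"
        using c dn by (intro mult_left_mono) auto
      finally show ?thesis .
    qed
    then show ?thesis by (simp add: x_def y_def)
  qed
  have "ennreal (cmod (LINT u|N. R u)) \<le> (\<integral>\<^sup>+u. ennreal (cmod (R u)) \<partial>N)"
    by (rule integral_norm_bound_ennreal[OF intR])
  also have "\<dots> \<le> (\<integral>\<^sup>+u. ennreal (8 / c\<^sup>2) * (ennreal (cmod (h u - h t) * decay d (arc_dist l t u)) + ennreal (cmod (h u - h v) * decay d (arc_dist l v u))) \<partial>N)"
  proof (rule nn_integral_mono)
    fix u assume "u \<in> space N"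
    then have u: "u \<in> {0..l}" by (simp add: space_N)
    have dn: "0 \<le> decay d (arc_dist l t u)" "0 \<le> decay d (arc_dist l v u)"
      using d u tv arc_dist_nonneg by (auto intro!: decay_nonneg)
    show "ennreal (cmod (R u)) \<le> ennreal (8 / c\<^sup>2) * (ennreal (cmod (h u - h t) * decay d (arc_dist l t u)) + ennreal (cmod (h u - h v) * decay d (arc_dist l v u)))"
      by (subst ennreal_mult_add) (use dn ennreal_leI[OF Rb[OF u]] in auto)
  qed
  also have "\<dots> = ennreal (8 / c\<^sup>2) * (local_osc h t v + local_osc h v t)"
  proof -
    have [measurable]: "(\<lambda>u. t) \<in> N \<rightarrow>\<^sub>M N" "(\<lambda>u. v) \<in> N \<rightarrow>\<^sub>M N" using tv by (auto simp: space_N)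
    show ?thesis unfolding local_osc_def dv
      by (subst nn_integral_cmult, measurable) (subst nn_integral_add, measurable, simp add: d_def)
  qed
  finally have 1: "ennreal (cmod (LINT u|N. R u)) \<le> ennreal (8 / c\<^sup>2) * (local_osc h t v + local_osc h v t)" .
  have "(LINT u|N. R u) = reg_cauchy h t - reg_cauchy h v - (h v - h t) * (far_integral t (2 * d))"
    unfolding R_def reg_cauchy_def far_integral_N[symmetric] k_def[symmetric]
    using int intk by simp
  then have "reg_cauchy h t - reg_cauchy h v = (LINT u|N. R u) + (h v - h t) * (far_integral t (2 * d))"
    by simp
  then have "cmod (reg_cauchy h t - reg_cauchy h v) \<le> cmod (LINT u|N. R u) + cmod (h v - h t) * cmod (far_integral t (2 * d))"
    by (metis norm_mult norm_triangle_ineq)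
  also have "\<dots> \<le> cmod (LINT u|N. R u) + cmod (h v - h t) * (8 / c\<^sup>2)"
  proof -
    have "cmod (far_integral t (2 * d)) \<le> 8 / c" using tv d by (intro far_integral_bound) auto
    also have "\<dots> \<le> 8 / c\<^sup>2" using c by (intro frac_le) auto
    finally show ?thesis by (intro add_left_mono mult_left_mono) auto
  qed
  finally have "ennreal (cmod (reg_cauchy h t - reg_cauchy h v)) \<le> ennreal (cmod (LINT u|N. R u) + cmod (h v - h t) * (8 / c\<^sup>2))"
    by (rule ennreal_leI)
  also have "\<dots> = ennreal (cmod (LINT u|N. R u)) + ennreal (8 / c\<^sup>2) * ennreal (cmod (h t - h v))"
    using c by (simp add: ennreal_plus ennreal_mult[symmetric] mult.commute norm_minus_commute)
  also have "\<dots> \<le> ennreal (8 / c\<^sup>2) * (local_osc h t v + local_osc h v t) + ennreal (8 / c\<^sup>2) * ennreal (cmod (h t - h v))"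
    by (intro add_right_mono 1)
  finally show ?thesis by (simp add: distrib_left)
qed

end

section \<open>Energy estimates\<close>

text \<open>
  A function of \<open>c\<close> and \<open>s\<close> only, so that the estimates are uniform over all parametrizations with
  the same chord-arc constant.
\<close>

definition reg_const :: "real \<Rightarrow> real \<Rightarrow> real" where
  "reg_const c s = 3 * (8 / c\<^sup>2)\<^sup>2 * (2 * (4 * hardy_const s)\<^sup>2 + 1)"

context chord_arc_loop
begin

abbreviation osc_density :: "real \<Rightarrow> (real \<Rightarrow> complex) \<Rightarrow> real \<Rightarrow> real \<Rightarrow> ennreal" where
  "osc_density s h t u \<equiv> ennreal ((cmod (h u - h t))\<^sup>2 * arc_dist l t u powr (- 1 - 2 * s))"

lemma iterated_nn_integral_cmult:
  assumes [measurable]: "(\<lambda>(t, u). f t u) \<in> borel_measurable (N \<Otimes>\<^sub>M N)"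
  shows "(\<integral>\<^sup>+t. \<integral>\<^sup>+u. k * f t u \<partial>N \<partial>N) = k * (\<integral>\<^sup>+t. \<integral>\<^sup>+u. f t u \<partial>N \<partial>N)"
proof -
  interpret NN: pair_sigma_finite N N by (rule pair_sigma_finite_N)
  have "(\<integral>\<^sup>+t. \<integral>\<^sup>+u. k * f t u \<partial>N \<partial>N) = (\<integral>\<^sup>+t. k * (\<integral>\<^sup>+u. f t u \<partial>N) \<partial>N)"
    by (intro nn_integral_cong nn_integral_cmult) measurable
  also have "\<dots> = k * (\<integral>\<^sup>+t. \<integral>\<^sup>+u. f t u \<partial>N \<partial>N)" by (rule nn_integral_cmult) measurable
  finally show ?thesis .
qed

lemma iterated_nn_integral_add:
  assumes [measurable]: "(\<lambda>(t, u). f t u) \<in> borel_measurable (N \<Otimes>\<^sub>M N)"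
    "(\<lambda>(t, u). g t u) \<in> borel_measurable (N \<Otimes>\<^sub>M N)"
  shows "(\<integral>\<^sup>+t. \<integral>\<^sup>+u. f t u + g t u \<partial>N \<partial>N) = (\<integral>\<^sup>+t. \<integral>\<^sup>+u. f t u \<partial>N \<partial>N) + (\<integral>\<^sup>+t. \<integral>\<^sup>+u. g t u \<partial>N \<partial>N)"
proof -
  interpret NN: pair_sigma_finite N N by (rule pair_sigma_finite_N)
  have "(\<integral>\<^sup>+t. \<integral>\<^sup>+u. f t u + g t u \<partial>N \<partial>N) = (\<integral>\<^sup>+t. (\<integral>\<^sup>+u. f t u \<partial>N) + (\<integral>\<^sup>+u. g t u \<partial>N) \<partial>N)"
    by (intro nn_integral_cong nn_integral_add) measurable
  also have "\<dots> = (\<integral>\<^sup>+t. \<integral>\<^sup>+u. f t u \<partial>N \<partial>N) + (\<integral>\<^sup>+t. \<integral>\<^sup>+u. g t u \<partial>N \<partial>N)"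
    by (rule nn_integral_add) measurable
  finally show ?thesis .
qed

text \<open>
  The \<open>H\<^sup>s\<close> energy with arc distances in place of chords; the two are comparable, and the arc
  distance has the simple distribution of \<open>nn_integral_arc_dist_le\<close>.
\<close>

definition arc_energy :: "real \<Rightarrow> (real \<Rightarrow> complex) \<Rightarrow> ennreal" where
  "arc_energy s h = (\<integral>\<^sup>+t. \<integral>\<^sup>+u. osc_density s h t u \<partial>N \<partial>N)"

lemma local_osc_energy_le:
  assumes s: "0 < s" "s < 1" and h [measurable]: "h \<in> borel_measurable N"
  shows "(\<integral>\<^sup>+t. \<integral>\<^sup>+v. (local_osc h t v)\<^sup>2 * ennreal (arc_dist l t v powr (- 1 - 2 * s)) \<partial>N \<partial>N)
    \<le> ennreal ((4 * hardy_const s)\<^sup>2) * arc_energy s h"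
proof -
  interpret NN: pair_sigma_finite N N by (rule pair_sigma_finite_N)
  have "(\<integral>\<^sup>+t. \<integral>\<^sup>+v. (local_osc h t v)\<^sup>2 * ennreal (arc_dist l t v powr (- 1 - 2 * s)) \<partial>N \<partial>N)
    \<le> (\<integral>\<^sup>+t. ennreal ((4 * hardy_const s)\<^sup>2) * (\<integral>\<^sup>+u. osc_density s h t u \<partial>N) \<partial>N)"
    unfolding local_osc_def
  proof (rule nn_integral_mono)
    fix t assume "t \<in> space N"
    then have t: "t \<in> {0..l}" by (simp add: space_N)
    have "(\<lambda>u. cmod (h u - h t)) \<in> borel_measurable N" by measurable
    from hardy_inequality[OF s t this]
    show "(\<integral>\<^sup>+v. (\<integral>\<^sup>+u. ennreal (cmod (h u - h t) * decay (arc_dist l t v) (arc_dist l t u)) \<partial>N)\<^sup>2 * ennreal (arc_dist l t v powr (- 1 - 2 * s)) \<partial>N)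
      \<le> ennreal ((4 * hardy_const s)\<^sup>2) * (\<integral>\<^sup>+u. osc_density s h t u \<partial>N)"
      by simp
  qed
  also have "\<dots> = ennreal ((4 * hardy_const s)\<^sup>2) * arc_energy s h"
    unfolding arc_energy_def by (rule nn_integral_cmult) measurable
  finally show ?thesis .
qed

text \<open>
  The Cauchy-Schwarz inequality with the weight \<open>x\<close> to the power \<open>2 s - 1\<close>, which is integrable at 0
  because \<open>s > 0\<close>.
\<close>

lemma reg_integrand_square_le:
  assumes s: "0 < s" and h [measurable]: "h \<in> borel_measurable N" and t: "t \<in> {0..l}"
  shows "(\<integral>\<^sup>+u. ennreal (cmod (reg_integrand h t u)) \<partial>N)\<^sup>2
    \<le> ennreal (4 * (l powr (2 * s) / (2 * s)) / c\<^sup>2) * (\<integral>\<^sup>+u. osc_density s h t u \<partial>N)"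
proof -
  have [measurable]: "(\<lambda>u. t) \<in> N \<rightarrow>\<^sub>M N" using t by (simp add: space_N)
  define x where "x = arc_dist l t"
  have [measurable]: "x \<in> borel_measurable N" unfolding x_def by measurable
  have x: "0 \<le> x u" "x u \<le> l" if "u \<in> {0..l}" for u
    using arc_dist_nonneg[OF t that] that t by (auto simp: x_def arc_dist_def)
  let ?a = "\<lambda>u. ennreal (cmod (h u - h t) * x u powr (- 1 / 2 - s))"
  let ?b = "\<lambda>u. ennreal (1 / c * x u powr (s - 1 / 2))"
  have "(\<integral>\<^sup>+u. ennreal (cmod (reg_integrand h t u)) \<partial>N) \<le> (\<integral>\<^sup>+u. ?a u * ?b u \<partial>N)"
  proof (rule nn_integral_mono)
    fix u assume "u \<in> space N"
    then have u: "u \<in> {0..l}" by (simp add: space_N)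
    have "cmod (reg_integrand h t u) \<le> cmod (h u - h t) * (1 / (c * x u))"
      unfolding reg_integrand_def norm_mult x_def by (intro mult_left_mono cauchy_kernel_le t u) auto
    also have "1 / (c * x u) = x u powr (- 1 / 2 - s) * (1 / c * x u powr (s - 1 / 2))"
    proof (cases "x u = 0")
      case False
      then have "x u powr (- 1 / 2 - s) * x u powr (s - 1 / 2) = x u powr (- 1)"
        unfolding powr_add[symmetric] by simp
      also have "\<dots> = 1 / x u" using False x(1)[OF u] by (simp add: powr_minus_divide)
      finally show ?thesis by (simp add: mult_ac)
    qed simp
    finally show "ennreal (cmod (reg_integrand h t u)) \<le> ?a u * ?b u"
      using c_pos by (subst ennreal_mult[symmetric]) (auto simp: mult.assoc intro: ennreal_leI)
  qed
  then have "(\<integral>\<^sup>+u. ennreal (cmod (reg_integrand h t u)) \<partial>N)\<^sup>2 \<le> (\<integral>\<^sup>+u. ?a u * ?b u \<partial>N)\<^sup>2"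
    by (rule power_mono) simp
  also have "\<dots> \<le> (\<integral>\<^sup>+u. (?a u)\<^sup>2 \<partial>N) * (\<integral>\<^sup>+u. (?b u)\<^sup>2 \<partial>N)"
    by (rule Cauchy_Schwarz_nn_integral) measurable
  also have "(\<integral>\<^sup>+u. (?a u)\<^sup>2 \<partial>N) = (\<integral>\<^sup>+u. osc_density s h t u \<partial>N)"
  proof (rule nn_integral_cong)
    fix u assume "u \<in> space N"
    then have u: "u \<in> {0..l}" by (simp add: space_N)
    have "(x u powr (- 1 / 2 - s))\<^sup>2 = x u powr (- 1 - 2 * s)"
      unfolding power2_eq_square powr_add[symmetric] by (rule arg_cong[where f = "(powr) (x u)"]) simp
    then show "(?a u)\<^sup>2 = osc_density s h t u"
      by (simp add: ennreal_power power_mult_distrib x_def)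
  qed
  also have "(\<integral>\<^sup>+u. osc_density s h t u \<partial>N) * (\<integral>\<^sup>+u. (?b u)\<^sup>2 \<partial>N)
      \<le> (\<integral>\<^sup>+u. osc_density s h t u \<partial>N) * ennreal (4 * (l powr (2 * s) / (2 * s)) / c\<^sup>2)"
  proof (rule mult_left_mono)
    show "(\<integral>\<^sup>+u. (?b u)\<^sup>2 \<partial>N) \<le> ennreal (4 * (l powr (2 * s) / (2 * s)) / c\<^sup>2)"
    proof -
      define \<phi> where "\<phi> y = indicator {0..l} y * ennreal (y powr (2 * s - 1))" for y
      have [measurable]: "\<phi> \<in> borel_measurable borel" unfolding \<phi>_def by measurable
      have "(\<integral>\<^sup>+u. (?b u)\<^sup>2 \<partial>N) = (\<integral>\<^sup>+u. ennreal (1 / c\<^sup>2) * \<phi> (arc_dist l t u) \<partial>N)"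
      proof (rule nn_integral_cong)
        fix u assume "u \<in> space N"
        then have u: "u \<in> {0..l}" by (simp add: space_N)
        have "(x u powr (s - 1 / 2))\<^sup>2 = x u powr (2 * s - 1)"
          unfolding power2_eq_square powr_add[symmetric] by (rule arg_cong[where f = "(powr) (x u)"]) simp
        then show "(?b u)\<^sup>2 = ennreal (1 / c\<^sup>2) * \<phi> (arc_dist l t u)"
          using x[OF u] c_pos by (simp add: \<phi>_def ennreal_power power_mult_distrib power_divide x_def ennreal_mult[symmetric])
      qed
      also have "\<dots> = ennreal (1 / c\<^sup>2) * (\<integral>\<^sup>+u. \<phi> (arc_dist l t u) \<partial>N)"
        by (rule nn_integral_cmult) measurable
      also have "\<dots> \<le> ennreal (1 / c\<^sup>2) * (4 * (\<integral>\<^sup>+y. \<phi> y * indicator {0..} y \<partial>lborel))"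
        by (intro mult_left_mono nn_integral_arc_dist_le t) auto
      also have "(\<integral>\<^sup>+y. \<phi> y * indicator {0..} y \<partial>lborel) = (\<integral>\<^sup>+y. indicator {0..l} y * ennreal (y powr (2 * s - 1)) \<partial>lborel)"
        by (rule nn_integral_cong) (auto simp: \<phi>_def indicator_def)
      also have "\<dots> = ennreal (l powr (2 * s - 1 + 1) / (2 * s - 1 + 1))"
        by (rule nn_integral_powr_near_0) (use s l_pos in auto)
      also have "ennreal (1 / c\<^sup>2) * (4 * ennreal (l powr (2 * s - 1 + 1) / (2 * s - 1 + 1))) = ennreal (1 / c\<^sup>2) * ennreal (4 * (l powr (2 * s) / (2 * s)))"
        using s by (subst ennreal_mult') auto
      also have "\<dots> = ennreal (4 * (l powr (2 * s) / (2 * s)) / c\<^sup>2)"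
        using s by (subst ennreal_mult[symmetric]) (auto simp: mult.commute)
      finally show ?thesis .
    qed
  qed simp
  finally show ?thesis by (simp only: mult.commute)
qed

lemma reg_integrand_integrable_AE:
  assumes s: "0 < s" and h [measurable]: "h \<in> borel_measurable N" and fin: "arc_energy s h < \<infinity>"
  shows "AE t in N. integrable N (reg_integrand h t)"
proof -
  interpret NN: pair_sigma_finite N N by (rule pair_sigma_finite_N)
  have "AE t in N. (\<integral>\<^sup>+u. osc_density s h t u \<partial>N) \<noteq> \<infinity>"
    by (rule nn_integral_PInf_AE) (use fin in \<open>auto simp: arc_energy_def\<close>)
  then show ?thesis
  proof (rule AE_mp, intro AE_I2 impI)
    fix t assume "t \<in> space N" and f: "(\<integral>\<^sup>+u. osc_density s h t u \<partial>N) \<noteq> \<infinity>"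
    then have t: "t \<in> {0..l}" by (simp add: space_N)
    have [measurable]: "(\<lambda>u. t) \<in> N \<rightarrow>\<^sub>M N" using t by (simp add: space_N)
    have "(\<integral>\<^sup>+u. ennreal (cmod (reg_integrand h t u)) \<partial>N)\<^sup>2 < \<infinity>"
      by (rule order.strict_trans1[OF reg_integrand_square_le[OF s h t]])
        (use f in \<open>simp add: ennreal_mult_less_top less_top\<close>)
    then have "(\<integral>\<^sup>+u. ennreal (cmod (reg_integrand h t u)) \<partial>N) < \<infinity>"
      by (metis ennreal_top_mult infinity_ennreal_def less_top power2_eq_square ennreal_top_neq_zero)
    moreover have "reg_integrand h t \<in> borel_measurable N"
      unfolding reg_integrand_def[abs_def] by measurable
    ultimately show "integrable N (reg_integrand h t)"
      by (intro integrableI_bounded) auto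
  qed
qed

lemma reg_cauchy_measurable:
  assumes h [measurable]: "h \<in> borel_measurable N"
  shows "reg_cauchy h \<in> borel_measurable N"
proof -
  interpret NN: pair_sigma_finite N N by (rule pair_sigma_finite_N)
  show ?thesis unfolding reg_cauchy_def reg_integrand_def by measurable
qed

lemma reg_cauchy_square_integral_le:
  assumes s: "0 < s" and h [measurable]: "h \<in> borel_measurable N"
  shows "(\<integral>\<^sup>+t. ennreal ((cmod (reg_cauchy h t))\<^sup>2) \<partial>N) \<le> ennreal (4 * (l powr (2 * s) / (2 * s)) / c\<^sup>2) * arc_energy s h"
proof -
  interpret NN: pair_sigma_finite N N by (rule pair_sigma_finite_N)
  have "(\<integral>\<^sup>+t. ennreal ((cmod (reg_cauchy h t))\<^sup>2) \<partial>N)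
    \<le> (\<integral>\<^sup>+t. ennreal (4 * (l powr (2 * s) / (2 * s)) / c\<^sup>2) * (\<integral>\<^sup>+u. osc_density s h t u \<partial>N) \<partial>N)"
  proof (rule nn_integral_mono)
    fix t assume "t \<in> space N"
    then have t: "t \<in> {0..l}" by (simp add: space_N)
    have "ennreal (cmod (reg_cauchy h t)) \<le> (\<integral>\<^sup>+u. ennreal (cmod (reg_integrand h t u)) \<partial>N)"
    proof (cases "integrable N (reg_integrand h t)")
      case True then show ?thesis unfolding reg_cauchy_def by (rule integral_norm_bound_ennreal)
    next
      case False then show ?thesis by (simp add: reg_cauchy_def not_integrable_integral_eq)
    qed
    then have "(ennreal (cmod (reg_cauchy h t)))\<^sup>2 \<le> (\<integral>\<^sup>+u. ennreal (cmod (reg_integrand h t u)) \<partial>N)\<^sup>2"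
      by (rule power_mono) simp
    also note reg_integrand_square_le[OF s h t]
    finally show "ennreal ((cmod (reg_cauchy h t))\<^sup>2)
      \<le> ennreal (4 * (l powr (2 * s) / (2 * s)) / c\<^sup>2) * (\<integral>\<^sup>+u. osc_density s h t u \<partial>N)"
      by (simp add: ennreal_power)
  qed
  also have "\<dots> = ennreal (4 * (l powr (2 * s) / (2 * s)) / c\<^sup>2) * arc_energy s h"
    unfolding arc_energy_def by (rule nn_integral_cmult) measurable
  finally show ?thesis .
qed

text \<open>
  The two local oscillations in \<open>reg_cauchy_diff_bound\<close> contribute equally, because their weight is
  symmetric in \<open>t\<close> and \<open>v\<close>.
\<close>

lemma arc_energy_reg_cauchy_le:
  assumes s: "0 < s" "s < 1" and h [measurable]: "h \<in> borel_measurable N" and fin: "arc_energy s h < \<infinity>"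
  shows "arc_energy s (reg_cauchy h) \<le> ennreal (reg_const c s) * arc_energy s h"
proof -
  interpret NN: pair_sigma_finite N N by (rule pair_sigma_finite_N)
  define w where "w t v = ennreal (arc_dist l t v powr (- 1 - 2 * s))" for t v
  define K where "K = ennreal (8 / c\<^sup>2)"
  define H where "H = ennreal ((4 * hardy_const s)\<^sup>2)"
  define E where "E = arc_energy s h"
  have [measurable]: "(\<lambda>(t, v). w t v) \<in> borel_measurable (N \<Otimes>\<^sub>M N)" unfolding w_def by measurable
  have M [measurable]: "(\<lambda>(t, v). local_osc h t v) \<in> borel_measurable (N \<Otimes>\<^sub>M N)" unfolding local_osc_def by measurable
  note [measurable] = reg_cauchy_measurable[OF h]
  have good: "AE t in N. integrable N (reg_integrand h t)"
    by (rule reg_integrand_integrable_AE[OF s(1) h fin])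
  have "arc_energy s (reg_cauchy h) \<le> (\<integral>\<^sup>+t. \<integral>\<^sup>+v. 3 * K\<^sup>2 * ((local_osc h t v)\<^sup>2 * w t v + (local_osc h v t)\<^sup>2 * w t v + osc_density s h t v) \<partial>N \<partial>N)"
    unfolding arc_energy_def
    using good AE_space
  proof (intro nn_integral_mono_AE, eventually_elim)
    fix t assume t: "integrable N (reg_integrand h t)" "t \<in> space N"
    show "(\<integral>\<^sup>+v. ennreal ((cmod (reg_cauchy h v - reg_cauchy h t))\<^sup>2 * arc_dist l t v powr (- 1 - 2 * s)) \<partial>N)
      \<le> (\<integral>\<^sup>+v. 3 * K\<^sup>2 * ((local_osc h t v)\<^sup>2 * w t v + (local_osc h v t)\<^sup>2 * w t v + osc_density s h t v) \<partial>N)"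
      using good AE_space
    proof (intro nn_integral_mono_AE, eventually_elim)
      fix v assume v: "integrable N (reg_integrand h v)" "v \<in> space N"
      show "ennreal ((cmod (reg_cauchy h v - reg_cauchy h t))\<^sup>2 * arc_dist l t v powr (- 1 - 2 * s))
        \<le> 3 * K\<^sup>2 * ((local_osc h t v)\<^sup>2 * w t v + (local_osc h v t)\<^sup>2 * w t v + osc_density s h t v)"
      proof (cases "arc_dist l t v = 0")
        case True then show ?thesis by simp
      next
        case False
        then have pos: "0 < arc_dist l t v" using arc_dist_nonneg[of t l v] t v by (simp add: space_N)
        have "ennreal (cmod (reg_cauchy h t - reg_cauchy h v)) \<le> K * (local_osc h t v + local_osc h v t + ennreal (cmod (h t - h v)))"
          unfolding K_def using t v pos by (intro reg_cauchy_diff_bound h) (auto simp: space_N)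
        then have "(ennreal (cmod (reg_cauchy h t - reg_cauchy h v)))\<^sup>2 \<le> (K * (local_osc h t v + local_osc h v t + ennreal (cmod (h t - h v))))\<^sup>2"
          by (rule power_mono) simp
        also have "\<dots> = K\<^sup>2 * (local_osc h t v + local_osc h v t + ennreal (cmod (h t - h v)))\<^sup>2"
          by (rule power_mult_distrib)
        also have "\<dots> \<le> K\<^sup>2 * (3 * ((local_osc h t v)\<^sup>2 + (local_osc h v t)\<^sup>2 + (ennreal (cmod (h t - h v)))\<^sup>2))"
          by (intro mult_left_mono ennreal_square_sum3_le) simp
        finally have "(ennreal (cmod (reg_cauchy h t - reg_cauchy h v)))\<^sup>2 * w t v \<le> K\<^sup>2 * (3 * ((local_osc h t v)\<^sup>2 + (local_osc h v t)\<^sup>2 + (ennreal (cmod (h t - h v)))\<^sup>2)) * w t v"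
          by (rule mult_right_mono) simp
        also have "\<dots> = 3 * K\<^sup>2 * ((local_osc h t v)\<^sup>2 * w t v + (local_osc h v t)\<^sup>2 * w t v + (ennreal (cmod (h t - h v)))\<^sup>2 * w t v)"
          by (simp only: distrib_left distrib_right mult_ac)
        also have "(ennreal (cmod (h t - h v)))\<^sup>2 * w t v = osc_density s h t v"
          by (simp add: w_def ennreal_power ennreal_mult norm_minus_commute)
        also have "(ennreal (cmod (reg_cauchy h t - reg_cauchy h v)))\<^sup>2 * w t v = ennreal ((cmod (reg_cauchy h v - reg_cauchy h t))\<^sup>2 * arc_dist l t v powr (- 1 - 2 * s))"
          by (simp add: w_def ennreal_power ennreal_mult norm_minus_commute)
        finally show ?thesis .
      qed
    qed
  qed
  also have "\<dots> = 3 * K\<^sup>2 * ((\<integral>\<^sup>+t. \<integral>\<^sup>+v. (local_osc h t v)\<^sup>2 * w t v \<partial>N \<partial>N) + (\<integral>\<^sup>+t. \<integral>\<^sup>+v. (local_osc h v t)\<^sup>2 * w t v \<partial>N \<partial>N) + E)"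
    unfolding E_def arc_energy_def
    by (subst iterated_nn_integral_cmult, measurable) (subst iterated_nn_integral_add, measurable, subst iterated_nn_integral_add, measurable)
  also have "(\<integral>\<^sup>+t. \<integral>\<^sup>+v. (local_osc h v t)\<^sup>2 * w t v \<partial>N \<partial>N) = (\<integral>\<^sup>+v. \<integral>\<^sup>+t. (local_osc h v t)\<^sup>2 * w t v \<partial>N \<partial>N)"
    by (rule NN.Fubini') measurable
  also have "\<dots> = (\<integral>\<^sup>+t. \<integral>\<^sup>+v. (local_osc h t v)\<^sup>2 * w t v \<partial>N \<partial>N)"
    by (simp add: w_def arc_dist_commute)
  also have "3 * K\<^sup>2 * ((\<integral>\<^sup>+t. \<integral>\<^sup>+v. (local_osc h t v)\<^sup>2 * w t v \<partial>N \<partial>N) + (\<integral>\<^sup>+t. \<integral>\<^sup>+v. (local_osc h t v)\<^sup>2 * w t v \<partial>N \<partial>N) + E)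
    \<le> 3 * K\<^sup>2 * (H * E + H * E + E)"
    unfolding w_def H_def E_def by (intro mult_left_mono add_mono local_osc_energy_le[OF s h]) auto
  also have "\<dots> = 3 * K\<^sup>2 * (2 * H + 1) * E"
    by (simp only: distrib_left distrib_right mult_2 mult_1 mult.assoc)
  also have "3 * K\<^sup>2 * (2 * H + 1) = ennreal (reg_const c s)"
  proof -
    have "3 * K\<^sup>2 = ennreal (3 * (8 / c\<^sup>2)\<^sup>2)" unfolding K_def ennreal_power[OF divide_nonneg_nonneg[of 8 "c\<^sup>2"]]
      using c_pos by (subst ennreal_mult') (auto simp: ennreal_power)
    moreover have "2 * H + 1 = ennreal (2 * (4 * hardy_const s)\<^sup>2 + 1)"
      unfolding H_def by (subst ennreal_plus) (auto simp: ennreal_mult')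
    ultimately show ?thesis unfolding reg_const_def by (simp only:) (rule ennreal_mult[symmetric]; simp)
  qed
  finally show ?thesis by (simp add: E_def)
qed

lemma arc_energy_linear_combination_le:
  assumes h [measurable]: "h \<in> borel_measurable N" and g [measurable]: "g \<in> borel_measurable N"
  shows "arc_energy s (\<lambda>t. a * h t + b * g t) \<le> ennreal (2 * (cmod a)\<^sup>2) * arc_energy s h + ennreal (2 * (cmod b)\<^sup>2) * arc_energy s g"
proof -
  interpret NN: pair_sigma_finite N N by (rule pair_sigma_finite_N)
  let ?w = "\<lambda>t u. arc_dist l t u powr (- 1 - 2 * s)"
  have pt: "ennreal ((cmod ((a * h u + b * g u) - (a * h t + b * g t)))\<^sup>2 * ?w t u)
     \<le> ennreal (2 * (cmod a)\<^sup>2) * osc_density s h t u + ennreal (2 * (cmod b)\<^sup>2) * osc_density s g t u" for t u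
  proof -
    define p q where "p = cmod a * cmod (h u - h t)" and "q = cmod b * cmod (g u - g t)"
    have "cmod ((a * h u + b * g u) - (a * h t + b * g t)) = cmod (a * (h u - h t) + b * (g u - g t))"
      by (simp add: algebra_simps)
    also have "\<dots> \<le> p + q" unfolding p_def q_def norm_mult[symmetric] by (rule norm_triangle_ineq)
    finally have "(cmod ((a * h u + b * g u) - (a * h t + b * g t)))\<^sup>2 \<le> (p + q)\<^sup>2" by (intro power_mono) auto
    also have "\<dots> \<le> 2 * p\<^sup>2 + 2 * q\<^sup>2" using sum_squares_bound[of p q] by (simp add: power2_sum)
    finally have "(cmod ((a * h u + b * g u) - (a * h t + b * g t)))\<^sup>2 * ?w t u \<le> (2 * p\<^sup>2 + 2 * q\<^sup>2) * ?w t u"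
      by (intro mult_right_mono) auto
    also have "\<dots> = 2 * (cmod a)\<^sup>2 * ((cmod (h u - h t))\<^sup>2 * ?w t u) + 2 * (cmod b)\<^sup>2 * ((cmod (g u - g t))\<^sup>2 * ?w t u)"
      by (simp add: p_def q_def power_mult_distrib algebra_simps)
    finally have "ennreal ((cmod ((a * h u + b * g u) - (a * h t + b * g t)))\<^sup>2 * ?w t u)
      \<le> ennreal (2 * (cmod a)\<^sup>2 * ((cmod (h u - h t))\<^sup>2 * ?w t u) + 2 * (cmod b)\<^sup>2 * ((cmod (g u - g t))\<^sup>2 * ?w t u))"
      by (rule ennreal_leI)
    also have "\<dots> = ennreal (2 * (cmod a)\<^sup>2) * osc_density s h t u + ennreal (2 * (cmod b)\<^sup>2) * osc_density s g t u"
      by (subst ennreal_plus) (auto simp only: intro!: arg_cong2[where f = "(+)"] ennreal_mult mult_nonneg_nonneg powr_ge_zero zero_le_power2 zero_le_numeral)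
    finally show ?thesis .
  qed
  have "arc_energy s (\<lambda>t. a * h t + b * g t) \<le> (\<integral>\<^sup>+t. \<integral>\<^sup>+u. ennreal (2 * (cmod a)\<^sup>2) * osc_density s h t u + ennreal (2 * (cmod b)\<^sup>2) * osc_density s g t u \<partial>N \<partial>N)"
    unfolding arc_energy_def by (intro nn_integral_mono pt)
  also have "\<dots> = ennreal (2 * (cmod a)\<^sup>2) * arc_energy s h + ennreal (2 * (cmod b)\<^sup>2) * arc_energy s g"
    unfolding arc_energy_def
    by (subst iterated_nn_integral_add, measurable) (subst iterated_nn_integral_cmult, measurable, subst iterated_nn_integral_cmult, measurable)
  finally show ?thesis .
qed

end

section \<open>Measurable dependence on the point\<close>

text \<open>
  For the truncated Cauchy integrals, whose integrand contains \<open>vector_derivative\<close> and is therefore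
  known only up to a null set.
\<close>

lemma borel_measurable_completion_AE_eq:
  fixes F G :: "'a \<Rightarrow> 'b::topological_space"
  assumes G: "G \<in> borel_measurable M" and eq: "AE x in M. F x = G x"
  shows "F \<in> borel_measurable (completion M)"
proof (rule measurableI)
  fix A :: "'b set" assume A: "A \<in> sets borel"
  have 1: "Measurable.pred (completion M) (\<lambda>x. F x \<noteq> G x)"
    by (rule sets_completion_AE) (use eq in auto)
  have 2: "Measurable.pred (completion M) (\<lambda>x. F x \<noteq> G x \<and> F x \<in> A)"
    by (rule sets_completion_AE) (use eq in auto)
  have 3: "Measurable.pred (completion M) (\<lambda>x. G x \<in> A)"
    using measurable_completion[OF G] A by measurable
  have "Measurable.pred (completion M) (\<lambda>x. (G x \<in> A \<and> \<not> F x \<noteq> G x) \<or> (F x \<noteq> G x \<and> F x \<in> A))"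
    by (intro pred_intros_logic 1 2 3)
  moreover have "(\<lambda>x. (G x \<in> A \<and> \<not> F x \<noteq> G x) \<or> (F x \<noteq> G x \<and> F x \<in> A)) = (\<lambda>x. F x \<in> A)"
    by auto
  ultimately have "Measurable.pred (completion M) (\<lambda>x. F x \<in> A)" by (simp only:)
  then show "F -` A \<inter> space (completion M) \<in> sets (completion M)"
    by (simp add: pred_def vimage_def Int_def conj_commute)
qed auto

definition small_rats :: "nat \<Rightarrow> real set" where
  "small_rats m = {p \<in> \<rat>. 0 < p \<and> p < 1 / real (Suc m)}"

lemma tendsto_at_right_iff_Cauchy:
  fixes T :: "real \<Rightarrow> 'a::complete_space"
  shows "(\<exists>w. (T \<longlongrightarrow> w) (at_right 0)) \<longleftrightarrow>
    (\<forall>e>0. \<exists>b>0. \<forall>x y. 0 < x \<and> x < b \<and> 0 < y \<and> y < b \<longrightarrow> dist (T x) (T y) < e)" (is "_ \<longleftrightarrow> ?R")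
proof -
  have "(\<exists>w. (T \<longlongrightarrow> w) (at_right 0)) \<longleftrightarrow> cauchy_filter (filtermap T (at_right 0))"
  proof
    assume "\<exists>w. (T \<longlongrightarrow> w) (at_right 0)"
    then show "cauchy_filter (filtermap T (at_right 0))" by (auto simp: filterlim_def intro: nhds_imp_cauchy_filter)
  next
    assume "cauchy_filter (filtermap T (at_right 0))"
    from cauchy_filter_complete_converges[OF this complete_UNIV] show "\<exists>w. (T \<longlongrightarrow> w) (at_right 0)"
      by (simp add: filterlim_def filtermap_bot_iff)
  qed
  also have "\<dots> \<longleftrightarrow> ?R"
    unfolding cauchy_filter_metric_filtermap
  proof (intro iffI allI impI)
    fix e :: real assume "\<forall>e>0. \<exists>P. eventually P (at_right 0) \<and> (\<forall>x y. P x \<and> P y \<longrightarrow> dist (T x) (T y) < e)" and "0 < e"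
    then obtain P where P: "eventually P (at_right (0::real))" "\<And>x y. P x \<Longrightarrow> P y \<Longrightarrow> dist (T x) (T y) < e" by blast
    from P(1) obtain b where "0 < b" "\<And>x. 0 < x \<Longrightarrow> x < b \<Longrightarrow> P x"
      unfolding eventually_at_right_field by blast
    then show "\<exists>b>0. \<forall>x y. 0 < x \<and> x < b \<and> 0 < y \<and> y < b \<longrightarrow> dist (T x) (T y) < e" using P(2) by blast
  next
    fix e :: real assume R: ?R and e: "0 < e"
    from R[rule_format, OF e] obtain b where "0 < b" and b: "\<forall>x y. 0 < x \<and> x < b \<and> 0 < y \<and> y < b \<longrightarrow> dist (T x) (T y) < e"
      by blast
    have "eventually (\<lambda>x. 0 < x \<and> x < b) (at_right 0)"
      unfolding eventually_at_right_field using \<open>0 < b\<close> by blast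
    moreover have "\<forall>x y. (0 < x \<and> x < b) \<and> (0 < y \<and> y < b) \<longrightarrow> dist (T x) (T y) < e" using b by simp
    ultimately show "\<exists>P. eventually P (at_right 0) \<and> (\<forall>x y. P x \<and> P y \<longrightarrow> dist (T x) (T y) < e)"
      by (intro exI[of _ "\<lambda>x. 0 < x \<and> x < b"] conjI)
  qed
  finally show ?thesis .
qed

text \<open>
  A limit over a continuum of truncation parameters is reduced to countably many conditions: by
  right continuity the values of \<open>T\<close> lie in the closure of its values at rational parameters, and
  closures have the same diameter.
\<close>

lemma right_continuous_tendsto_iff_rational_Cauchy:
  fixes T :: "real \<Rightarrow> 'a::banach"
  assumes rc: "\<And>\<epsilon>. 0 < \<epsilon> \<Longrightarrow> (T \<longlongrightarrow> T \<epsilon>) (at_right \<epsilon>)"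
  shows "(\<exists>w. (T \<longlongrightarrow> w) (at_right 0)) \<longleftrightarrow>
    (\<forall>n. \<exists>m. \<forall>p\<in>small_rats m. \<forall>q\<in>small_rats m. norm (T p - T q) \<le> 1 / real (Suc n))" (is "_ \<longleftrightarrow> ?R")
  unfolding tendsto_at_right_iff_Cauchy
proof (intro iffI allI impI)
  fix n assume C: "\<forall>e>0. \<exists>b>0. \<forall>x y. 0 < x \<and> x < b \<and> 0 < y \<and> y < b \<longrightarrow> dist (T x) (T y) < e"
  have "0 < 1 / real (Suc n)" by simp
  from C[rule_format, OF this] obtain b where b: "0 < b" "\<forall>x y. 0 < x \<and> x < b \<and> 0 < y \<and> y < b \<longrightarrow> dist (T x) (T y) < 1 / real (Suc n)"
    by blast
  obtain m where "1 / real (Suc m) < b" using nat_approx_posE[OF b(1)] by blast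
  then have "\<forall>p\<in>small_rats m. \<forall>q\<in>small_rats m. norm (T p - T q) \<le> 1 / real (Suc n)"
    using b(2) by (force simp: small_rats_def dist_norm intro: less_imp_le)
  then show "\<exists>m. \<forall>p\<in>small_rats m. \<forall>q\<in>small_rats m. norm (T p - T q) \<le> 1 / real (Suc n)" by blast
next
  fix e :: real assume R: ?R and "0 < e"
  then obtain n where n: "1 / real (Suc n) < e" using nat_approx_posE by blast
  obtain m where m: "\<And>p q. p \<in> small_rats m \<Longrightarrow> q \<in> small_rats m \<Longrightarrow> norm (T p - T q) \<le> 1 / real (Suc n)"
    using R by blast
  have "T x \<in> closure (T ` small_rats m)" if x: "0 < x" "x < 1 / real (Suc m)" for x
    unfolding closure_approachable
  proof (intro allI impI)
    fix d :: real assume "0 < d"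
    from tendstoD[OF rc[OF x(1)] this] obtain b where b: "x < b" "\<And>y. x < y \<Longrightarrow> y < b \<Longrightarrow> dist (T y) (T x) < d"
      by (auto simp: eventually_at_right_field)
    obtain p where p: "p \<in> \<rat>" "x < p" "p < min b (1 / real (Suc m))"
      using Rats_dense_in_real[of x "min b (1 / real (Suc m))"] b x by auto
    then have "p \<in> small_rats m" "dist (T p) (T x) < d" using b(2)[of p] x by (auto simp: small_rats_def)
    then show "\<exists>y\<in>T ` small_rats m. dist y (T x) < d" by blast
  qed
  moreover have "dist v w \<le> 1 / real (Suc n)"
    if "v \<in> closure (T ` small_rats m)" "w \<in> closure (T ` small_rats m)" for v w
  proof -
    have half: "dist (T p) v \<le> 1 / real (Suc n)" if p: "p \<in> small_rats m" and v: "v \<in> closure (T ` small_rats m)" for p v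
    proof -
      have "T ` small_rats m \<subseteq> cball (T p) (1 / real (Suc n))" using m[OF p] by (auto simp: dist_norm)
      from closure_minimal[OF this closed_cball] show ?thesis using v by auto
    qed
    have "T ` small_rats m \<subseteq> cball v (1 / real (Suc n))" using half[OF _ that(1)] by (auto simp: dist_commute)
    from closure_minimal[OF this closed_cball] show ?thesis using that(2) by auto
  qed
  ultimately have "dist (T x) (T y) < e" if "0 < x" "x < 1 / real (Suc m)" "0 < y" "y < 1 / real (Suc m)" for x y
    using n that by (meson le_less_trans)
  then show "\<exists>b>0. \<forall>x y. 0 < x \<and> x < b \<and> 0 < y \<and> y < b \<longrightarrow> dist (T x) (T y) < e"
    by (intro exI[of _ "1 / real (Suc m)"]) simp
qed

lemma Lim_at_right_eq_lim_seq:
  fixes T :: "real \<Rightarrow> 'a::t2_space"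
  assumes "(T \<longlongrightarrow> w) (at_right 0)"
  shows "Lim (at_right 0) T = lim (\<lambda>k. T (1 / real (Suc k)))"
proof -
  have 0: "(\<lambda>k. 1 / real (Suc k)) \<longlonglongrightarrow> 0" by (rule LIMSEQ_Suc[OF lim_1_over_n])
  have "filterlim (\<lambda>k. 1 / real (Suc k)) (at_right 0) sequentially"
    unfolding filterlim_at using 0 by auto
  then have "(\<lambda>k. T (1 / real (Suc k))) \<longlonglongrightarrow> w" by (rule filterlim_compose[OF assms])
  then have "lim (\<lambda>k. T (1 / real (Suc k))) = w" by (rule limI)
  moreover have "Lim (at_right 0) T = w" by (rule tendsto_Lim[OF _ assms]) simp
  ultimately show ?thesis by simp
qed

context chord_arc_loop
begin

abbreviation trunc_integrand :: "(complex \<Rightarrow> complex) \<Rightarrow> complex \<Rightarrow> real \<Rightarrow> real \<Rightarrow> complex" where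
  "trunc_integrand f z \<epsilon> u \<equiv> indicator (chord_far z \<epsilon>) u *\<^sub>R (f (\<gamma> u) * (D u / (\<gamma> u - z)))"

definition trunc :: "(complex \<Rightarrow> complex) \<Rightarrow> complex \<Rightarrow> real \<Rightarrow> complex" where
  "trunc f z \<epsilon> = (LINT u|N. trunc_integrand f z \<epsilon> u)"

lemma truncated_cauchy_integral_eq:
  assumes f [measurable]: "f \<in> borel_measurable borel"
  shows "truncated_cauchy_integral \<gamma> l f z \<epsilon> = trunc f z \<epsilon>"
proof -
  let ?F = "\<lambda>t. indicator (chord_far z \<epsilon>) t *\<^sub>R (f (\<gamma> t) / (\<gamma> t - z) * vector_derivative \<gamma> (at t within {0..l}))"
  let ?G = "\<lambda>t. indicator {0..l} t *\<^sub>R (trunc_integrand f z \<epsilon> t)"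
  have [measurable]: "indicator (chord_far z \<epsilon>) \<in> borel_measurable N"
    by (rule measurable_restrict_space1) simp
  have "(\<lambda>t. trunc_integrand f z \<epsilon> t) \<in> borel_measurable N"
    by measurable
  then have G: "?G \<in> borel_measurable lborel"
    by (subst (asm) borel_measurable_restrict_space_iff) auto
  have eq: "AE t in lborel. ?F t = ?G t"
    using D_derivative AE_lborel_singleton[of 0] AE_lborel_singleton[of l]
  proof eventually_elim
    case (elim t)
    show ?case
    proof (cases "t \<in> chord_far z \<epsilon>")
      case True
      then have t: "0 < t" "t < l" using elim by (auto simp: chord_far_def)
      then have "vector_derivative \<gamma> (at t within {0..l}) = D t"
        using elim by (intro vector_derivative_at_within_ivl) auto
      then show ?thesis using t by simp
    qed simp
  qed
  have F: "?F \<in> borel_measurable lebesgue"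
    by (rule borel_measurable_completion_AE_eq[OF G eq])
  have "truncated_cauchy_integral \<gamma> l f z \<epsilon> = integral\<^sup>L lebesgue ?F"
    by (simp add: truncated_cauchy_integral_def set_lebesgue_integral_def chord_far_def)
  also have "\<dots> = integral\<^sup>L lebesgue ?G"
    by (rule integral_cong_AE[OF F measurable_completion[OF G] AE_completion[OF eq]])
  also have "\<dots> = integral\<^sup>L lborel ?G" by (rule integral_completion[OF G])
  also have "\<dots> = trunc f z \<epsilon>"
    unfolding trunc_def by (rule integral_restrict_space[symmetric]) simp
  finally show ?thesis .
qed

lemma indicator_chord_far_N:
  "u \<in> space N \<Longrightarrow> indicator (chord_far z \<epsilon>) u = (if \<epsilon> < cmod (\<gamma> u - z) then 1 else 0 :: real)"
  by (simp add: space_N chord_far_def indicator_def)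

lemma trunc_measurable:
  assumes f [measurable]: "f \<in> borel_measurable borel"
  shows "(\<lambda>z. trunc f z \<epsilon>) \<in> borel_measurable borel"
proof -
  interpret sigma_finite_measure N
    using pair_sigma_finite_N by (simp add: pair_sigma_finite_def)
  have "trunc f z \<epsilon> = (LINT u|N. (if \<epsilon> < cmod (\<gamma> u - z) then 1 else 0) *\<^sub>R (f (\<gamma> u) * (D u / (\<gamma> u - z))))" for z
    unfolding trunc_def by (intro Bochner_Integration.integral_cong refl) (simp add: indicator_chord_far_N)
  moreover have "(\<lambda>z. LINT u|N. (if \<epsilon> < cmod (\<gamma> u - z) then 1 else 0) *\<^sub>R (f (\<gamma> u) * (D u / (\<gamma> u - z)))) \<in> borel_measurable borel"
    by measurable
  ultimately show ?thesis by simp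
qed

lemma chord_far_kernel_le:
  assumes "0 < \<delta>" "\<delta> \<le> \<epsilon>"
  shows "cmod (indicator (chord_far z \<epsilon>) u *\<^sub>R (a * (D u / (\<gamma> u - z)))) \<le> cmod a * (1 / \<delta>)"
proof (cases "u \<in> chord_far z \<epsilon>")
  case True
  then have "cmod (D u) / cmod (\<gamma> u - z) \<le> 1 / \<delta>"
    using assms D_le_1[of u] by (intro frac_le) (auto simp: chord_far_def)
  then show ?thesis using True by (simp add: norm_mult norm_divide mult_left_mono del: times_divide_eq_right)
qed (use assms in auto)

lemma chord_far_term_measurable:
  assumes f [measurable]: "f \<in> borel_measurable borel"
  shows "(\<lambda>u. trunc_integrand f z \<epsilon> u) \<in> borel_measurable N"
proof -
  have [measurable]: "indicator (chord_far z \<epsilon>) \<in> borel_measurable N"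
    by (rule measurable_restrict_space1) simp
  show ?thesis by measurable
qed

text \<open>
  Being defined by a strict inequality, the sets \<open>chord_far z \<delta>\<close> increase to \<open>chord_far z \<epsilon>\<close>
  as \<open>\<delta>\<close> decreases to \<open>\<epsilon>\<close>; dominated convergence applies.
\<close>

lemma trunc_right_continuous:
  assumes f: "f \<in> borel_measurable borel" and int: "integrable N (\<lambda>u. f (\<gamma> u))" and \<epsilon>: "0 < \<epsilon>"
  shows "(trunc f z \<longlongrightarrow> trunc f z \<epsilon>) (at_right \<epsilon>)"
proof (rule tendsto_at_right_sequentially[of \<epsilon> "\<epsilon> + 1"])
  fix S :: "nat \<Rightarrow> real" assume S: "\<And>n. \<epsilon> < S n" "S \<longlonglongrightarrow> \<epsilon>"
  show "(\<lambda>n. trunc f z (S n)) \<longlonglongrightarrow> trunc f z \<epsilon>"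
    unfolding trunc_def
  proof (rule integral_dominated_convergence)
    show "integrable N (\<lambda>u. cmod (f (\<gamma> u)) * (1 / \<epsilon>))" using int by (intro integrable_mult_left integrable_norm)
    show "AE u in N. (\<lambda>n. trunc_integrand f z (S n) u) \<longlonglongrightarrow> trunc_integrand f z \<epsilon> u"
    proof (rule AE_I2)
      fix u
      have "\<forall>\<^sub>F n in sequentially. indicator (chord_far z (S n)) u = (indicator (chord_far z \<epsilon>) u :: real)"
      proof (cases "u \<in> chord_far z \<epsilon>")
        case True
        then have "\<forall>\<^sub>F n in sequentially. S n < cmod (\<gamma> u - z)"
          using order_tendstoD(2)[OF S(2)] by (auto simp: chord_far_def)
        then show ?thesis by eventually_elim (use True in \<open>auto simp: chord_far_def indicator_def\<close>)
      next
        case False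
        then have "u \<notin> chord_far z (S n)" for n using S(1)[of n] by (auto simp: chord_far_def)
        then show ?thesis using False by simp
      qed
      then have "\<forall>\<^sub>F n in sequentially. trunc_integrand f z (S n) u = trunc_integrand f z \<epsilon> u"
        by eventually_elim simp
      then show "(\<lambda>n. trunc_integrand f z (S n) u) \<longlonglongrightarrow> trunc_integrand f z \<epsilon> u"
        by (rule tendsto_eventually)
    qed
    show "AE u in N. cmod (trunc_integrand f z (S n) u) \<le> cmod (f (\<gamma> u)) * (1 / \<epsilon>)" for n
      using \<epsilon> S(1)[of n] by (intro AE_I2 chord_far_kernel_le) auto
  qed (intro chord_far_term_measurable f)+
qed simp

lemma pv_set_borel:
  assumes f: "f \<in> borel_measurable borel" and int: "integrable N (\<lambda>u. f (\<gamma> u))"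
  shows "{z. has_cauchy_pv \<gamma> l f z} \<in> sets borel"
proof -
  note [measurable] = trunc_measurable[OF f]
  have T: "truncated_cauchy_integral \<gamma> l f z = trunc f z" for z
    by (rule ext) (rule truncated_cauchy_integral_eq[OF f])
  have iff: "(\<exists>w. (trunc f z \<longlongrightarrow> w) (at_right 0)) \<longleftrightarrow>
      (\<forall>n. \<exists>m. \<forall>p\<in>small_rats m. \<forall>q\<in>small_rats m. norm (trunc f z p - trunc f z q) \<le> 1 / real (Suc n))" for z
    by (rule right_continuous_tendsto_iff_rational_Cauchy[OF trunc_right_continuous[OF f int]])
  have "{z. has_cauchy_pv \<gamma> l f z}
    = (\<Inter>n. \<Union>m. \<Inter>p\<in>small_rats m. \<Inter>q\<in>small_rats m. {z. norm (trunc f z p - trunc f z q) \<le> 1 / real (Suc n)})"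
    unfolding has_cauchy_pv_def T iff by (simp only: Collect_all_eq Collect_ex_eq Collect_ball_eq)
  also have "\<dots> \<in> sets borel"
  proof -
    have 1: "countable (small_rats m)" for m
      by (rule countable_subset[OF _ countable_rat]) (auto simp: small_rats_def)
    have 2: "{z. norm (trunc f z p - trunc f z q) \<le> 1 / real (Suc n)} \<in> sets borel" for p q n
      by measurable
    show ?thesis
      by (intro sets.countable_INT'' sets.countable_UN'' 1 2) auto
  qed
  finally show ?thesis .
qed

text \<open>
  On the Borel set where the principal value exists it is the limit along \<open>1 / (k + 1)\<close>; elsewhere
  \<open>Lim\<close> returns the fixed default value of \<open>THE\<close>, so that the operator is Borel on the whole plane.
\<close>

lemma cauchy_operator_borel:
  assumes f: "f \<in> borel_measurable borel" and int: "integrable N (\<lambda>u. f (\<gamma> u))"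
  shows "cauchy_operator \<gamma> l f \<in> borel_measurable borel"
proof -
  note [measurable] = trunc_measurable[OF f] pv_set_borel[OF f int]
  have T: "truncated_cauchy_integral \<gamma> l f z = trunc f z" for z
    by (rule ext) (rule truncated_cauchy_integral_eq[OF f])
  have "cauchy_operator \<gamma> l f z = 1 / (2 * of_real pi * \<i>) *
      (if z \<in> {z. has_cauchy_pv \<gamma> l f z} then lim (\<lambda>k. trunc f z (1 / real (Suc k))) else (THE w. False))" for z
  proof (cases "has_cauchy_pv \<gamma> l f z")
    case True
    then show ?thesis
      unfolding cauchy_operator_def has_cauchy_pv_def T using Lim_at_right_eq_lim_seq[of "trunc f z"] by auto
  next
    case False
    then have "Lim (at_right 0) (trunc f z) = (THE w. False)"
      unfolding has_cauchy_pv_def T Topological_Spaces.Lim_def by simp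
    then show ?thesis using False by (simp add: cauchy_operator_def T)
  qed
  then have "cauchy_operator \<gamma> l f = (\<lambda>z. 1 / (2 * of_real pi * \<i>) *
      (if z \<in> {z. has_cauchy_pv \<gamma> l f z} then lim (\<lambda>k. trunc f z (1 / real (Suc k))) else (THE w. False)))"
    by (rule ext)
  moreover have "(\<lambda>z. lim (\<lambda>k. trunc f z (1 / real (Suc k)))) \<in> borel_measurable borel"
    by (rule borel_measurable_lim_metric) measurable
  ultimately show ?thesis
    by (simp only:) (intro borel_measurable_times borel_measurable_const measurable_If_set; simp)
qed

section \<open>The principal value for functions of finite energy\<close>

text \<open>
  Subtracting \<open>f (\<gamma> t)\<close> leaves an absolutely convergent integral, to which dominated convergence
  applies, and \<open>f (\<gamma> t)\<close> times a truncated integral of the constant function.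
\<close>

lemma trunc_tendsto:
  assumes f [measurable]: "f \<in> borel_measurable borel"
    and t: "0 < t" "t < l" and der: "(\<gamma> has_vector_derivative v) (at t)"
    and reg: "integrable N (reg_integrand (\<lambda>u. f (\<gamma> u)) t)"
  shows "(trunc f (\<gamma> t) \<longlongrightarrow> reg_cauchy (\<lambda>u. f (\<gamma> u)) t + f (\<gamma> t) * cauchy_jump) (at_right 0)"
proof -
  let ?I = "\<lambda>\<epsilon> u. indicator (chord_far (\<gamma> t) \<epsilon>) u :: real"
  let ?r = "reg_integrand (\<lambda>u. f (\<gamma> u)) t"
  have tm [measurable]: "(\<lambda>u. t) \<in> N \<rightarrow>\<^sub>M N" using t by (simp add: space_N)
  have Im [measurable]: "?I \<epsilon> \<in> borel_measurable N" for \<epsilon>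
    by (rule measurable_restrict_space1) simp
  have rm: "?r \<in> borel_measurable N" using reg by (rule borel_measurable_integrable)
  have A: "((\<lambda>\<epsilon>. LINT u|N. ?I \<epsilon> u *\<^sub>R ?r u) \<longlongrightarrow> reg_cauchy (\<lambda>u. f (\<gamma> u)) t) (at_right 0)"
  proof (rule tendsto_at_right_sequentially[of 0 1])
    fix S :: "nat \<Rightarrow> real" assume S: "\<And>n. 0 < S n" "S \<longlonglongrightarrow> 0"
    show "(\<lambda>n. LINT u|N. ?I (S n) u *\<^sub>R ?r u) \<longlonglongrightarrow> reg_cauchy (\<lambda>u. f (\<gamma> u)) t"
      unfolding reg_cauchy_def
    proof (rule integral_dominated_convergence)
      show "integrable N (\<lambda>u. cmod (?r u))" using reg by (rule integrable_norm)
      show "(\<lambda>u. ?I (S n) u *\<^sub>R ?r u) \<in> borel_measurable N" for n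
        by (intro borel_measurable_scaleR Im rm)
      show "AE u in N. (\<lambda>n. ?I (S n) u *\<^sub>R ?r u) \<longlonglongrightarrow> ?r u"
      proof (rule AE_I2)
        fix u assume u: "u \<in> space N"
        have "\<forall>\<^sub>F n in sequentially. ?I (S n) u *\<^sub>R ?r u = ?r u"
        proof (cases "\<gamma> u = \<gamma> t")
          case True
          then have "?r u = 0" by (simp add: reg_integrand_def)
          then show ?thesis by simp
        next
          case False
          then have "0 < cmod (\<gamma> u - \<gamma> t)" by simp
          then have "\<forall>\<^sub>F n in sequentially. S n < cmod (\<gamma> u - \<gamma> t)" by (rule order_tendstoD(2)[OF S(2)])
          then show ?thesis by eventually_elim (simp add: indicator_chord_far_N[OF u])
        qed
        then show "(\<lambda>n. ?I (S n) u *\<^sub>R ?r u) \<longlonglongrightarrow> ?r u" by (rule tendsto_eventually)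
      qed
      show "AE u in N. cmod (?I (S n) u *\<^sub>R ?r u) \<le> cmod (?r u)" for n
        by (intro AE_I2) (auto simp: indicator_def)
    qed (rule rm)
  qed simp
  have ext: "(\<lambda>u. indicator {0..l} u *\<^sub>R (?I \<epsilon> u *\<^sub>R cauchy_kernel t u)) = (\<lambda>u. ?I \<epsilon> u *\<^sub>R cauchy_kernel t u)" for \<epsilon>
    by (auto simp: indicator_def chord_far_def fun_eq_iff)
  have Kint: "integrable N (\<lambda>u. ?I \<epsilon> u *\<^sub>R cauchy_kernel t u)" if "0 < \<epsilon>" for \<epsilon>
    using kernel_integrable_chord_far[OF that, of "\<gamma> t", folded cauchy_kernel_def]
    by (subst integrable_restrict_space) (auto simp only: ext set_integrable_def, simp)
  have Keq: "(LINT u|N. ?I \<epsilon> u *\<^sub>R cauchy_kernel t u) = chord_far_integral t \<epsilon>" for \<epsilon>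
    by (subst integral_restrict_space) (auto simp only: ext set_lebesgue_integral_def, simp)
  have split: "trunc f (\<gamma> t) \<epsilon> = (LINT u|N. ?I \<epsilon> u *\<^sub>R ?r u) + f (\<gamma> t) * (chord_far_integral t \<epsilon>)"
    if \<epsilon>: "0 < \<epsilon>" for \<epsilon>
  proof -
    have pt: "i *\<^sub>R (a * k) = i *\<^sub>R ((a - b) * k) + b * (i *\<^sub>R k)" for i and a b k :: complex
      by (simp add: algebra_simps)
    have rint: "integrable N (\<lambda>u. ?I \<epsilon> u *\<^sub>R ?r u)"
      by (rule Bochner_Integration.integrable_bound[OF reg]) (auto intro!: borel_measurable_scaleR Im rm AE_I2 simp: indicator_def)
    have "trunc f (\<gamma> t) \<epsilon> = (LINT u|N. ?I \<epsilon> u *\<^sub>R ?r u + f (\<gamma> t) * (?I \<epsilon> u *\<^sub>R cauchy_kernel t u))"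
      unfolding trunc_def
      unfolding reg_integrand_def cauchy_kernel_def by (intro Bochner_Integration.integral_cong refl pt)
    also have "\<dots> = (LINT u|N. ?I \<epsilon> u *\<^sub>R ?r u) + (LINT u|N. f (\<gamma> t) * (?I \<epsilon> u *\<^sub>R cauchy_kernel t u))"
      by (intro Bochner_Integration.integral_add rint integrable_mult_right Kint \<epsilon>)
    also have "(LINT u|N. f (\<gamma> t) * (?I \<epsilon> u *\<^sub>R cauchy_kernel t u)) = f (\<gamma> t) * (LINT u|N. ?I \<epsilon> u *\<^sub>R cauchy_kernel t u)"
      by (rule integral_mult_right_zero)
    finally show ?thesis by (simp only: Keq)
  qed
  have "((\<lambda>\<epsilon>. (LINT u|N. ?I \<epsilon> u *\<^sub>R ?r u) + f (\<gamma> t) * (chord_far_integral t \<epsilon>))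
     \<longlongrightarrow> reg_cauchy (\<lambda>u. f (\<gamma> u)) t + f (\<gamma> t) * cauchy_jump) (at_right 0)"
    by (intro tendsto_add tendsto_mult tendsto_const A chord_far_integral_tendsto[OF der t])
  then show ?thesis
    by (rule Lim_transform_eventually) (auto simp: eventually_at_right_field split intro!: exI[of _ 1])
qed

end

section \<open>Boundedness on the Sobolev space\<close>

definition op_const :: "real \<Rightarrow> real \<Rightarrow> real" where
  "op_const c s = (1 / c) powr (1 + 2 * s) * (2 * (4 / c)\<^sup>2 + 2 * reg_const c s)"

context chord_arc_loop
begin

lemma arc_length_measure_N: "arc_length_measure \<gamma> l = distr N borel \<gamma>"
  by (simp add: arc_length_measure_def)

lemma borel_measurable_arc_length_measure: "borel_measurable (arc_length_measure \<gamma> l) = borel_measurable borel"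
  by (intro measurable_cong_sets) (simp_all add: arc_length_measure_def)

lemma Hs_energy_eq:
  assumes f [measurable]: "f \<in> borel_measurable borel"
  shows "Hs_energy (arc_length_measure \<gamma> l) s f
    = (\<integral>\<^sup>+t. \<integral>\<^sup>+u. ennreal ((cmod (f (\<gamma> t) - f (\<gamma> u)))\<^sup>2 / cmod (\<gamma> t - \<gamma> u) powr (1 + 2 * s)) \<partial>N \<partial>N)"
proof -
  interpret sigma_finite_measure N
    using pair_sigma_finite_N by (simp add: pair_sigma_finite_def)
  let ?F = "\<lambda>z w. ennreal ((cmod (f z - f w))\<^sup>2 / cmod (z - w) powr (1 + 2 * s))"
  have inner: "(\<integral>\<^sup>+w. ?F z w \<partial>distr N borel \<gamma>) = (\<integral>\<^sup>+u. ?F z (\<gamma> u) \<partial>N)" for z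
    by (rule nn_integral_distr) measurable
  have "(\<lambda>z. \<integral>\<^sup>+u. ?F z (\<gamma> u) \<partial>N) \<in> borel_measurable borel" by measurable
  then show ?thesis
    unfolding Hs_energy_def arc_length_measure_N inner by (intro nn_integral_distr) measurable
qed

lemma chord_weight_bounds:
  assumes tu: "t \<in> {0..l}" "u \<in> {0..l}" and p: "0 < p"
  shows "arc_dist l t u powr (- p) \<le> 1 / cmod (\<gamma> t - \<gamma> u) powr p"
    "1 / cmod (\<gamma> t - \<gamma> u) powr p \<le> (1 / c) powr p * arc_dist l t u powr (- p)"
proof -
  define x where "x = arc_dist l t u"
  define y where "y = cmod (\<gamma> t - \<gamma> u)"
  have x0: "0 \<le> x" unfolding x_def by (rule arc_dist_nonneg[OF tu])
  have xy: "y \<le> x" "c * x \<le> y" using chord_le_arc_dist[OF tu] chord_arc[OF tu] by (auto simp: x_def y_def)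
  have "x powr (- p) \<le> 1 / y powr p \<and> 1 / y powr p \<le> (1 / c) powr p * x powr (- p)"
  proof (cases "x = 0")
    case True
    then have "y = 0" using xy by (simp add: y_def)
    then show ?thesis using True by simp
  next
    case False
    then have x: "0 < x" using x0 by simp
    then have "0 < c * x" using c_pos by simp
    then have y: "0 < y" using xy by linarith
    have "y powr p \<le> x powr p" using xy y p by (intro powr_mono2) auto
    moreover have "(c * x) powr p \<le> y powr p" using xy x c_pos p by (intro powr_mono2) auto
    moreover have "(c * x) powr p = c powr p * x powr p" using x c_pos by (simp add: powr_mult)
    ultimately show ?thesis using x y c_pos
      by (auto simp: powr_minus_divide powr_divide divide_simps)
  qed
  then show "arc_dist l t u powr (- p) \<le> 1 / cmod (\<gamma> t - \<gamma> u) powr p"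
    "1 / cmod (\<gamma> t - \<gamma> u) powr p \<le> (1 / c) powr p * arc_dist l t u powr (- p)"
    by (auto simp: x_def y_def)
qed

lemma arc_energy_le_Hs_energy:
  assumes f: "f \<in> borel_measurable borel" and s: "0 < s"
  shows "arc_energy s (\<lambda>t. f (\<gamma> t)) \<le> Hs_energy (arc_length_measure \<gamma> l) s f"
  unfolding Hs_energy_eq[OF f] arc_energy_def
proof (intro nn_integral_mono ennreal_leI)
  fix t u assume "t \<in> space N" "u \<in> space N"
  then have tu: "t \<in> {0..l}" "u \<in> {0..l}" by (auto simp: space_N)
  have "(cmod (f (\<gamma> u) - f (\<gamma> t)))\<^sup>2 * arc_dist l t u powr (- (1 + 2 * s)) \<le> (cmod (f (\<gamma> u) - f (\<gamma> t)))\<^sup>2 * (1 / cmod (\<gamma> t - \<gamma> u) powr (1 + 2 * s))"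
    using s by (intro mult_left_mono chord_weight_bounds(1)[OF tu]) auto
  then show "(cmod (f (\<gamma> u) - f (\<gamma> t)))\<^sup>2 * arc_dist l t u powr (- 1 - 2 * s) \<le> (cmod (f (\<gamma> t) - f (\<gamma> u)))\<^sup>2 / cmod (\<gamma> t - \<gamma> u) powr (1 + 2 * s)"
    by (simp add: norm_minus_commute)
qed

lemma Hs_energy_le_arc_energy:
  assumes f [measurable]: "f \<in> borel_measurable borel" and s: "0 < s"
  shows "Hs_energy (arc_length_measure \<gamma> l) s f \<le> ennreal ((1 / c) powr (1 + 2 * s)) * arc_energy s (\<lambda>t. f (\<gamma> t))"
proof -
  interpret NN: pair_sigma_finite N N by (rule pair_sigma_finite_N)
  let ?k = "(1 / c) powr (1 + 2 * s)"
  have "Hs_energy (arc_length_measure \<gamma> l) s f \<le> (\<integral>\<^sup>+t. \<integral>\<^sup>+u. ennreal ?k * osc_density s (\<lambda>t. f (\<gamma> t)) t u \<partial>N \<partial>N)"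
    unfolding Hs_energy_eq[OF f]
  proof (intro nn_integral_mono)
    fix t u assume "t \<in> space N" "u \<in> space N"
    then have tu: "t \<in> {0..l}" "u \<in> {0..l}" by (auto simp: space_N)
    have "(cmod (f (\<gamma> t) - f (\<gamma> u)))\<^sup>2 * (1 / cmod (\<gamma> t - \<gamma> u) powr (1 + 2 * s)) \<le> (cmod (f (\<gamma> t) - f (\<gamma> u)))\<^sup>2 * (?k * arc_dist l t u powr (- (1 + 2 * s)))"
      using s by (intro mult_left_mono chord_weight_bounds(2)[OF tu]) auto
    then have "(cmod (f (\<gamma> t) - f (\<gamma> u)))\<^sup>2 / cmod (\<gamma> t - \<gamma> u) powr (1 + 2 * s) \<le> ?k * ((cmod (f (\<gamma> u) - f (\<gamma> t)))\<^sup>2 * arc_dist l t u powr (- 1 - 2 * s))"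
      by (simp add: norm_minus_commute mult_ac)
    then have "ennreal ((cmod (f (\<gamma> t) - f (\<gamma> u)))\<^sup>2 / cmod (\<gamma> t - \<gamma> u) powr (1 + 2 * s)) \<le> ennreal (?k * ((cmod (f (\<gamma> u) - f (\<gamma> t)))\<^sup>2 * arc_dist l t u powr (- 1 - 2 * s)))"
      by (rule ennreal_leI)
    also have "\<dots> = ennreal ?k * osc_density s (\<lambda>t. f (\<gamma> t)) t u"
      by (rule ennreal_mult') simp
    finally show "ennreal ((cmod (f (\<gamma> t) - f (\<gamma> u)))\<^sup>2 / cmod (\<gamma> t - \<gamma> u) powr (1 + 2 * s)) \<le> ennreal ?k * osc_density s (\<lambda>t. f (\<gamma> t)) t u" .
  qed
  also have "\<dots> = ennreal ?k * arc_energy s (\<lambda>t. f (\<gamma> t))"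
    unfolding arc_energy_def by (rule iterated_nn_integral_cmult) measurable
  finally show ?thesis .
qed

lemma arc_energy_cong_AE:
  assumes "AE t in N. h t = k t"
  shows "arc_energy s h = arc_energy s k"
  unfolding arc_energy_def
proof (rule nn_integral_cong_AE)
  show "AE t in N. (\<integral>\<^sup>+u. ennreal ((cmod (h u - h t))\<^sup>2 * arc_dist l t u powr (- 1 - 2 * s)) \<partial>N)
    = (\<integral>\<^sup>+u. ennreal ((cmod (k u - k t))\<^sup>2 * arc_dist l t u powr (- 1 - 2 * s)) \<partial>N)"
    using assms
  proof eventually_elim
    case (elim t)
    show ?case
      by (rule nn_integral_cong_AE) (use assms in eventually_elim, simp add: elim)
  qed
qed

lemma tangent_AE: "AE t in N. 0 < t \<and> t < l \<and> (\<gamma> has_vector_derivative D t) (at t)"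
proof -
  have "AE t in lborel. t \<in> {0..l} \<longrightarrow> 0 < t \<and> t < l \<and> (\<gamma> has_vector_derivative D t) (at t)"
    using D_derivative AE_lborel_singleton[of 0] AE_lborel_singleton[of l]
    by eventually_elim auto
  then show ?thesis by (subst AE_restrict_space_iff) auto
qed

text \<open>
  Almost everywhere \<open>T f\<close> is a linear combination of \<open>f\<close> and the regularised integral, with
  coefficients bounded in terms of \<open>c\<close>.  Null sets affect neither the energy nor the \<open>L\<^sup>2\<close> norm.
\<close>

theorem cauchy_operator_bounded_arc_length:
  assumes s: "0 < s" "s < 1" and fH: "f \<in> Hs_space (arc_length_measure \<gamma> l) s"
  shows "AE z in arc_length_measure \<gamma> l. has_cauchy_pv \<gamma> l f z"
    "cauchy_operator \<gamma> l f \<in> Hs_space (arc_length_measure \<gamma> l) s"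
    "Hs_energy (arc_length_measure \<gamma> l) s (cauchy_operator \<gamma> l f)
      \<le> ennreal (op_const c s) * Hs_energy (arc_length_measure \<gamma> l) s f"
proof -
  let ?\<sigma> = "arc_length_measure \<gamma> l"
  let ?T = "cauchy_operator \<gamma> l f"
  define h where "h t = f (\<gamma> t)" for t
  define g where "g = reg_cauchy h"
  define b where "b = 1 / (2 * of_real pi * \<i>)"
  define a where "a = b * cauchy_jump"
  have f [measurable]: "f \<in> borel_measurable borel"
    using fH by (simp add: Hs_space_def borel_measurable_arc_length_measure)
  have h [measurable]: "h \<in> borel_measurable N" unfolding h_def by measurable
  have g [measurable]: "g \<in> borel_measurable N" unfolding g_def by (rule reg_cauchy_measurable[OF h])
  have E: "Hs_energy ?\<sigma> s f < \<infinity>" using fH by (simp add: Hs_space_def)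
  have Eh: "arc_energy s h \<le> Hs_energy ?\<sigma> s f" unfolding h_def by (rule arc_energy_le_Hs_energy[OF f s(1)])
  then have fin: "arc_energy s h < \<infinity>" using E by (rule order.strict_trans1)
  have h2: "integrable N (\<lambda>t. (cmod (h t))\<^sup>2)"
    using fH unfolding Hs_space_def arc_length_measure_N h_def
    by (auto simp: integrable_distr_eq)
  interpret fN: finite_measure N by (rule finite_measure_N)
  have hint: "integrable N h"
  proof (rule Bochner_Integration.integrable_bound)
    show "integrable N (\<lambda>t. 1 + (cmod (h t))\<^sup>2)" using h2 by (intro Bochner_Integration.integrable_add) auto
    have "x \<le> 1 + x\<^sup>2" for x :: real using sum_squares_bound[of x 1] zero_le_power2[of x] by (simp; linarith)
    then show "AE t in N. norm (h t) \<le> norm (1 + (cmod (h t))\<^sup>2)" by (intro AE_I2) (simp add: abs_of_nonneg add_nonneg_nonneg)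
  qed (rule h)
  have hint': "integrable N (\<lambda>u. f (\<gamma> u))" using hint by (simp add: h_def[abs_def])
  have good: "AE t in N. integrable N (reg_integrand h t)"
    by (rule reg_integrand_integrable_AE[OF s(1) h fin])
  have T: "truncated_cauchy_integral \<gamma> l f z = trunc f z" for z
    by (rule ext) (rule truncated_cauchy_integral_eq[OF f])
  have key: "AE t in N. has_cauchy_pv \<gamma> l f (\<gamma> t) \<and> ?T (\<gamma> t) = a * h t + b * g t"
    using good tangent_AE
  proof eventually_elim
    case (elim t)
    have lim: "(trunc f (\<gamma> t) \<longlongrightarrow> g t + h t * cauchy_jump) (at_right 0)"
      unfolding g_def h_def[abs_def] by (rule trunc_tendsto[OF f]) (use elim in \<open>auto simp: h_def[abs_def]\<close>)
    have "Lim (at_right 0) (trunc f (\<gamma> t)) = g t + h t * cauchy_jump"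
      by (rule tendsto_Lim[OF _ lim]) simp
    then have "?T (\<gamma> t) = b * (g t + h t * cauchy_jump)" by (simp add: cauchy_operator_def T b_def)
    then show ?case using lim by (auto simp: has_cauchy_pv_def T a_def algebra_simps)
  qed
  have Tm [measurable]: "?T \<in> borel_measurable borel" by (rule cauchy_operator_borel[OF f hint'])
  show "AE z in ?\<sigma>. has_cauchy_pv \<gamma> l f z"
    unfolding arc_length_measure_N
    by (subst AE_distr_iff) (use pv_set_borel[OF f hint'] key in auto)
  have b1: "cmod b \<le> 1" "cmod a \<le> 4 / c"
  proof -
    have "cmod b = 1 / (2 * pi)" by (simp add: b_def norm_divide norm_mult)
    also have "\<dots> \<le> 1" using pi_ge_two by (simp add: divide_le_eq)
    finally show "cmod b \<le> 1" .
    then show "cmod a \<le> 4 / c"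
      unfolding a_def norm_mult using cauchy_jump_bound
      by (meson mult_left_le_one_le norm_ge_zero order_trans)
  qed
  have rc: "0 \<le> reg_const c s" by (simp add: reg_const_def)
  have ET: "arc_energy s (\<lambda>t. ?T (\<gamma> t)) \<le> ennreal (2 * (4 / c)\<^sup>2 + 2 * reg_const c s) * arc_energy s h"
  proof -
    have "arc_energy s (\<lambda>t. ?T (\<gamma> t)) = arc_energy s (\<lambda>t. a * h t + b * g t)"
      by (rule arc_energy_cong_AE) (use key in eventually_elim, simp)
    also have "\<dots> \<le> ennreal (2 * (cmod a)\<^sup>2) * arc_energy s h + ennreal (2 * (cmod b)\<^sup>2) * arc_energy s g"
      by (rule arc_energy_linear_combination_le[OF h g])
    also have "\<dots> \<le> ennreal (2 * (4 / c)\<^sup>2) * arc_energy s h + ennreal (2 * 1\<^sup>2) * (ennreal (reg_const c s) * arc_energy s h)"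
      using b1 arc_energy_reg_cauchy_le[OF s h fin] unfolding g_def
      by (intro add_mono mult_mono ennreal_leI mult_left_mono power_mono) auto
    also have "\<dots> = (ennreal (2 * (4 / c)\<^sup>2) + ennreal (2 * reg_const c s)) * arc_energy s h"
      using rc by (simp add: distrib_right ennreal_mult' mult.assoc del: power_divide)
    also have "ennreal (2 * (4 / c)\<^sup>2) + ennreal (2 * reg_const c s) = ennreal (2 * (4 / c)\<^sup>2 + 2 * reg_const c s)"
      using rc by (intro ennreal_plus[symmetric]) auto
    finally show ?thesis .
  qed
  have "Hs_energy ?\<sigma> s ?T \<le> ennreal ((1 / c) powr (1 + 2 * s)) * arc_energy s (\<lambda>t. ?T (\<gamma> t))"
    by (rule Hs_energy_le_arc_energy[OF Tm s(1)])
  also have "\<dots> \<le> ennreal ((1 / c) powr (1 + 2 * s)) * (ennreal (2 * (4 / c)\<^sup>2 + 2 * reg_const c s) * Hs_energy ?\<sigma> s f)"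
    by (intro mult_left_mono order_trans[OF ET] Eh) auto
  also have "\<dots> = ennreal (op_const c s) * Hs_energy ?\<sigma> s f"
    using rc unfolding op_const_def by (subst ennreal_mult) (auto simp: mult.assoc)
  finally show bound: "Hs_energy ?\<sigma> s ?T \<le> ennreal (op_const c s) * Hs_energy ?\<sigma> s f" .
  have finT: "Hs_energy ?\<sigma> s ?T < \<infinity>"
    by (rule order.strict_trans1[OF bound]) (use E in \<open>simp add: ennreal_mult_less_top\<close>)
  have "integrable N (\<lambda>t. (cmod (?T (\<gamma> t)))\<^sup>2)"
  proof -
    have g2: "integrable N (\<lambda>t. (cmod (g t))\<^sup>2)"
    proof (rule integrableI_bounded)
      have "(\<integral>\<^sup>+t. ennreal (norm ((cmod (g t))\<^sup>2)) \<partial>N) \<le> ennreal (4 * (l powr (2 * s) / (2 * s)) / c\<^sup>2) * arc_energy s h"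
        using reg_cauchy_square_integral_le[OF s(1) h] by (simp add: g_def)
      also have "\<dots> < \<infinity>" using fin by (simp add: ennreal_mult_less_top)
      finally show "(\<integral>\<^sup>+t. ennreal (norm ((cmod (g t))\<^sup>2)) \<partial>N) < \<infinity>" .
    qed measurable
    have "integrable N (\<lambda>t. (cmod (a * h t + b * g t))\<^sup>2)"
    proof (rule Bochner_Integration.integrable_bound)
      show "integrable N (\<lambda>t. 2 * (cmod a)\<^sup>2 * (cmod (h t))\<^sup>2 + 2 * (cmod b)\<^sup>2 * (cmod (g t))\<^sup>2)"
        by (intro Bochner_Integration.integrable_add integrable_mult_right h2 g2)
      show "AE t in N. norm ((cmod (a * h t + b * g t))\<^sup>2) \<le> norm (2 * (cmod a)\<^sup>2 * (cmod (h t))\<^sup>2 + 2 * (cmod b)\<^sup>2 * (cmod (g t))\<^sup>2)"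
      proof (rule AE_I2)
        fix t
        define p q where "p = cmod a * cmod (h t)" and "q = cmod b * cmod (g t)"
        have "(cmod (a * h t + b * g t))\<^sup>2 \<le> (p + q)\<^sup>2"
          unfolding p_def q_def norm_mult[symmetric] by (intro power_mono norm_triangle_ineq) auto
        also have "\<dots> \<le> 2 * p\<^sup>2 + 2 * q\<^sup>2" using sum_squares_bound[of p q] by (simp add: power2_sum)
        also have "\<dots> = 2 * (cmod a)\<^sup>2 * (cmod (h t))\<^sup>2 + 2 * (cmod b)\<^sup>2 * (cmod (g t))\<^sup>2"
          by (simp add: p_def q_def power_mult_distrib)
        finally show "norm ((cmod (a * h t + b * g t))\<^sup>2) \<le> norm (2 * (cmod a)\<^sup>2 * (cmod (h t))\<^sup>2 + 2 * (cmod b)\<^sup>2 * (cmod (g t))\<^sup>2)"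
          by simp
      qed
    qed measurable
    moreover have "(\<lambda>t. (cmod (?T (\<gamma> t)))\<^sup>2) \<in> borel_measurable N" by measurable
    moreover have "AE t in N. (cmod (a * h t + b * g t))\<^sup>2 = (cmod (?T (\<gamma> t)))\<^sup>2"
      using key by eventually_elim simp
    ultimately show ?thesis by (rule integrable_cong_AE_imp)
  qed
  then have "integrable ?\<sigma> (\<lambda>z. (cmod (?T z))\<^sup>2)"
    unfolding arc_length_measure_N by (subst integrable_distr_eq) auto
  then show "?T \<in> Hs_space ?\<sigma> s"
    using finT by (simp add: Hs_space_def borel_measurable_arc_length_measure)
qed

end

text \<open>
  A Borel version of the derivative is the limit of difference quotients along \<open>1 / (k + 1)\<close>; it is
  replaced by 0 where the value of \<open>lim\<close> is not bounded by 1.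
\<close>

lemma nonexpansive_borel_tangent:
  fixes \<gamma> :: "real \<Rightarrow> complex"
  assumes l: "0 < l" and \<gamma>: "\<And>x y. x \<in> {0..l} \<Longrightarrow> y \<in> {0..l} \<Longrightarrow> cmod (\<gamma> x - \<gamma> y) \<le> \<bar>x - y\<bar>"
  obtains D where "D \<in> borel_measurable borel"
    "AE t in lborel. t \<in> {0<..<l} \<longrightarrow> (\<gamma> has_vector_derivative D t) (at t)"
    "\<And>t. cmod (D t) \<le> 1"
proof -
  define \<psi> where "\<psi> x = \<gamma> (max 0 (min l x))" for x
  have lip: "cmod (\<psi> x - \<psi> y) \<le> \<bar>x - y\<bar>" for x y
  proof -
    have "cmod (\<psi> x - \<psi> y) \<le> \<bar>max 0 (min l x) - max 0 (min l y)\<bar>"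
      unfolding \<psi>_def using l by (intro \<gamma>) auto
    also have "\<dots> \<le> \<bar>x - y\<bar>" by auto
    finally show ?thesis .
  qed
  have "continuous_on UNIV \<psi>"
    by (rule lipschitz_on_continuous_on[of 1]) (auto intro!: lipschitz_onI lip simp: dist_norm)
  then have [measurable]: "\<psi> \<in> borel_measurable borel" by (rule borel_measurable_continuous_onI)
  define Q where "Q k x = (\<psi> (x + 1 / real (Suc k)) - \<psi> x) /\<^sub>R (1 / real (Suc k))" for k x
  define P where "P x = lim (\<lambda>k. Q k x)" for x
  have Qm: "Q k \<in> borel_measurable borel" for k unfolding Q_def by measurable
  have [measurable]: "P \<in> borel_measurable borel"
    unfolding P_def by (rule borel_measurable_lim_metric) (rule Qm)
  define D where "D x = (if cmod (P x) \<le> 1 then P x else 0)" for x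
  have Qb: "cmod (Q k x) \<le> 1" for k x
    using lip[of "x + 1 / real (Suc k)" x] by (simp add: Q_def divide_simps mult.commute)
  have DP: "D x = v" if v: "(\<psi> has_vector_derivative v) (at x)" for x v
  proof -
    have "(\<lambda>k. 1 / real (Suc k)) \<longlonglongrightarrow> 0" by (rule LIMSEQ_Suc[OF lim_1_over_n])
    from tendsto_add[OF tendsto_const this, of x] have "(\<lambda>k. x + 1 / real (Suc k)) \<longlonglongrightarrow> x" by simp
    then have "filterlim (\<lambda>k. x + 1 / real (Suc k)) (at x) sequentially"
      by (simp add: filterlim_at)
    from filterlim_compose[OF has_vector_derivative_quotient_tendsto[OF v] this]
    have lim: "(\<lambda>k. Q k x) \<longlonglongrightarrow> v" by (simp add: Q_def)
    then have "cmod v \<le> 1" using Qb by (intro tendsto_upperbound[OF tendsto_norm[OF lim]]) auto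
    moreover have "P x = v" unfolding P_def by (rule limI[OF lim])
    ultimately show ?thesis by (simp add: D_def)
  qed
  have "AE x in lborel. \<exists>v. (\<psi> has_vector_derivative v) (at x)"
    using lipschitz_complex_differentiable_AE[of \<psi>, OF lip] by (simp add: AE_completion_iff)
  then have "AE t in lborel. t \<in> {0<..<l} \<longrightarrow> (\<gamma> has_vector_derivative D t) (at t)"
  proof eventually_elim
    case (elim t)
    show ?case
    proof
      assume t: "t \<in> {0<..<l}"
      from elim obtain v where v: "(\<psi> has_vector_derivative v) (at t)" by blast
      have "(\<gamma> has_vector_derivative v) (at t)"
        by (rule has_vector_derivative_transform_within_open[OF v, of "{0<..<l}"]) (use t in \<open>auto simp: \<psi>_def\<close>)
      then show "(\<gamma> has_vector_derivative D t) (at t)" by (simp add: DP[OF v])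
    qed
  qed
  moreover have "D \<in> borel_measurable borel" unfolding D_def by measurable
  moreover have "cmod (D t) \<le> 1" for t by (simp add: D_def)
  ultimately show ?thesis using that by blast
qed

theorem theorem1p5:
  fixes \<Gamma> :: "complex set" and s :: real
  assumes "chord_arc_curve \<Gamma>" and "0 < s" and "s < 1"
  shows "\<exists>C>0. \<forall>\<gamma> len. arc_length_parametrization \<gamma> len \<Gamma> \<longrightarrow>
           (\<forall>f \<in> Hs_space (arc_length_measure \<gamma> len) s.
              (AE z in arc_length_measure \<gamma> len. has_cauchy_pv \<gamma> len f z) \<and>
              cauchy_operator \<gamma> len f \<in> Hs_space (arc_length_measure \<gamma> len) s \<and>
              Hs_norm (arc_length_measure \<gamma> len) s (cauchy_operator \<gamma> len f)
                \<le> C * Hs_norm (arc_length_measure \<gamma> len) s f)"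
proof -
  obtain c where c: "0 < c"
    "\<And>\<gamma> l x y. arc_length_parametrization \<gamma> l \<Gamma> \<Longrightarrow> x \<in> {0..l} \<Longrightarrow> y \<in> {0..l} \<Longrightarrow>
       c * arc_dist l x y \<le> cmod (\<gamma> x - \<gamma> y)"
    using chord_arc_lower_bound[OF assms(1)] by blast
  define K where "K = op_const c s"
  have "0 \<le> reg_const c s" by (simp add: reg_const_def)
  then have K: "0 < K" unfolding K_def op_const_def using c(1) by (intro mult_pos_pos add_pos_nonneg) auto
  show ?thesis
  proof (intro exI[of _ "sqrt K"] conjI allI impI ballI)
    show "0 < sqrt K" using K by simp
    fix \<gamma> l f
    assume par: "arc_length_parametrization \<gamma> l \<Gamma>" and f: "f \<in> Hs_space (arc_length_measure \<gamma> l) s"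
    have l: "0 < l" "\<gamma> l = \<gamma> 0" using par by (auto simp: arc_length_parametrization_def)
    have ne: "cmod (\<gamma> x - \<gamma> y) \<le> \<bar>x - y\<bar>" if "x \<in> {0..l}" "y \<in> {0..l}" for x y
      by (rule arc_length_parametrization_nonexpansive[OF par that])
    obtain D where D: "D \<in> borel_measurable borel"
      "AE t in lborel. t \<in> {0<..<l} \<longrightarrow> (\<gamma> has_vector_derivative D t) (at t)"
      "\<And>t. cmod (D t) \<le> 1"
      using nonexpansive_borel_tangent[OF l(1) ne] by metis
    interpret chord_arc_loop \<gamma> D l c
      by unfold_locales (use c l ne par D in auto)
    note bd = cauchy_operator_bounded_arc_length[OF assms(2,3) f]
    show "AE z in arc_length_measure \<gamma> l. has_cauchy_pv \<gamma> l f z"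
      "cauchy_operator \<gamma> l f \<in> Hs_space (arc_length_measure \<gamma> l) s"
      by (rule bd)+
    have "enn2real (Hs_energy (arc_length_measure \<gamma> l) s (cauchy_operator \<gamma> l f))
      \<le> enn2real (ennreal K * Hs_energy (arc_length_measure \<gamma> l) s f)"
      using f by (intro enn2real_mono bd(3)[folded K_def]) (auto simp: Hs_space_def ennreal_mult_less_top)
    also have "\<dots> = K * enn2real (Hs_energy (arc_length_measure \<gamma> l) s f)"
      using K by (simp add: enn2real_mult)
    finally show "Hs_norm (arc_length_measure \<gamma> l) s (cauchy_operator \<gamma> l f) \<le> sqrt K * Hs_norm (arc_length_measure \<gamma> l) s f"
      unfolding Hs_norm_def by (simp add: real_sqrt_mult[symmetric])
  qed
qed

end
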